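(* Let $g:(1,+\infty)\to(0,1)$ be the function $g(\beta)=\max\left\{\frac{\beta-2}{\beta^2-1},\frac{(\beta-1)^2}{\beta^3+\beta^2-\beta}\right\}$. Fix rational numbers $\beta,\gamma$ such that $\min\{\beta,\gamma\}<0$ and $\beta+\gamma>2-g(\max\{\beta,\gamma\})$. For any positive integer $\Delta$, there is an FPTAS for $Z_G$, where the input graph $G$ has maximum degree at most $\Delta$. Without the bounded degree requirement, there is a quasi-polynomial time approximation scheme for $Z_G$.
   Context: Graphs are finite undirected multigraphs, possibly with self-loops and parallel edges. For fixed $\beta,\gamma$, let $A=\begin{bmatrix}\beta&1\\1&\gamma\end{bmatrix}$ and for a graph $G=(V,E)$ define $Z_G=\sum_{\sigma\in\{0,1\}^V}\prod_{\{u,v\}\in E}A_{\sigma(u),\sigma(v)}$. *)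

theory Defs
  imports
    Complex_Main
    "HOL-Library.Uprod"
    "HOL-Library.Multiset"
    "HOL-Library.FuncSet"
    "HOL-Computational_Algebra.Polynomial"
begin

section \<open>Multigraphs and the partition function\<close>

text \<open>An edge is an unordered pair, \<open>Upair v v\<close> being a self-loop; edge multiplicities are
  given by the multiset.\<close>

record 'v mgraph =
  verts :: "'v set"
  edges :: "'v uprod multiset"

definition wf_mgraph :: "'v mgraph \<Rightarrow> bool" where
  "wf_mgraph G \<longleftrightarrow> finite (verts G) \<and> (\<forall>e \<in># edges G. set_uprod e \<subseteq> verts G)"

text \<open>A self-loop contributes two to the degree of its vertex.\<close>

definition mdegree :: "'v mgraph \<Rightarrow> 'v \<Rightarrow> nat" where
  "mdegree G v =
     (\<Sum>e \<in># edges G. if e = Upair v v then 2 else if v \<in> set_uprod e then 1 else 0)"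

definition max_degree_le :: "'v mgraph \<Rightarrow> nat \<Rightarrow> bool" where
  "max_degree_le G \<Delta> \<longleftrightarrow> (\<forall>v \<in> verts G. mdegree G v \<le> \<Delta>)"

definition spin_matrix :: "rat \<Rightarrow> rat \<Rightarrow> nat \<Rightarrow> nat \<Rightarrow> rat" where
  "spin_matrix \<beta> \<gamma> i j = (if i = 0 \<and> j = 0 then \<beta> else if i = 1 \<and> j = 1 then \<gamma> else 1)"

lift_definition edge_weight :: "rat \<Rightarrow> rat \<Rightarrow> ('v \<Rightarrow> nat) \<Rightarrow> 'v uprod \<Rightarrow> rat" is
  "\<lambda>\<beta> \<gamma> \<sigma> (u, v). spin_matrix \<beta> \<gamma> (\<sigma> u) (\<sigma> v)"
  by (auto simp: spin_matrix_def eq_upair_def)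

lemma edge_weight_Upair [simp]:
  "edge_weight \<beta> \<gamma> \<sigma> (Upair u v) = spin_matrix \<beta> \<gamma> (\<sigma> u) (\<sigma> v)"
  by transfer simp

definition Z :: "rat \<Rightarrow> rat \<Rightarrow> 'v mgraph \<Rightarrow> rat" where
  "Z \<beta> \<gamma> G = (\<Sum>\<sigma> \<in> verts G \<rightarrow>\<^sub>E {0, 1}. \<Prod>e \<in># edges G. edge_weight \<beta> \<gamma> \<sigma> e)"


section \<open>The function \<open>g\<close>\<close>

text \<open>Only the values on \<open>{1<..}\<close> are meaningful.\<close>

definition g :: "real \<Rightarrow> real" where
  "g x = max ((x - 2) / (x\<^sup>2 - 1)) ((x - 1)\<^sup>2 / (x ^ 3 + x\<^sup>2 - x))"

lemma g_range:
  assumes "1 < x"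
  shows "g x \<in> {0<..<1}"
proof -
  have x2: "x\<^sup>2 > x" using assms by (simp add: power2_eq_square)
  have x3: "x ^ 3 > x" using assms power_strict_increasing[of 1 3 x] by simp
  have d: "x ^ 3 + x\<^sup>2 - x > 0" using x2 x3 assms by linarith
  have "(x - 2) / (x\<^sup>2 - 1) < 1" using x2 assms by (simp add: field_simps)
  moreover have "(x - 1)\<^sup>2 / (x ^ 3 + x\<^sup>2 - x) < 1"
    using d x3 assms by (simp add: power2_diff field_simps)
  moreover have "(x - 1)\<^sup>2 / (x ^ 3 + x\<^sup>2 - x) > 0" using d assms by simp
  ultimately show ?thesis by (auto simp: g_def)
qed


section \<open>Model of computation\<close>

text \<open>
  A first-order call-by-value functional language over binary trees (pure LISP with the single
  atom \<open>Atom\<close>), with unit cost for every elementary operation.  Values are immutable and can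
  only be compared with \<open>Atom\<close>, so every operation is a constant number of pointer operations on a
  shared representation; up to a polynomial, time in this model is therefore time on a
  Turing machine (N. D. Jones, Computability and Complexity from a Programming Perspective,
  MIT Press 1997).

  A program is a list of bodies of mutually recursive unary functions, the function with
  index 0 being the main one.  Variables are de Bruijn indices into the environment; a body
  starts with its argument as the only variable.
\<close>

datatype data = Atom | Node data data

datatype expr =
    EVar nat
  | EAtom
  | EPair expr expr
  | EFst expr
  | ESnd expr
  | EIf expr expr expr
  | ELet expr expr
  | ECall nat expr

type_synonym program = "expr list"

fun dfst :: "data \<Rightarrow> data" where
  "dfst Atom = Atom"
| "dfst (Node a b) = a"

fun dsnd :: "data \<Rightarrow> data" where
  "dsnd Atom = Atom"
| "dsnd (Node a b) = b"

text \<open>\<open>eval P env e v t\<close>: expression \<open>e\<close> evaluates to \<open>v\<close> in exactly \<open>t\<close> steps.  Divergence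
  is the absence of a derivation.\<close>

inductive eval :: "program \<Rightarrow> data list \<Rightarrow> expr \<Rightarrow> data \<Rightarrow> nat \<Rightarrow> bool" for P where
  eval_Var: "i < length env \<Longrightarrow> eval P env (EVar i) (env ! i) 1"
| eval_Atom: "eval P env EAtom Atom 1"
| eval_Pair: "eval P env e1 v1 t1 \<Longrightarrow> eval P env e2 v2 t2 \<Longrightarrow>
    eval P env (EPair e1 e2) (Node v1 v2) (t1 + t2 + 1)"
| eval_Fst: "eval P env e v t \<Longrightarrow> eval P env (EFst e) (dfst v) (t + 1)"
| eval_Snd: "eval P env e v t \<Longrightarrow> eval P env (ESnd e) (dsnd v) (t + 1)"
| eval_If_true: "eval P env c v t \<Longrightarrow> v \<noteq> Atom \<Longrightarrow> eval P env e1 v1 t1 \<Longrightarrow>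
    eval P env (EIf c e1 e2) v1 (t + t1 + 1)"
| eval_If_false: "eval P env c Atom t \<Longrightarrow> eval P env e2 v2 t2 \<Longrightarrow>
    eval P env (EIf c e1 e2) v2 (t + t2 + 1)"
| eval_Let: "eval P env e1 v1 t1 \<Longrightarrow> eval P (v1 # env) e2 v2 t2 \<Longrightarrow>
    eval P env (ELet e1 e2) v2 (t1 + t2 + 1)"
| eval_Call: "eval P env e v t \<Longrightarrow> f < length P \<Longrightarrow> eval P [v] (P ! f) w s \<Longrightarrow>
    eval P env (ECall f e) w (t + s + 1)"

inductive_cases eval_elims:
  "eval P env (EVar i) v t"
  "eval P env EAtom v t"
  "eval P env (EPair e1 e2) v t"
  "eval P env (EFst e) v t"
  "eval P env (ESnd e) v t"
  "eval P env (EIf c e1 e2) v t"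
  "eval P env (ELet e1 e2) v t"
  "eval P env (ECall f e) v t"

lemma eval_deterministic:
  assumes "eval P env e v t" and "eval P env e w s"
  shows "w = v \<and> s = t"
  using assms
proof (induction arbitrary: w s rule: eval.induct)
  case eval_Var
  then show ?case by (auto elim: eval_elims)
next
  case eval_Atom
  then show ?case by (auto elim: eval_elims)
next
  case eval_Pair
  from eval_Pair.prems show ?case by (rule eval_elims) (auto dest: eval_Pair.IH)
next
  case eval_Fst
  from eval_Fst.prems show ?case by (rule eval_elims) (auto dest: eval_Fst.IH)
next
  case eval_Snd
  from eval_Snd.prems show ?case by (rule eval_elims) (auto dest: eval_Snd.IH)
next
  case eval_If_true
  from eval_If_true.prems show ?case
    by (rule eval_elims) (use eval_If_true.hyps in \<open>auto dest: eval_If_true.IH\<close>)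
next
  case eval_If_false
  from eval_If_false.prems show ?case
    by (rule eval_elims) (auto dest: eval_If_false.IH)
next
  case eval_Let
  from eval_Let.prems show ?case by (rule eval_elims) (auto dest: eval_Let.IH)
next
  case eval_Call
  from eval_Call.prems show ?case by (rule eval_elims) (auto dest: eval_Call.IH)
qed

definition run :: "program \<Rightarrow> data \<Rightarrow> data \<Rightarrow> nat \<Rightarrow> bool" where
  "run P x y t \<longleftrightarrow> P \<noteq> [] \<and> eval P [x] (P ! 0) y t"


section \<open>Encodings\<close>

fun enc_list :: "data list \<Rightarrow> data" where
  "enc_list [] = Atom"
| "enc_list (x # xs) = Node x (enc_list xs)"

definition enc_bit :: "bool \<Rightarrow> data" where
  "enc_bit b = (if b then Node Atom Atom else Atom)"

text \<open>Binary, least significant bit first, without leading zeros.\<close>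

fun enc_nat :: "nat \<Rightarrow> data" where
  "enc_nat n = (if n = 0 then Atom else Node (enc_bit (odd n)) (enc_nat (n div 2)))"

declare enc_nat.simps [simp del]

definition enc_int :: "int \<Rightarrow> data" where
  "enc_int k = Node (enc_bit (k < 0)) (enc_nat (nat \<bar>k\<bar>))"

text \<open>Fractions need not be in lowest terms.\<close>

definition encodes_rat :: "data \<Rightarrow> rat \<Rightarrow> bool" where
  "encodes_rat d r \<longleftrightarrow>
     (\<exists>a b. b > 0 \<and> d = Node (enc_int a) (enc_nat b) \<and> r = of_int a / of_nat b)"

text \<open>A graph is presented by the list of its vertices and the list of its edges (parallel edges
  being repeated), in any order and with either order of the two ends of an edge.\<close>

definition encodes_graph :: "data \<Rightarrow> nat mgraph \<Rightarrow> bool" where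
  "encodes_graph d G \<longleftrightarrow>
     (\<exists>vs es. distinct vs \<and> set vs = verts G \<and>
        image_mset (\<lambda>(u, v). Upair u v) (mset es) = edges G \<and>
        d = Node (enc_list (map enc_nat vs))
                 (enc_list (map (\<lambda>(u, v). Node (enc_nat u) (enc_nat v)) es)))"


section \<open>Approximation schemes\<close>

text \<open>\<open>P\<close> computes, for every graph in \<open>X\<close> and every rational \<open>\<epsilon> > 0\<close>, a rational with relative
  error at most \<open>\<epsilon>\<close>, in time bounded by \<open>T\<close> of the input length plus \<open>1/\<epsilon>\<close> (rounded up).
  The input length, which is the number of \<open>Node\<close> nodes, includes the encoding of \<open>\<epsilon>\<close>.\<close>

definition approximates ::
  "program \<Rightarrow> nat mgraph set \<Rightarrow> (nat mgraph \<Rightarrow> rat) \<Rightarrow> (nat \<Rightarrow> real) \<Rightarrow> bool" where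
  "approximates P X F T \<longleftrightarrow>
     (\<forall>G \<in> X. \<forall>\<epsilon> > 0. \<forall>x y. encodes_graph x G \<and> encodes_rat y \<epsilon> \<longrightarrow>
        (\<exists>z r t. run P (Node x y) z t \<and> encodes_rat z r \<and>
           \<bar>r - F G\<bar> \<le> \<epsilon> * \<bar>F G\<bar> \<and>
           real t \<le> T (size (Node x y) + nat \<lceil>1 / \<epsilon>\<rceil>)))"

definition has_FPTAS :: "nat mgraph set \<Rightarrow> (nat mgraph \<Rightarrow> rat) \<Rightarrow> bool" where
  "has_FPTAS X F \<longleftrightarrow>
     (\<exists>P (p :: real poly). approximates P X F (\<lambda>N. poly p (real N)))"

definition has_quasipoly_AS :: "nat mgraph set \<Rightarrow> (nat mgraph \<Rightarrow> rat) \<Rightarrow> bool" where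
  "has_quasipoly_AS X F \<longleftrightarrow>
     (\<exists>P (p :: real poly). approximates P X F (\<lambda>N. exp (poly p (ln (real N)))))"

end

theory Submission
  imports Defs "HOL-Complex_Analysis.Complex_Analysis"
begin

text \<open>
  By symmetry let \<open>\<beta>\<close> be the larger parameter.  The partition function is viewed as a polynomial in
  the other one.  At \<open>\<gamma> = 1 / \<beta>\<close> the weight matrix has rank one, and \<open>Z\<close> does not vanish on a disc
  around \<open>1 / \<beta>\<close> that contains the given \<open>\<gamma>\<close> in its interior: merging vertices and removing edges one
  at a time, the ratio of the contributions of spin 1 and spin 0 at a merged vertex stays in a region
  of the unit disc that shrinks with the degree.

  Hence \<open>Z\<close> is a telescoping product of factors \<open>1 + r(z)\<close>, one for each vertex, with \<open>r\<close> holomorphic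
  and bounded by 1 on a disc of radius \<open>R > 1\<close>, to be evaluated at \<open>z = - 1\<close>.  The Taylor polynomial
  of degree \<open>O(log (n / \<epsilon>))\<close> is accurate enough.  The ratio at a vertex is a product, over its edges, of
  Moebius transforms of ratios at the neighbours, in which the neighbour's ratio gains a factor \<open>z\<close>
  over what is already known, so the recursion has logarithmic depth and, if the degrees are bounded,
  polynomial size; otherwise its size is quasi-polynomial.
\<close>

section \<open>Partition sums with fixed spins\<close>

text \<open>Restoring one edge between the merged set \<open>T\<close> and a free vertex
  \<open>u\<close> gives the ratio (r + \<gamma> c) / (\<beta> + x). Here r, c and x are ratios
  without that edge: at \<open>T\<close>, at \<open>T\<close> merged with \<open>u\<close>, and at
  \<open>u\<close> alone, over sums in which \<open>u\<close> is otherwise fixed to spin 0. At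
  \<gamma> = 1 / \<beta> the edge factorises and leaves only a vertex weight 1 / \<beta> at
  \<open>u\<close>; hence arbitrary vertex weights in [0, 1] are carried along. For other \<gamma>
  the new ratio is this comparison ratio divided by \<beta>, plus the perturbation (\<gamma> - 1 /
  \<beta>) c / (\<beta> + x). The vertex of c has inherited the edges of \<open>u\<close>, so c is
  small exactly when x can be complicated, and this gain pays for the perturbation.

  On the side of the algorithm the target parameter is negative, but as a polynomial in z the
  parameter has nonnegative coefficients. Numerators and denominators can therefore be kept as lists
  of natural numbers, and signs enter only when a series is inverted and evaluated at -1.\<close>

definition ew :: "'c::comm_ring_1 \<Rightarrow> 'c \<Rightarrow> 'a set \<Rightarrow> 'a \<times> 'a \<Rightarrow> 'c" where
  "ew b c S e = (if fst e \<in> S \<and> snd e \<in> S then c else if fst e \<in> S \<or> snd e \<in> S then 1 else b)"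

definition wt :: "'c::comm_ring_1 \<Rightarrow> 'c \<Rightarrow> ('a \<Rightarrow> 'c) \<Rightarrow> ('a \<times> 'a) list \<Rightarrow> 'a set \<Rightarrow> 'c" where
  "wt b c l es S = (\<Prod>v\<in>S. l v) * (\<Prod>e\<leftarrow>es. ew b c S e)"

text \<open>The vertices in \<open>T\<close> have spin 1, those in \<open>F\<close> are free, and
  all others have spin 0, so fixing a vertex to spin 0 just means dropping it from
  \<open>F\<close>.\<close>

definition zs :: "'c::comm_ring_1 \<Rightarrow> 'c \<Rightarrow> ('a \<Rightarrow> 'c) \<Rightarrow> ('a \<times> 'a) list \<Rightarrow> 'a set \<Rightarrow> 'a set \<Rightarrow> 'c" where
  "zs b c l es T F = (\<Sum>S\<in>Pow F. wt b c l es (T \<union> S))"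

lemma zs_split:
  assumes "finite F" "u \<in> F"
  shows "zs b c l es T F = zs b c l es T (F - {u}) + zs b c l es (insert u T) (F - {u})"
proof -
  have "Pow F = Pow (F - {u}) \<union> insert u ` Pow (F - {u})"
    using assms(2) Pow_insert[of u "F - {u}"] by (simp add: insert_absorb)
  moreover have "Pow (F - {u}) \<inter> insert u ` Pow (F - {u}) = {}" by auto
  moreover have "inj_on (insert u) (Pow (F - {u}))"
    by (rule inj_onI) blast
  ultimately show ?thesis
    using assms(1) by (simp add: zs_def sum.union_disjoint sum.reindex)
qed

lemma wt_mset:
  fixes es :: "('a \<times> 'a) list" and b :: "'b::comm_ring_1"
  shows "mset es = mset es' \<Longrightarrow> wt b c l es S = wt b c l es' S"
proof -
  assume "mset es = mset es'"
  then have "prod_mset (image_mset f (mset es)) = prod_mset (image_mset f (mset es'))" for f :: "'a \<times> 'a \<Rightarrow> 'b"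
    by simp
  then show ?thesis unfolding wt_def by (simp flip: mset_map add: prod_mset_prod_list)
qed

lemma zs_mset: "mset es = mset es' \<Longrightarrow> zs b c l es T F = zs b c l es' T F"
  unfolding zs_def by (intro sum.cong refl wt_mset)

lemma wt_Cons: "wt b c l (e # es) S = ew b c S e * wt b c l es S"
  by (simp add: wt_def mult_ac)

lemma zs_Cons:
  assumes "\<And>S. S \<subseteq> F \<Longrightarrow> ew b c (T \<union> S) e = k"
  shows "zs b c l (e # es) T F = k * zs b c l es T F"
  unfolding zs_def wt_Cons sum_distrib_left by (rule sum.cong) (auto simp: assms)

lemma zs_empty: "zs b c l es T {} = wt b c l es T"
  by (simp add: zs_def)

lemma wt_fun_upd:
  assumes "finite S"
  shows "wt b c (l(u := k * l u)) es S = (if u \<in> S then k else 1) * wt b c l es S"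
proof (cases "u \<in> S")
  case True
  then have "(\<Prod>v\<in>S. (l(u := k * l u)) v) = k * l u * (\<Prod>v\<in>S - {u}. l v)"
    using assms by (subst prod.remove[of _ u]) (auto intro!: prod.cong)
  also have "\<dots> = k * (\<Prod>v\<in>S. l v)" using True assms by (subst (2) prod.remove[of _ u]) auto
  finally show ?thesis using True by (simp add: wt_def mult_ac)
next
  case False
  then have "(\<Prod>v\<in>S. (l(u := k * l u)) v) = (\<Prod>v\<in>S. l v)" by (intro prod.cong) auto
  with False show ?thesis by (simp add: wt_def)
qed

text \<open>For \<open>k\<close> = 1 / \<beta> the right-hand side is the sum with one more edge
  from \<open>u\<close> to a vertex of spin 1, taken at the rank-one parameter \<gamma> = 1 /
  \<beta>.\<close>

lemma zs_fun_upd: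
  assumes "finite F" "finite T" "u \<in> F" "u \<notin> T"
  shows "zs b c (l(u := k * l u)) es T F
       = zs b c l es T (F - {u}) + k * zs b c l es (insert u T) (F - {u})"
proof -
  have fin: "finite (T \<union> S)" if "S \<subseteq> F - {u}" for S
    using that assms finite_subset[of S F] by auto
  have "zs b c (l(u := k * l u)) es T (F - {u}) = zs b c l es T (F - {u})"
    unfolding zs_def using assms(4) fin by (intro sum.cong refl) (auto simp: wt_fun_upd)
  moreover have "zs b c (l(u := k * l u)) es (insert u T) (F - {u}) = k * zs b c l es (insert u T) (F - {u})"
    unfolding zs_def sum_distrib_left using fin
    by (intro sum.cong refl) (subst wt_fun_upd, auto)
  ultimately show ?thesis by (simp add: zs_split[OF assms(1,3)])
qed

text \<open>The set \<open>T\<close> is treated as one merged vertex of spin 1: \<open>dg\<close> is its degree, an edge inside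
  \<open>T\<close> being a loop.  Edges from \<open>T\<close> to vertices outside \<open>F\<close>, which have spin 0, do not count.\<close>

definition de :: "'a set \<Rightarrow> 'a set \<Rightarrow> 'a \<times> 'a \<Rightarrow> nat" where
  "de T F e = (if fst e \<in> T \<and> snd e \<in> T then 2
     else if fst e \<in> T \<and> snd e \<in> F \<or> fst e \<in> F \<and> snd e \<in> T then 1 else 0)"

definition dg :: "('a \<times> 'a) list \<Rightarrow> 'a set \<Rightarrow> 'a set \<Rightarrow> nat" where
  "dg es T F = (\<Sum>e\<leftarrow>es. de T F e)"

lemma dg_mset: "mset es = mset es' \<Longrightarrow> dg es T F = dg es' T F"
proof -
  assume "mset es = mset es'"
  then have "sum_mset (image_mset (de T F) (mset es)) = sum_mset (image_mset (de T F) (mset es'))" by simp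
  then show ?thesis unfolding dg_def by (simp flip: mset_map add: sum_mset_sum_list)
qed

lemma dg_Cons [simp]: "dg (e # es) T F = de T F e + dg es T F"
  by (simp add: dg_def)

lemma dg_Nil [simp]: "dg [] T F = 0"
  by (simp add: dg_def)

lemma dg_mono: "F \<subseteq> F' \<Longrightarrow> dg es T F \<le> dg es T F'"
  unfolding dg_def by (rule sum_list_mono) (auto simp: de_def)

text \<open>An edge between \<open>u\<close> and \<open>T\<close> counts once on each side and
  becomes a loop of the merged vertex; loops count twice so that degrees add.\<close>

lemma dg_insert:
  assumes "u \<in> F" "T \<inter> F = {}"
  shows "dg es (insert u T) (F - {u}) = dg es T F + dg es {u} (F - {u} \<union> T)"
proof (induction es)
  case (Cons e es)
  have "de (insert u T) (F - {u}) e = de T F e + de {u} (F - {u} \<union> T) e"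
    using assms by (cases e) (auto simp: de_def)
  with Cons show ?case by simp
qed simp

lemma dg_remove:
  assumes "dg es {u} (F - {u} \<union> T) = 0" "u \<in> F" "T \<inter> F = {}"
  shows "dg es T (F - {u}) = dg es T F"
  using assms
proof (induction es)
  case (Cons e es)
  then have "de T (F - {u}) e = de T F e"
    by (cases e) (auto simp: de_def split: if_splits)
  with Cons show ?case by simp
qed simp

lemma dg_pos_cases:
  assumes "dg es T F > 0"
  obtains e es' where "mset es = mset (e # es')" "fst e \<in> T" "snd e \<in> T"
  | e es' v u where "mset es = mset (e # es')" "e = (v, u) \<or> e = (u, v)" "v \<in> T" "u \<in> F" 
proof -
  obtain e where e: "e \<in> set es" "de T F e \<noteq> 0"
  proof (rule ccontr)
    assume "\<not> thesis"
    then have "\<forall>e \<in> set es. de T F e = 0" using that by blast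
    then have "dg es T F = 0" by (simp add: dg_def)
    with assms show False by simp
  qed
  then have m: "mset es = mset (e # remove1 e es)" by simp
  from e(2) consider "fst e \<in> T" "snd e \<in> T" | "fst e \<in> T" "snd e \<in> F" | "fst e \<in> F" "snd e \<in> T"
    unfolding de_def by presburger
  then show ?thesis
  proof cases
    case 1 then show ?thesis by (rule that(1)[OF m])
  next
    case 2 then show ?thesis by (intro that(2)[OF m, of "fst e" "snd e"]) simp_all
  next
    case 3 then show ?thesis by (intro that(2)[OF m, of "snd e" "fst e"]) simp_all
  qed
qed

text \<open>An edge that meets \<open>T\<close> has its other end at spin 0, because
  \<open>T\<close> has degree 0. Raising \<open>T\<close> to spin 1 changes the weight of such an
  edge from \<open>b\<close> to 1, so \<open>k\<close> is a product of vertex weights and factors 1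
  / \<open>b\<close>, all of them in [0, 1].\<close>

lemma dg0_factor:
  fixes l :: "'a \<Rightarrow> real" and b :: real and c :: complex
  assumes "dg es T F = 0" "T \<inter> F = {}" "finite T" "finite F" "b \<ge> 1" "\<forall>v. 0 \<le> l v \<and> l v \<le> 1"
  shows "\<exists>k. 0 \<le> k \<and> k \<le> 1 \<and>
    (\<forall>S. S \<subseteq> F \<longrightarrow> wt (of_real b) c (\<lambda>v. of_real (l v)) es (T \<union> S)
       = of_real k * wt (of_real b) c (\<lambda>v. of_real (l v)) es S)"
  using assms(1)
proof (induction es)
  case Nil
  have "(\<Prod>v\<in>T \<union> S. complex_of_real (l v)) = of_real (\<Prod>v\<in>T. l v) * (\<Prod>v\<in>S. complex_of_real (l v))"
    if "S \<subseteq> F" for S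
    using assms(2-4) that finite_subset[OF that] by (subst prod.union_disjoint) auto
  moreover have "0 \<le> (\<Prod>v\<in>T. l v)" "(\<Prod>v\<in>T. l v) \<le> 1"
    using assms(6) by (auto intro: prod_nonneg prod_le_1)
  ultimately show ?case by (intro exI[of _ "\<Prod>v\<in>T. l v"]) (auto simp: wt_def)
next
  case (Cons e es)
  then obtain k where k: "0 \<le> k" "k \<le> 1" "\<And>S. S \<subseteq> F \<Longrightarrow> wt (of_real b) c (\<lambda>v. of_real (l v)) es (T \<union> S)
       = of_real k * wt (of_real b) c (\<lambda>v. of_real (l v)) es S" by auto
  have d0: "de T F e = 0" using Cons.prems by simp
  show ?case
  proof (cases "fst e \<in> T \<or> snd e \<in> T")
    case True
    have *: "ew (complex_of_real b) c (T \<union> S) e = of_real (1 / b) * ew (of_real b) c S e" if "S \<subseteq> F" for S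
      using d0 True that assms(2,5) by (auto simp: de_def ew_def split: if_splits)
    have "0 \<le> k / b" "k / b \<le> 1" using k assms(5) by (auto simp: field_simps)
    with k(3) show ?thesis by (intro exI[of _ "k / b"]) (auto simp: wt_Cons * mult_ac)
  next
    case False
    then have "ew (complex_of_real b) c (T \<union> S) e = ew (of_real b) c S e" for S
      by (auto simp: ew_def)
    with k show ?thesis by (intro exI[of _ k]) (auto simp: wt_Cons)
  qed
qed

text \<open>One \<open>k\<close> serves all \<open>T'\<close> and \<open>F'\<close>. In the
  induction it is a common factor of ratios taken over different sets.\<close>

lemma dg0_zs:
  fixes l :: "'a \<Rightarrow> real" and b :: real and c :: complex
  assumes "dg es T F = 0" "T \<inter> F = {}" "finite T" "finite F" "b \<ge> 1" "\<forall>v. 0 \<le> l v \<and> l v \<le> 1"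
  obtains k where "0 \<le> k" "k \<le> 1"
    "\<And>T' F'. T' \<union> F' \<subseteq> F \<Longrightarrow> zs (of_real b) c (\<lambda>v. of_real (l v)) es (T \<union> T') F'
       = of_real k * zs (of_real b) c (\<lambda>v. of_real (l v)) es T' F'"
proof -
  from dg0_factor[OF assms, of c] obtain k where k: "0 \<le> k" "k \<le> 1"
    "\<And>S. S \<subseteq> F \<Longrightarrow> wt (of_real b) c (\<lambda>v. of_real (l v)) es (T \<union> S)
       = of_real k * wt (of_real b) c (\<lambda>v. of_real (l v)) es S" by (elim exE conjE) auto
  show ?thesis
  proof (rule that[OF k(1,2)])
    fix T' F' :: "'a set" assume sub: "T' \<union> F' \<subseteq> F"
    have "wt (of_real b) c (\<lambda>v. of_real (l v)) es (T \<union> T' \<union> S)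
       = of_real k * wt (of_real b) c (\<lambda>v. of_real (l v)) es (T' \<union> S)" if "S \<in> Pow F'" for S
      using k(3)[of "T' \<union> S"] sub that by (auto simp: Un_assoc)
    then show "zs (of_real b) c (\<lambda>v. of_real (l v)) es (T \<union> T') F'
       = of_real k * zs (of_real b) c (\<lambda>v. of_real (l v)) es T' F'"
      unfolding zs_def sum_distrib_left by (intro sum.cong refl)
  qed
qed

section \<open>Absence of zeros\<close>

text \<open>\<open>M\<close> is the radius allowed for \<gamma> around 1 / \<beta>, and
  \<open>q\<close> bounds the deviation (\<gamma> - 1 / \<beta>) x / (\<beta> + x) of an edge factor
  from 1 / \<beta>. Norms of ratios are at most \<kappa>1 at degree 1 and \<kappa>2 at degree 2,
  with a factor \<rho> for each further degree. H2 to H4 keep the deviation within \<open>q\<close>,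
  H5 compares two lower bounds for |\<beta> + x|, H6 and H7 serve loops and leaves, and H9 to H11
  close the induction at a general edge.\<close>

locale zero_free =
  fixes \<beta> M q \<kappa>1 \<kappa>2 \<rho> :: real
  assumes beta: "\<beta> > 1" and M: "M > 0" and q: "q > 0" and k1: "\<kappa>1 = 1 / \<beta> + q" "\<kappa>1 < 1"
    and k2: "\<kappa>2 > 0" and rho: "0 < \<rho>" "\<rho> \<le> 1"
    and qM: "q \<le> M"
    and H2: "M \<le> q * (\<beta> + 1)"
    and H3: "M * \<kappa>2 \<le> q * (\<beta> - \<kappa>2)"
    and H4: "M * (q - 1 / \<beta>) \<le> q * (\<beta> + 1 / \<beta> - q)"
    and H5: "q - 1 / \<beta> \<le> \<kappa>2"
    and H6: "1 / \<beta>\<^sup>2 + M / \<beta> \<le> \<kappa>2"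
    and H7: "\<kappa>1 \<le> \<rho>" "\<kappa>2 \<le> \<rho>\<^sup>2" "\<kappa>1\<^sup>2 \<le> \<kappa>2"
    and H9: "\<kappa>1 / \<beta> + M * \<kappa>2 / min \<beta> (\<beta> + 1 / \<beta> - q) \<le> \<kappa>2"
    and H10: "\<kappa>1 / \<beta> + M * \<kappa>2 * \<rho> / (\<beta> - \<kappa>2) \<le> \<kappa>2"
    and H11: "\<kappa>2 \<le> \<kappa>1 * \<rho>"
begin

text \<open>The lower bound for |\<beta> + x| at degree at most 1. A ratio of degree 1 is k (1 /
  \<beta> + w) with 0 \<le> k \<le> 1 and |w| \<le> q, so its real part is at least the minimum of 0
  and 1 / \<beta> - q.\<close>

definition den where "den = min \<beta> (\<beta> + 1 / \<beta> - q)"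

text \<open>\<open>lev d\<close> is the invariant of the induction over the edges: it contains all ratios
  \<open>Z(T merged, spin 1) / Z(T merged, spin 0)\<close> at a merged vertex of degree \<open>d\<close>.  At \<open>d = 0\<close> the ratio
  is a product of vertex weights; at \<open>d = 1\<close> a norm bound alone is too weak to be preserved.\<close>

definition kap :: "nat \<Rightarrow> real" where
  "kap d = (if d = 0 then 1 else if d = 1 then \<kappa>1 else \<kappa>2 * \<rho> ^ (d - 2))"

definition lev :: "nat \<Rightarrow> complex \<Rightarrow> bool" where
  "lev d x \<longleftrightarrow> (d = 0 \<longrightarrow> (\<exists>k. 0 \<le> k \<and> k \<le> 1 \<and> x = of_real k)) \<and> cmod x \<le> kap d \<and>
     (d = 1 \<longrightarrow> M * cmod x \<le> q * cmod (of_real \<beta> + x) \<and> den \<le> cmod (of_real \<beta> + x))"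

section \<open>Bounds on a ratio, and on \<beta> plus a ratio, in terms of the degree\<close>

lemma k21: "\<kappa>2 \<le> \<kappa>1" using H11 rho k1 beta q
  by (smt (verit, best) mult_left_le zero_less_divide_1_iff)

lemma k1_pos: "\<kappa>1 > 0" using k1 q beta by (simp add: add_pos_pos)

lemma den_bounds: "\<beta> - \<kappa>2 \<le> den" "den > 0" "\<beta> - \<kappa>2 > 0" "den \<le> \<beta>"
  using H5 k21 k1 beta k2 by (auto simp: den_def min_def)

lemma kap_pos: "kap d > 0"
  using k1_pos k2 rho by (simp add: kap_def)

lemma kap_Suc_le: "kap (Suc d) \<le> kap d"
proof -
  consider "d = 0" | "d = 1" | n where "d = Suc (Suc n)" by (metis One_nat_def not0_implies_Suc)
  then show ?thesis
  proof cases
    case 3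
    have "\<kappa>2 * \<rho> ^ n * \<rho> \<le> \<kappa>2 * \<rho> ^ n" using k2 rho by (intro mult_left_le) auto
    with 3 show ?thesis by (simp add: kap_def mult_ac)
  qed (use k21 k1(2) in \<open>auto simp: kap_def\<close>)
qed

lemma kap_antimono: "d \<le> e \<Longrightarrow> kap e \<le> kap d"
  using lift_Suc_antimono_le[of kap] kap_Suc_le by blast

lemma kap_step: "d \<ge> 2 \<Longrightarrow> kap (d - 1) * \<kappa>1 \<le> kap d"
proof -
  assume "d \<ge> 2"
  then consider "d = 2" | n where "d = Suc (Suc (Suc n))"
    by (metis One_nat_def Suc_1 add_2_eq_Suc le_Suc_ex not0_implies_Suc plus_nat.add_0 add.commute)
  then show ?thesis
  proof cases
    case 1 with H7 show ?thesis by (simp add: kap_def power2_eq_square)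
  next
    case 2
    have "\<kappa>2 * \<rho> ^ n * \<kappa>1 \<le> \<kappa>2 * \<rho> ^ n * \<rho>" using H7 k2 rho by (intro mult_left_mono) auto
    with 2 show ?thesis by (simp add: kap_def mult_ac)
  qed
qed

text \<open>Reduces the general step to degree 2: the quotient of successive bounds is largest
  there, which is why H9 and H10 mention only \<kappa>1 and \<kappa>2.\<close>

lemma kap_ratio: "d \<ge> 2 \<Longrightarrow> kap (d - 1) * \<kappa>2 \<le> \<kappa>1 * kap d"
proof -
  assume "d \<ge> 2"
  then consider "d = 2" | n where "d = Suc (Suc (Suc n))"
    by (metis One_nat_def Suc_1 add_2_eq_Suc le_Suc_ex not0_implies_Suc plus_nat.add_0 add.commute)
  then show ?thesis
  proof cases
    case 1 then show ?thesis by (simp add: kap_def)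
  next
    case 2
    have "\<kappa>2 * \<rho> ^ n * \<kappa>2 \<le> \<kappa>2 * \<rho> ^ n * (\<kappa>1 * \<rho>)" using H11 k2 rho by (intro mult_left_mono) auto
    with 2 show ?thesis by (simp add: kap_def mult_ac)
  qed
qed

lemma lev_norm: "lev d x \<Longrightarrow> cmod x \<le> kap d"
  by (simp add: lev_def)

lemma lev_norm1: "lev d x \<Longrightarrow> cmod x \<le> 1"
  using lev_norm[of d x] kap_antimono[of 0 d] by (simp add: kap_def)

lemma lev_k1: "lev d x \<Longrightarrow> d > 0 \<Longrightarrow> cmod x \<le> \<kappa>1"
  using lev_norm[of d x] kap_antimono[of 1 d] by (simp add: kap_def)

lemma norm_beta_add: "cmod x \<le> k \<Longrightarrow> \<beta> - k \<le> cmod (of_real \<beta> + x)"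
  using norm_diff_ineq[of "of_real \<beta>" x] beta by simp

lemma lev_den1:
  assumes "lev d x" "d \<le> 1" shows "den \<le> cmod (of_real \<beta> + x)"
proof (cases "d = 1")
  case True then show ?thesis using assms by (simp add: lev_def)
next
  case False
  then obtain k where "0 \<le> k" "x = of_real k" using assms by (auto simp: lev_def)
  then have "cmod (of_real \<beta> + x) = \<beta> + k" using beta by (simp flip: of_real_add)
  then show ?thesis using den_bounds \<open>0 \<le> k\<close> by simp
qed

lemma lev_den:
  assumes "lev d x" shows "\<beta> - \<kappa>2 \<le> cmod (of_real \<beta> + x)"
proof (cases "d \<le> 1")
  case True then show ?thesis using lev_den1[OF assms] den_bounds by simp
next
  case False
  then have "kap d \<le> \<kappa>2" using kap_antimono[of 2 d] by (simp add: kap_def)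
  then show ?thesis using norm_beta_add[of x \<kappa>2] lev_norm[OF assms] by simp
qed

lemma lev_nz: "lev d x \<Longrightarrow> of_real \<beta> + x \<noteq> 0"
  using lev_den[of d x] den_bounds by auto

section \<open>The admissible region and its image under one edge\<close>

lemma le_unit:
  assumes "0 \<le> y" "y \<le> 1" shows "M * y \<le> q * (\<beta> + y)"
proof -
  have "M * y \<le> q * (\<beta> + 1) * y" using H2 assms by (intro mult_right_mono) auto
  also have "\<dots> = q * (\<beta> * y + y)" by (simp add: algebra_simps)
  also have "\<dots> \<le> q * (\<beta> + y)" using q assms beta by (intro mult_left_mono add_right_mono mult_left_le) auto
  finally show ?thesis .
qed

text \<open>Three different reasons by degree: the ratio is real and in [0, 1], or the inequality is
  part of the invariant, or the norm bound \<kappa>2 suffices by H3.\<close>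

lemma lev_common:
  assumes "lev d x" shows "M * cmod x \<le> q * cmod (of_real \<beta> + x)"
proof -
  consider "d = 0" | "d = 1" | "d \<ge> 2" by linarith
  then show ?thesis
  proof cases
    case 1
    then obtain k where k: "0 \<le> k" "k \<le> 1" "x = of_real k" using assms by (auto simp: lev_def)
    show ?thesis using le_unit[OF k(1,2)] k beta by (simp flip: of_real_add)
  next
    case 2 then show ?thesis using assms by (simp add: lev_def)
  next
    case 3
    then have c: "cmod x \<le> \<kappa>2" using kap_antimono[of 2 d] lev_norm[OF assms] by (simp add: kap_def)
    have "M * cmod x \<le> M * \<kappa>2" using c M by simp
    also have "\<dots> \<le> q * (\<beta> - \<kappa>2)" by (rule H3)
    also have "\<dots> \<le> q * cmod (of_real \<beta> + x)" using lev_den[OF assms] q by simp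
    finally show ?thesis .
  qed
qed

text \<open>At \<gamma> = 1 / \<beta> the Moebius map is the constant 1 / \<beta>; the second
  summand is the perturbation away from rank one.\<close>

lemma f_eq:
  fixes x \<gamma> :: complex
  assumes "of_real \<beta> + x \<noteq> 0"
  shows "(1 + \<gamma> * x) / (of_real \<beta> + x) = of_real (1 / \<beta>) + (\<gamma> - of_real (1 / \<beta>)) * (x / (of_real \<beta> + x))"
proof -
  have "of_real \<beta> \<noteq> (0::complex)" using beta by simp
  then have "1 + \<gamma> * x = of_real (1 / \<beta>) * (of_real \<beta> + x) + (\<gamma> - of_real (1 / \<beta>)) * x"
    by (simp add: field_simps)
  then show ?thesis using assms by (simp only: add_divide_distrib) (simp del: of_real_divide)
qed

lemma norm_p:
  assumes "lev d x" "cmod \<nu> \<le> M"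
  shows "cmod (\<nu> * (x / (of_real \<beta> + x))) \<le> q"
proof -
  have "cmod (\<nu> * (x / (of_real \<beta> + x))) \<le> M * (cmod x / cmod (of_real \<beta> + x))"
    unfolding norm_mult norm_divide using assms(2) by (intro mult_right_mono) auto
  also have "\<dots> \<le> q" using lev_common[OF assms(1)] lev_nz[OF assms(1)] by (simp add: field_simps)
  finally show ?thesis .
qed

lemma step_one:
  assumes "lev d x" "cmod (\<gamma> - of_real (1 / \<beta>)) \<le> M" "0 \<le> k" "k \<le> 1"
  shows "lev 1 (of_real k * ((1 + \<gamma> * x) / (of_real \<beta> + x)))"
proof -
  define w where "w = (\<gamma> - of_real (1 / \<beta>)) * (x / (of_real \<beta> + x))"
  define R where "R = of_real k * (of_real (1 / \<beta>) + w)"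
  have w: "cmod w \<le> q" unfolding w_def by (rule norm_p) fact+
  have kw: "k * cmod w \<le> k * q" using w assms by (intro mult_left_mono)
  have Rw: "\<bar>Re w\<bar> \<le> q" using w abs_Re_le_cmod[of w] by linarith
  have n1: "cmod R \<le> \<kappa>1"
  proof -
    have "cmod R \<le> 1 * (1 / \<beta> + cmod w)"
      unfolding R_def norm_mult using assms beta norm_triangle_ineq[of "of_real (1 / \<beta>)" w]
      by (intro mult_mono) (auto simp: norm_divide)
    with w k1 show ?thesis by simp
  qed
  have ReR: "Re R = k / \<beta> + k * Re w" by (simp add: R_def algebra_simps)
  have kRw: "\<bar>k * Re w\<bar> \<le> k * q" using Rw assms by (simp add: abs_mult mult_left_mono)
  have kk: "k * (q - 1 / \<beta>) \<le> max 0 (q - 1 / \<beta>)"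
    using assms by (cases "q - 1 / \<beta> \<ge> 0") (auto simp: mult_left_le_one_le mult_nonneg_nonpos max_def)
  have n2: "den \<le> cmod (of_real \<beta> + R)"
  proof -
    have "den \<le> \<beta> - max 0 (q - 1 / \<beta>)" by (auto simp: den_def max_def)
    also have "\<dots> \<le> \<beta> - k * (q - 1 / \<beta>)" using kk by simp
    also have "\<dots> \<le> \<beta> + Re R" using ReR kRw by (simp add: algebra_simps)
    also have "\<dots> = Re (of_real \<beta> + R)" by simp
    also have "\<dots> \<le> cmod (of_real \<beta> + R)" by (rule complex_Re_le_cmod)
    finally show ?thesis .
  qed
  \<comment> \<open>\<open>R\<close> lies in the disc with centre k / \<beta> and radius k q. As M
    \<ge> q, inserting the upper bound for |R|^2 on this disc only strengthens the squared
    inequality and makes it affine in \<open>y\<close> = Re R. It remains to check the two real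
    points of the circle, where it reads (M t)^2 \<le> (q (\<beta> + t))^2.\<close>
  have n3: "M * cmod R \<le> q * cmod (of_real \<beta> + R)"
  proof -
    define y where "y = Re R"
    have "(cmod (R - of_real (k / \<beta>)))\<^sup>2 \<le> (k * q)\<^sup>2"
      using kw assms by (intro power_mono) (auto simp: R_def algebra_simps norm_mult)
    then have sq: "(cmod R)\<^sup>2 \<le> (k * q)\<^sup>2 - (k / \<beta>)\<^sup>2 + 2 * (k / \<beta>) * y"
      by (simp add: cmod_power2 y_def power2_diff algebra_simps)
    have sq2: "(cmod (of_real \<beta> + R))\<^sup>2 = \<beta>\<^sup>2 + 2 * \<beta> * y + (cmod R)\<^sup>2"
      by (simp add: cmod_power2 y_def power2_sum algebra_simps)
    have yl: "k / \<beta> - k * q \<le> y" "y \<le> k / \<beta> + k * q" using ReR kRw by (auto simp: y_def)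
    define A where "A = 2 * (k / \<beta>) * (M\<^sup>2 - q\<^sup>2) - 2 * q\<^sup>2 * \<beta>"
    define C where "C = (M\<^sup>2 - q\<^sup>2) * ((k * q)\<^sup>2 - (k / \<beta>)\<^sup>2) - q\<^sup>2 * \<beta>\<^sup>2"
    have qM2: "0 \<le> M\<^sup>2 - q\<^sup>2" using qM q by (simp add: power_mono)
    have ends: "A * t + C = (M * t)\<^sup>2 - (q * (\<beta> + t))\<^sup>2" if "t = k / \<beta> - k * q \<or> t = k / \<beta> + k * q" for t
    proof -
      have "w\<^sup>2 - s\<^sup>2 + 2 * s * t = t\<^sup>2" if "t = s - w \<or> t = s + w" for w s :: real
        using that by (auto simp: algebra_simps power2_eq_square)
      from this[OF that] have "(k * q)\<^sup>2 - (k / \<beta>)\<^sup>2 + 2 * (k / \<beta>) * t = t\<^sup>2" .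
      moreover have "A * t + C = (M\<^sup>2 - q\<^sup>2) * ((k * q)\<^sup>2 - (k / \<beta>)\<^sup>2 + 2 * (k / \<beta>) * t) - 2 * q\<^sup>2 * \<beta> * t - q\<^sup>2 * \<beta>\<^sup>2"
        unfolding A_def C_def by (simp add: algebra_simps)
      ultimately have "A * t + C = (M\<^sup>2 - q\<^sup>2) * t\<^sup>2 - 2 * q\<^sup>2 * \<beta> * t - q\<^sup>2 * \<beta>\<^sup>2" by simp
      also have "\<dots> = (M * t)\<^sup>2 - (q * (\<beta> + t))\<^sup>2"
        by (simp add: power2_eq_square algebra_simps)
      finally show ?thesis .
    qed
    \<comment> \<open>The left end may be negative; then H4, scaled by \<open>k\<close>, takes over
      from the estimate on [0, 1].\<close>
    have e1: "A * (k / \<beta> - k * q) + C \<le> 0"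
    proof -
      have "\<bar>M * (k / \<beta> - k * q)\<bar> \<le> q * (\<beta> + (k / \<beta> - k * q))"
      proof (cases "k / \<beta> - k * q \<ge> 0")
        case True
        have "k / \<beta> \<le> 1" using assms beta by (simp add: field_simps)
        then have "k / \<beta> - k * q \<le> 1" using assms q by (smt (verit) mult_nonneg_nonneg)
        from le_unit[OF True this] True M show ?thesis by (simp add: abs_mult)
      next
        case False
        then have "\<bar>k / \<beta> - k * q\<bar> = k * q - k / \<beta>" by simp
        then have "\<bar>M * (k / \<beta> - k * q)\<bar> = k * (M * (q - 1 / \<beta>))"
          using M by (simp only: abs_mult abs_of_pos) (simp add: algebra_simps)
        also have "\<dots> \<le> k * (q * (\<beta> + 1 / \<beta> - q))" using H4 assms by (intro mult_left_mono)
        also have "\<dots> = q * (k * \<beta> + (k / \<beta> - k * q))" by (simp add: algebra_simps)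
        also have "\<dots> \<le> q * (\<beta> + (k / \<beta> - k * q))"
          using q assms beta by (intro mult_left_mono add_right_mono mult_left_le_one_le) auto
        finally show ?thesis .
      qed
      then have "\<bar>M * (k / \<beta> - k * q)\<bar>\<^sup>2 \<le> (q * (\<beta> + (k / \<beta> - k * q)))\<^sup>2"
        by (intro power_mono) auto
      then have "(M * (k / \<beta> - k * q))\<^sup>2 \<le> (q * (\<beta> + (k / \<beta> - k * q)))\<^sup>2" by simp
      with ends[of "k / \<beta> - k * q"] show ?thesis by simp
    qed
    have e2: "A * (k / \<beta> + k * q) + C \<le> 0"
    proof -
      have "k / \<beta> + k * q = k * \<kappa>1" using k1 by (simp add: algebra_simps)
      then have y: "0 \<le> k / \<beta> + k * q" "k / \<beta> + k * q \<le> 1" using assms k1 k1_pos by (auto simp: mult_le_one)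
      have "(M * (k / \<beta> + k * q))\<^sup>2 \<le> (q * (\<beta> + (k / \<beta> + k * q)))\<^sup>2"
        using le_unit[OF y] y M by (intro power_mono) auto
      with ends[of "k / \<beta> + k * q"] show ?thesis by simp
    qed
    have "A * y + C \<le> 0"
    proof (cases "A \<ge> 0")
      case True
      then have "A * y \<le> A * (k / \<beta> + k * q)" using yl by (intro mult_left_mono)
      with e2 show ?thesis by simp
    next
      case False
      then have "A * y \<le> A * (k / \<beta> - k * q)" using yl by (intro mult_left_mono_neg) auto
      with e1 show ?thesis by simp
    qed
    moreover have "(M\<^sup>2 - q\<^sup>2) * (cmod R)\<^sup>2 \<le> (M\<^sup>2 - q\<^sup>2) * ((k * q)\<^sup>2 - (k / \<beta>)\<^sup>2 + 2 * (k / \<beta>) * y)"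
      using qM2 sq by (rule mult_left_mono[rotated])
    ultimately have "(M\<^sup>2 - q\<^sup>2) * (cmod R)\<^sup>2 - 2 * q\<^sup>2 * \<beta> * y - q\<^sup>2 * \<beta>\<^sup>2 \<le> 0"
      unfolding A_def C_def by (simp add: algebra_simps)
    then have "(M * cmod R)\<^sup>2 \<le> (q * cmod (of_real \<beta> + R))\<^sup>2"
      unfolding power_mult_distrib sq2 by (simp add: algebra_simps)
    then show ?thesis using q by (simp add: power2_le_iff_abs_le)
  qed
  have "R = of_real k * ((1 + \<gamma> * x) / (of_real \<beta> + x))"
    unfolding R_def w_def using f_eq[OF lev_nz[OF assms(1)]] by simp
  with n1 n2 n3 show ?thesis by (simp add: lev_def kap_def)
qed

lemma gamma_div:
  assumes "cmod (\<gamma> - of_real (1 / \<beta>)) \<le> M"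
  shows "cmod (\<gamma> / of_real \<beta>) \<le> \<kappa>2"
proof -
  have "cmod \<gamma> \<le> 1 / \<beta> + M"
    using norm_triangle_sub[of \<gamma> "of_real (1 / \<beta>)"] assms beta by (simp add: norm_divide)
  then have "cmod \<gamma> / \<beta> \<le> (1 / \<beta> + M) / \<beta>" using beta by (intro divide_right_mono) auto
  also have "\<dots> = 1 / \<beta>\<^sup>2 + M / \<beta>" using beta by (simp add: field_simps power2_eq_square)
  finally show ?thesis using H6 beta by (simp add: norm_divide)
qed

text \<open>A loop uses up two degrees, and its factor of norm at most \<kappa>2 \<le> \<rho>^2 pays
  for them. Degrees 2 and 3 are separate because the bounds are not geometric there.\<close>

lemma step_loop:
  assumes "d \<ge> 2" "lev (d - 2) x" "cmod (\<gamma> - of_real (1 / \<beta>)) \<le> M"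
  shows "lev d (\<gamma> / of_real \<beta> * x)"
proof -
  have "cmod (\<gamma> / of_real \<beta> * x) \<le> \<kappa>2 * kap (d - 2)"
    unfolding norm_mult using gamma_div[OF assms(3)] lev_norm[OF assms(2)] k2 by (intro mult_mono) auto
  also have "\<dots> \<le> kap d"
  proof -
    consider "d = 2" | "d = 3" | n where "d = Suc (Suc (Suc (Suc n)))"
    proof -
      assume a: "d = 2 \<Longrightarrow> thesis" "d = 3 \<Longrightarrow> thesis" "\<And>n. d = Suc (Suc (Suc (Suc n))) \<Longrightarrow> thesis"
      have "d = 2 \<or> d = 3 \<or> d = Suc (Suc (Suc (Suc (d - 4))))" using assms(1) by presburger
      with a show thesis by blast
    qed
    then show ?thesis
    proof cases
      case 2
      have "\<kappa>2 * \<kappa>1 \<le> \<kappa>2 * \<rho>" using H7 k2 by simp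
      with 2 show ?thesis by (simp add: kap_def)
    next
      case 3
      have "\<kappa>2 * (\<kappa>2 * \<rho> ^ n) \<le> \<rho>\<^sup>2 * (\<kappa>2 * \<rho> ^ n)" using H7 k2 rho by (intro mult_right_mono) auto
      with 3 show ?thesis by (simp add: kap_def power2_eq_square mult_ac)
    qed (simp add: kap_def)
  qed
  finally show ?thesis using assms(1) by (simp add: lev_def)
qed

lemma step_leaf:
  assumes "d \<ge> 2" "lev (d - 1) r" "cmod (\<gamma> - of_real (1 / \<beta>)) \<le> M" "lev e x"
  shows "lev d (r * ((1 + \<gamma> * x) / (of_real \<beta> + x)))"
proof -
  have "cmod ((1 + \<gamma> * x) / (of_real \<beta> + x)) \<le> \<kappa>1"
    using step_one[OF assms(4,3), of 1] lev_norm[of 1 "(1 + \<gamma> * x) / (of_real \<beta> + x)"] by (simp add: kap_def)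
  then have "cmod (r * ((1 + \<gamma> * x) / (of_real \<beta> + x))) \<le> kap (d - 1) * \<kappa>1"
    unfolding norm_mult using lev_norm[OF assms(2)] kap_pos[of "d - 1"] by (intro mult_mono) auto
  also have "\<dots> \<le> kap d" by (rule kap_step) fact
  finally show ?thesis using assms(1) by (simp add: lev_def)
qed

text \<open>\<open>e\<close> is the number of degrees that the neighbour brings into the merge. For
  \<open>e\<close> = 1 the ratio \<open>x\<close> has degree at most 1 and the better denominator
  \<open>den\<close> is available. For larger \<open>e\<close> only \<beta> - \<kappa>2 is, but then
  \<open>c\<close> has degree at least \<open>d\<close> + 1 and gains a factor \<rho>.\<close>

lemma step_gen:
  assumes "d \<ge> 2" "e \<ge> 1" "dx \<le> e" "lev (d - 1) r" "lev (d - 1 + e) c" "lev dx x" "cmod \<nu> \<le> M"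
  shows "lev d (r / of_real \<beta> + \<nu> * c / (of_real \<beta> + x))"
proof -
  have *: "cmod (r / of_real \<beta> + \<nu> * c / (of_real \<beta> + x)) \<le> kap (d - 1) / \<beta> + M * kap (d - 1 + e) / D"
    if "0 < D" "D \<le> cmod (of_real \<beta> + x)" for D
  proof -
    have "cmod (r / of_real \<beta>) \<le> kap (d - 1) / \<beta>"
      unfolding norm_divide using lev_norm[OF assms(4)] beta by (simp add: divide_right_mono)
    moreover have "cmod (\<nu> * c / (of_real \<beta> + x)) \<le> M * kap (d - 1 + e) / D"
      unfolding norm_divide norm_mult using that M assms(7) lev_norm[OF assms(5)] kap_pos[of "d - 1 + e"]
      by (intro frac_le mult_mono mult_nonneg_nonneg) auto
    ultimately show ?thesis by (meson add_mono norm_triangle_le)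
  qed
  \<comment> \<open>By \<open>kap_ratio\<close> it is enough that the inequality holds at degree
    2.\<close>
  have fin: "kap (d - 1) / \<beta> + Q * kap d \<le> kap d" if "\<kappa>1 / \<beta> + Q * \<kappa>2 \<le> \<kappa>2" for Q
  proof -
    have "(kap (d - 1) / \<beta> + Q * kap d) * \<kappa>2 \<le> (\<kappa>1 / \<beta> + Q * \<kappa>2) * kap d"
      using kap_ratio[OF assms(1)] beta by (simp add: algebra_simps divide_right_mono)
    also have "\<dots> \<le> \<kappa>2 * kap d" using that kap_pos[of d] by (intro mult_right_mono) auto
    finally show ?thesis using k2 by (simp add: mult.commute)
  qed
  have "cmod (r / of_real \<beta> + \<nu> * c / (of_real \<beta> + x)) \<le> kap d"
  proof (cases "e = 1")
    case True
    have "den \<le> cmod (of_real \<beta> + x)" using lev_den1[OF assms(6)] assms(3) True by simp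
    from *[OF den_bounds(2) this] True assms(1)
    have "cmod (r / of_real \<beta> + \<nu> * c / (of_real \<beta> + x)) \<le> kap (d - 1) / \<beta> + (M / den) * kap d" by simp
    also have "\<dots> \<le> kap d" using H9 by (intro fin) (simp add: den_def)
    finally show ?thesis .
  next
    case False
    have "kap (d - 1 + e) \<le> kap (Suc d)" using False assms by (intro kap_antimono) auto
    moreover have "Suc d - 2 = Suc (d - 2)" using assms(1) by simp
    then have "kap (Suc d) = kap d * \<rho>" using assms(1) by (simp add: kap_def)
    ultimately have "M * kap (d - 1 + e) / (\<beta> - \<kappa>2) \<le> M * (kap d * \<rho>) / (\<beta> - \<kappa>2)"
      using den_bounds M by (intro divide_right_mono mult_left_mono) auto
    with *[OF den_bounds(3) lev_den[OF assms(6)]]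
    have "cmod (r / of_real \<beta> + \<nu> * c / (of_real \<beta> + x)) \<le> kap (d - 1) / \<beta> + (M * \<rho> / (\<beta> - \<kappa>2)) * kap d"
      by (simp add: mult_ac)
    also have "\<dots> \<le> kap d" using H10 by (intro fin) (simp add: mult_ac)
    finally show ?thesis .
  qed
  then show ?thesis using assms(1) by (simp add: lev_def)
qed

section \<open>Absence of zeros by induction over the edges\<close>

lemma zs_recursion:
  fixes l :: "'a \<Rightarrow> real"
  assumes "e = (v, u) \<or> e = (u, v)" "v \<in> T" "u \<in> F" "T \<inter> F = {}" "finite F" "finite T"
  defines "l' \<equiv> \<lambda>v. complex_of_real (l v)"
  shows "zs b c l' (e # es) T F = zs b c l' es T (F - {u}) + c * zs b c l' es (insert u T) (F - {u})"
    and "zs b c l' (e # es) {} F = b * zs b c l' es {} (F - {u}) + zs b c l' es {u} (F - {u})"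
proof -
  have "zs b c l' (e # es) T (F - {u}) = 1 * zs b c l' es T (F - {u})"
    using assms by (intro zs_Cons) (auto simp: ew_def)
  moreover have "zs b c l' (e # es) (insert u T) (F - {u}) = c * zs b c l' es (insert u T) (F - {u})"
    using assms by (intro zs_Cons) (auto simp: ew_def)
  \<comment> \<open>With \<open>{}\<close> in place of \<open>T\<close>, the end \<open>v\<close> of
    the edge has spin 0.\<close>
  moreover have "zs b c l' (e # es) {} (F - {u}) = b * zs b c l' es {} (F - {u})"
    using assms by (intro zs_Cons) (auto simp: ew_def)
  moreover have "zs b c l' (e # es) {u} (F - {u}) = 1 * zs b c l' es {u} (F - {u})"
    using assms by (intro zs_Cons) (auto simp: ew_def)
  ultimately show "zs b c l' (e # es) T F = zs b c l' es T (F - {u}) + c * zs b c l' es (insert u T) (F - {u})"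
    and "zs b c l' (e # es) {} F = b * zs b c l' es {} (F - {u}) + zs b c l' es {u} (F - {u})"
    by (simp_all add: zs_split[OF \<open>finite F\<close> \<open>u \<in> F\<close>])
qed

text \<open>The induction covers all \<open>T\<close>, \<open>F\<close> and \<open>l\<close> at
  once, since removing an edge enlarges \<open>T\<close>, shrinks \<open>F\<close> or changes
  \<open>l\<close>. At positive degree the edge formula refers only to shorter edge lists
  (\<open>pos\<close>). At degree 0 no edge is removed and the denominator must be known to be
  nonzero (\<open>all\<close>), which follows by adding vertices one at a time
  (\<open>nz\<close>).\<close>

lemma zs_lev:
  fixes l :: "'a \<Rightarrow> real" and \<gamma> :: complex
  assumes \<gamma>: "cmod (\<gamma> - of_real (1 / \<beta>)) \<le> M"
    and "finite F" "finite T" "T \<inter> F = {}" "\<forall>v. 0 \<le> l v \<and> l v \<le> 1"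
  shows "zs (of_real \<beta>) \<gamma> (\<lambda>v. of_real (l v)) es {} F \<noteq> 0 \<and>
    lev (dg es T F) (zs (of_real \<beta>) \<gamma> (\<lambda>v. of_real (l v)) es T F / zs (of_real \<beta>) \<gamma> (\<lambda>v. of_real (l v)) es {} F)"
  using assms(2-)
proof (induction "length es" arbitrary: es T F l rule: less_induct)
  case less
  define Z where "Z l es T F = zs (of_real \<beta>) \<gamma> (\<lambda>v. of_real (l v)) es T F" for l :: "'a \<Rightarrow> real" and es T F
  have IH: "Z l es' {} F \<noteq> 0" "lev (dg es' T F) (Z l es' T F / Z l es' {} F)"
    if "length es' < length es" "finite F" "finite T" "T \<inter> F = {}" "\<forall>v. 0 \<le> l v \<and> l v \<le> 1" for es' T F l
    using less.hyps[OF that] by (simp_all add: Z_def)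
  have b1: "1 \<le> \<beta>" using beta by simp
  have pos: "lev (dg es T F) (Z l es T F / Z l es {} F)"
    if F: "finite F" and T: "finite T" "T \<inter> F = {}" and l: "\<forall>v. 0 \<le> l v \<and> l v \<le> 1" and d: "dg es T F > 0" for T F l
    using d
  proof (cases rule: dg_pos_cases)
    case (1 e es')
    have eq: "Z l es T' F = Z l (e # es') T' F" for T'
      unfolding Z_def by (rule zs_mset) fact
    have "Z l (e # es') T F = \<gamma> * Z l es' T F"
      unfolding Z_def using 1 by (intro zs_Cons) (auto simp: ew_def)
    moreover have "Z l (e # es') {} F = of_real \<beta> * Z l es' {} F"
      unfolding Z_def using 1 T by (intro zs_Cons) (auto simp: ew_def)
    ultimately have "Z l es T F / Z l es {} F = \<gamma> / of_real \<beta> * (Z l es' T F / Z l es' {} F)" by (simp add: eq)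
    moreover have "dg es T F = 2 + dg es' T F" using dg_mset[OF 1(1), of T F] 1 by (simp add: de_def)
    moreover have len: "length es' < length es" using 1(1)[THEN arg_cong, of size] by simp
    moreover have "lev (2 + dg es' T F) (\<gamma> / of_real \<beta> * (Z l es' T F / Z l es' {} F))"
      using IH(2)[OF len F T l] \<gamma> by (intro step_loop) (simp_all only: add_diff_cancel_left' le_add1)
    ultimately show ?thesis by simp
  next
    case (2 e es' v u)
    have eq: "Z l es T' F = Z l (e # es') T' F" for T'
      unfolding Z_def by (rule zs_mset) fact
    have len: "length es' < length es" using 2(1)[THEN arg_cong, of size] by simp
    have dgT: "dg es T F = Suc (dg es' T F)"
      using dg_mset[OF 2(1), of T F] 2 T by (auto simp: de_def)
    have uT: "u \<notin> T" using 2 T by auto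
    define F' where "F' = F - {u}"
    have F': "finite F'" "T \<inter> F' = {}" "{u} \<inter> F' = {}" "insert u T \<inter> F' = {}" using F T uT by (auto simp: F'_def)
    define z where "z = Z l es' {} F'"
    define r where "r = Z l es' T F' / z"
    define c where "c = Z l es' (insert u T) F' / z"
    define x where "x = Z l es' {u} F' / z"
    have z: "z \<noteq> 0" unfolding z_def using IH(1)[OF len F'(1) _ F'(3) l] by simp
    have R: "Z l es T F / Z l es {} F = (r + \<gamma> * c) / (of_real \<beta> + x)"
    proof -
      have "Z l es T F = z * (r + \<gamma> * c)"
        unfolding eq unfolding Z_def zs_recursion(1)[OF 2(2-4) T(2) F T(1)]
        using z by (simp add: r_def c_def Z_def F'_def field_simps)
      moreover have "Z l es {} F = z * (of_real \<beta> + x)"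
        unfolding eq unfolding Z_def zs_recursion(2)[OF 2(2-4) T(2) F T(1)]
        using z by (simp add: x_def z_def Z_def F'_def field_simps)
      ultimately show ?thesis using z by simp
    qed
    have levx: "lev (dg es' {u} F') x"
      unfolding x_def z_def using IH(2)[OF len F'(1) _ F'(3) l] by simp
    have bx: "of_real \<beta> + x \<noteq> 0" by (rule lev_nz[OF levx])
    show ?thesis
    proof (cases "dg es' T F = 0")
      case True
      \<comment> \<open>The removed edge was the only one at \<open>T\<close>, so \<open>T\<close>
        contributes the factor \<open>k\<close> and the new ratio is \<open>k\<close> times the
        Moebius image of \<open>x\<close>.\<close>
      from dg0_zs[OF True T(2) T(1) F b1 l, of \<gamma>] obtain k where k: "0 \<le> k" "k \<le> 1"
        "\<And>T' F'. T' \<union> F' \<subseteq> F \<Longrightarrow> Z l es' (T \<union> T') F' = of_real k * Z l es' T' F'" unfolding Z_def by metis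
      have "r = of_real k" using k(3)[of "{}" F'] z by (simp add: r_def z_def F'_def)
      moreover have "c = of_real k * x" using k(3)[of "{u}" F'] 2(4) by (auto simp: c_def x_def F'_def)
      ultimately have "(r + \<gamma> * c) / (of_real \<beta> + x) = of_real k * ((1 + \<gamma> * x) / (of_real \<beta> + x))"
        by (simp add: algebra_simps add_divide_distrib)
      then show ?thesis using step_one[OF levx \<gamma> k(1,2)] R dgT True by (metis One_nat_def)
    next
      case False
      then have d2: "dg es T F \<ge> 2" using dgT by simp
      define e' where "e' = dg es' {u} (F' \<union> T)"
      show ?thesis
      proof (cases "e' = 0")
        case True
        \<comment> \<open>Now \<open>u\<close> is a leaf: without the edge it interacts neither with
          \<open>T\<close> nor with a free vertex, so \<open>x\<close> is a constant and
          \<open>c\<close> = \<open>x\<close> \<open>r\<close>.\<close>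
        have fin: "finite (F' \<union> T)" "{u} \<inter> (F' \<union> T) = {}" using F' T uT by auto
        from dg0_zs[OF _ fin(2) _ fin(1) b1 l, of es' \<gamma>] True obtain k where k: "0 \<le> k" "k \<le> 1"
          "\<And>T' F''. T' \<union> F'' \<subseteq> F' \<union> T \<Longrightarrow> Z l es' ({u} \<union> T') F'' = of_real k * Z l es' T' F''"
          unfolding Z_def e'_def by (metis finite.emptyI finite_insert)
        have "x = of_real k" using k(3)[of "{}" F'] z by (simp add: x_def z_def)
        moreover have "c = of_real k * r" using k(3)[of T F'] by (simp add: c_def r_def)
        ultimately have "(r + \<gamma> * c) / (of_real \<beta> + x) = r * ((1 + \<gamma> * x) / (of_real \<beta> + x))"
          by (simp add: algebra_simps add_divide_distrib)
        moreover have "lev (dg es T F - 1) r"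
          unfolding r_def z_def using IH(2)[OF len F'(1) T(1) F'(2) l] dgT
            dg_remove[of es' u F T] True 2(4) T(2) by (simp add: F'_def e'_def)
        ultimately show ?thesis using step_leaf[OF d2 _ \<gamma> levx] R by metis
      next
        case e'0: False
        \<comment> \<open>The comparison model: the removed edge at \<gamma> = 1 / \<beta> acts as a
          weight 1 / \<beta> at \<open>u\<close>. It has one edge less, so the induction hypothesis
          applies to its ratio \<open>rh\<close>.\<close>
        define l' where "l' = l(u := 1 / \<beta> * l u)"
        have l': "\<forall>v. 0 \<le> l' v \<and> l' v \<le> 1" using l beta by (auto simp: l'_def field_simps intro: order_trans)
        have upd: "(\<lambda>v. complex_of_real (l' v)) = (\<lambda>v. complex_of_real (l v))(u := of_real (1 / \<beta>) * complex_of_real (l u))"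
          by (auto simp: l'_def fun_eq_iff)
        define rh where "rh = Z l' es' T F / Z l' es' {} F"
        have rh: "lev (dg es T F - 1) rh"
          unfolding rh_def using IH(2)[OF len F T l'] dgT by simp
        have zu: "Z l' es' T' F = Z l es' T' (F - {u}) + Z l es' (insert u T') (F - {u}) / of_real \<beta>"
          if "finite T'" "u \<notin> T'" for T'
          unfolding Z_def upd
          using zs_fun_upd[OF F that(1) 2(4) that(2), of _ _ "\<lambda>v. complex_of_real (l v)" "of_real (1 / \<beta>)"] by simp
        have "Z l' es' T F = z * (r + c / of_real \<beta>)"
          unfolding zu[OF T(1) uT] using z by (simp add: r_def c_def F'_def distrib_left)
        moreover have "Z l' es' {} F = z * (1 + x / of_real \<beta>)"
          using zu[of "{}"] z by (simp add: x_def F'_def distrib_left) (simp add: z_def F'_def)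
        ultimately have "rh = (r + c / of_real \<beta>) / (1 + x / of_real \<beta>)" using z by (simp add: rh_def)
        moreover have "1 + x / of_real \<beta> = (of_real \<beta> + x) / of_real \<beta>" using beta by (simp add: field_simps)
        ultimately have "rh / of_real \<beta> = (r + c / of_real \<beta>) / (of_real \<beta> + x)" using beta by simp
        then have "(r + \<gamma> * c) / (of_real \<beta> + x) = rh / of_real \<beta> + (\<gamma> - of_real (1 / \<beta>)) * c / (of_real \<beta> + x)"
          by (simp add: algebra_simps flip: add_divide_distrib diff_divide_distrib)
        moreover have "lev (dg es T F - 1 + e') c"
          unfolding c_def z_def using IH(2)[OF len F'(1) _ F'(4) l] dgT T(1)
            dg_insert[OF 2(4) T(2), of es'] by (simp add: F'_def e'_def)
        moreover have "dg es' {u} F' \<le> e'" unfolding e'_def by (rule dg_mono) auto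
        ultimately show ?thesis
          using step_gen[OF d2 _ _ rh _ levx \<gamma>, of e' c] e'0 R by simp
      qed
    qed
  qed
  have zero: "Z l es T F = of_real k * Z l es {} F \<Longrightarrow> 0 \<le> k \<Longrightarrow> k \<le> 1 \<Longrightarrow> Z l es {} F \<noteq> 0 \<Longrightarrow> lev 0 (Z l es T F / Z l es {} F)" for T F k l
    by (auto simp: lev_def kap_def)
  have all: "lev (dg es T F) (Z l es T F / Z l es {} F)"
    if F: "finite F" and T: "finite T" "T \<inter> F = {}" and l: "\<forall>v. 0 \<le> l v \<and> l v \<le> 1" and nz: "Z l es {} F \<noteq> 0" for T F l
  proof (cases "dg es T F = 0")
    case True
    from dg0_zs[OF True T(2) T(1) F b1 l, of \<gamma>] obtain k where k: "0 \<le> k" "k \<le> 1"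
      "\<And>T' F'. T' \<union> F' \<subseteq> F \<Longrightarrow> Z l es (T \<union> T') F' = of_real k * Z l es T' F'" unfolding Z_def by metis
    have "Z l es T F = of_real k * Z l es {} F" using k(3)[of "{}" F] by simp
    from zero[OF this k(1,2) nz] True show ?thesis by simp
  next
    case False
    with pos[OF F T l] show ?thesis by simp
  qed
  \<comment> \<open>A new vertex multiplies the sum by 1 + \<open>R\<close>, where \<open>R\<close>
    is either real and nonnegative or of norm at most \<kappa>1 < 1.\<close>
  have nz: "Z l es {} F \<noteq> 0" if "finite F" and l: "\<forall>v. 0 \<le> l v \<and> l v \<le> 1" for F l
    using that(1)
  proof (induction F rule: finite_induct)
    case empty
    show ?case unfolding Z_def zs_empty wt_def using beta
      by (auto simp: ew_def prod_list_zero_iff)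
  next
    case (insert u F)
    define R where "R = Z l es {u} F / Z l es {} F"
    have "lev (dg es {u} F) R" unfolding R_def using insert l by (intro all) auto
    then have "1 + R \<noteq> 0"
    proof (cases "dg es {u} F = 0")
      case True
      then obtain k where "0 \<le> k" "R = of_real k" using \<open>lev (dg es {u} F) R\<close> by (auto simp: lev_def)
      then have "Re (1 + R) > 0" by simp
      then show ?thesis by fastforce
    next
      case False
      then have "cmod R < 1" using lev_k1[OF \<open>lev (dg es {u} F) R\<close>] k1(2) by simp
      then show ?thesis by (metis add_eq_0_iff norm_minus_cancel norm_one order_less_irrefl)
    qed
    moreover have "Z l es {} (insert u F) = Z l es {} F * (1 + R)"
      unfolding Z_def using insert by (subst zs_split[of _ u]) (auto simp: R_def Z_def field_simps)
    ultimately show ?case using insert by simp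
  qed
  show ?case using nz[OF less.prems(1,4)] all[OF less.prems nz[OF less.prems(1,4)]] by (simp add: Z_def)
qed

end

section \<open>Admissible parameters\<close>

lemma nonneg_of_mult: "0 \<le> a * c \<Longrightarrow> 0 < c \<Longrightarrow> 0 \<le> a" for a c :: real
  by (simp add: zero_le_mult_iff)

text \<open>As s + u = 19/20, multiplying the quartic by (19/20)^4 = 130321/160000 makes it a form
  in s and u. All coefficients of this form, the Bernstein form on the interval, are nonnegative.
  The next four lemmas are certified in the same way. This one bounds \<kappa>1; the others give H9,
  the comparison with the two branches of \<open>g\<close>, and the exclusion of small
  \<open>x\<close>.\<close>

lemma small_k1:
  fixes x :: real assumes "19 / 10 \<le> x" "x \<le> 57 / 20"
  shows "0 \<le> 743 / 1000 * (x * (x - ((191 + 16 * x) / 400))) - x + 2 * ((191 + 16 * x) / 400) - x\<^sup>2 * ((191 + 16 * x) / 400)\<^sup>2"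
proof -
  define s u where "s = x - 19 / 10" and "u = 57 / 20 - x"
  have "(743 / 1000 * (x * (x - ((191 + 16 * x) / 400))) - x + 2 * ((191 + 16 * x) / 400) - x\<^sup>2 * ((191 + 16 * x) / 400)\<^sup>2) * (130321 / 160000) = (754531 / 400000000) * (s^0 * u^4) + (45446701 / 400000000) * (s^1 * u^3) + (863527139 / 1600000000) * (s^2 * u^2) + (562341257 / 800000000) * (s^3 * u^1) + (437838919 / 1600000000) * (s^4 * u^0)"
    unfolding s_def u_def by (simp add: field_simps power2_eq_square power3_eq_cube power4_eq_xxxx power_numeral_reduce)
  moreover have "0 \<le> s" "0 \<le> u" using assms by (simp_all add: s_def u_def)
  ultimately have "0 \<le> (743 / 1000 * (x * (x - ((191 + 16 * x) / 400))) - x + 2 * ((191 + 16 * x) / 400) - x\<^sup>2 * ((191 + 16 * x) / 400)\<^sup>2) * (130321 / 160000)" by simp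
  then show ?thesis by (rule nonneg_of_mult) simp
qed
lemma small_H9:
  fixes x :: real assumes "19 / 10 \<le> x" "x \<le> 57 / 20"
  shows "0 \<le> ((191 + 16 * x) / 400) * (x * (x - 1 / 20)) - 743 / 1000 * (x - 1 / 20) + ((191 + 16 * x) / 400) - x\<^sup>2 * ((191 + 16 * x) / 400)\<^sup>2"
proof -
  define s u where "s = x - 19 / 10" and "u = 57 / 20 - x"
  have "(((191 + 16 * x) / 400) * (x * (x - 1 / 20)) - 743 / 1000 * (x - 1 / 20) + ((191 + 16 * x) / 400) - x\<^sup>2 * ((191 + 16 * x) / 400)\<^sup>2) * (130321 / 160000) = (7413911 / 400000000) * (s^0 * u^4) + (101550751 / 400000000) * (s^1 * u^3) + (1362828299 / 1600000000) * (s^2 * u^2) + (805729157 / 800000000) * (s^3 * u^1) + (623092239 / 1600000000) * (s^4 * u^0)"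
    unfolding s_def u_def by (simp add: field_simps power2_eq_square power3_eq_cube power4_eq_xxxx power_numeral_reduce)
  moreover have "0 \<le> s" "0 \<le> u" using assms by (simp_all add: s_def u_def)
  ultimately have "0 \<le> (((191 + 16 * x) / 400) * (x * (x - 1 / 20)) - 743 / 1000 * (x - 1 / 20) + ((191 + 16 * x) / 400) - x\<^sup>2 * ((191 + 16 * x) / 400)\<^sup>2) * (130321 / 160000)" by simp
  then show ?thesis by (rule nonneg_of_mult) simp
qed
lemma small_g2:
  fixes x :: real assumes "19 / 10 \<le> x" "x \<le> 57 / 20"
  shows "0 \<le> (x\<^sup>2 * ((191 + 16 * x) / 400) - 2 - x\<^sup>2 + 2 * x) * (x\<^sup>2 + x - 1) - (x - 1)\<^sup>2"
proof -
  define s u where "s = x - 19 / 10" and "u = 57 / 20 - x"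
  have "((x\<^sup>2 * ((191 + 16 * x) / 400) - 2 - x\<^sup>2 + 2 * x) * (x\<^sup>2 + x - 1) - (x - 1)\<^sup>2) * (2476099 / 3200000) = (769777 / 20000000) * (s^0 * u^5) + (2517021 / 2000000) * (s^1 * u^4) + (18628743 / 4000000) * (s^2 * u^3) + (19622127 / 3200000) * (s^3 * u^2) + (195224511 / 64000000) * (s^4 * u^1) + (123706763 / 320000000) * (s^5 * u^0)"
    unfolding s_def u_def by (simp add: field_simps power2_eq_square power3_eq_cube power4_eq_xxxx power_numeral_reduce)
  moreover have "0 \<le> s" "0 \<le> u" using assms by (simp_all add: s_def u_def)
  ultimately have "0 \<le> ((x\<^sup>2 * ((191 + 16 * x) / 400) - 2 - x\<^sup>2 + 2 * x) * (x\<^sup>2 + x - 1) - (x - 1)\<^sup>2) * (2476099 / 3200000)" by simp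
  then show ?thesis by (rule nonneg_of_mult) simp
qed
lemma small_g1:
  fixes x :: real assumes "19 / 10 \<le> x" "x \<le> 57 / 20"
  shows "0 \<le> (x\<^sup>2 * ((191 + 16 * x) / 400) - 2 - x\<^sup>2 + 2 * x) * (x\<^sup>2 - 1) - x * (x - 2)"
proof -
  define s u where "s = x - 19 / 10" and "u = 57 / 20 - x"
  have "((x\<^sup>2 * ((191 + 16 * x) / 400) - 2 - x\<^sup>2 + 2 * x) * (x\<^sup>2 - 1) - x * (x - 2)) * (2476099 / 3200000) = (13620647 / 20000000) * (s^0 * u^5) + (2787521 / 800000) * (s^1 * u^4) + (57890067 / 8000000) * (s^2 * u^3) + (14253119 / 2000000) * (s^3 * u^2) + (189486079 / 64000000) * (s^4 * u^1) + (95360383 / 320000000) * (s^5 * u^0)"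
    unfolding s_def u_def by (simp add: field_simps power2_eq_square power3_eq_cube power4_eq_xxxx power_numeral_reduce)
  moreover have "0 \<le> s" "0 \<le> u" using assms by (simp_all add: s_def u_def)
  ultimately have "0 \<le> ((x\<^sup>2 * ((191 + 16 * x) / 400) - 2 - x\<^sup>2 + 2 * x) * (x\<^sup>2 - 1) - x * (x - 2)) * (2476099 / 3200000)" by simp
  then show ?thesis by (rule nonneg_of_mult) simp
qed
lemma low_bd:
  fixes x :: real assumes "1 \<le> x" "x \<le> 19 / 10"
  shows "0 \<le> x\<^sup>2 * ((2 - x) * (1 + x)) - 1"
proof -
  define s u where "s = x - 1" and "u = 19 / 10 - x"
  have "(x\<^sup>2 * ((2 - x) * (1 + x)) - 1) * (6561 / 10000) = (1) * (s^0 * u^4) + (67 / 10) * (s^1 * u^3) + (1329 / 100) * (s^2 * u^2) + (8293 / 1000) * (s^3 * u^1) + (469 / 10000) * (s^4 * u^0)"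
    unfolding s_def u_def by (simp add: field_simps power2_eq_square power3_eq_cube power4_eq_xxxx power_numeral_reduce)
  moreover have "0 \<le> s" "0 \<le> u" using assms by (simp_all add: s_def u_def)
  ultimately have "0 \<le> (x\<^sup>2 * ((2 - x) * (1 + x)) - 1) * (6561 / 10000)" by simp
  then show ?thesis by (rule nonneg_of_mult) simp
qed

text \<open>Everything is expressed through \<open>k\<close> = \<kappa>2. The choice of
  \<open>M\<close> turns H6 into an equality, q = M k / (b - k) does so for H3, and \<rho> is the
  largest number up to 1 that H10 permits. The bound \<open>b / (b + 2) \<le> k\<close> is then H2,
  and \<open>2 * k \<le> b\<close> is q \<le> M.\<close>

lemma zero_free_of_kappa:
  fixes b k :: real
  defines "M \<equiv> b * k - 1 / b" and "k1 \<equiv> (1 - 2 * k / b + b * k\<^sup>2) / (b - k)"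
  assumes b: "b > 1" and k: "b / (b + 2) \<le> k" "k < 1" "2 * k \<le> b" and M: "M > 0" and k1k: "k1\<^sup>2 \<le> k"
    and H4: "M * (k1 - 2 / b) \<le> (k1 - 1 / b) * (b + 2 / b - k1)" and H5: "k1 - 2 / b \<le> k"
    and H9: "k1 / b + M * k / min b (b + 2 / b - k1) \<le> k"
  shows "zero_free b M (k1 - 1 / b) k1 k (min 1 ((k - k1 / b) / (k1 - 1 / b)))"
proof -
  have k0: "k > 0" using k(1) b by (smt (verit) divide_pos_pos)
  have bk: "b - k > 0" using b k by simp
  define q where "q = k1 - 1 / b"
  have qeq: "q = M * k / (b - k)"
  proof -
    have "k1 * (b - k) = 1 - 2 * k / b + b * k\<^sup>2" using bk by (simp add: k1_def)
    moreover have "1 / b * (b - k) = 1 - k / b" using b by (simp add: field_simps)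
    moreover have "M * k = b * k\<^sup>2 - k / b" by (simp add: M_def algebra_simps power2_eq_square)
    ultimately have "q * (b - k) = M * k" by (simp add: q_def left_diff_distrib)
    then show ?thesis using bk by (simp add: field_simps)
  qed
  have q0: "q > 0" unfolding qeq using M k0 bk by simp
  have k1q: "k1 = 1 / b + q" by (simp add: q_def)
  have k10: "k1 > 0" using k1q q0 b by (simp add: add_pos_pos)
  have k11: "k1 < 1" using k1k k(2) k10 by (smt (verit) one_le_power)
  have kb: "b - k \<le> k * (b + 1)" using k(1) b by (simp add: field_simps)
  have H2: "M \<le> q * (b + 1)"
  proof -
    have "M * (b - k) \<le> M * (k * (b + 1))" using kb M by simp
    then show ?thesis using bk by (simp add: qeq field_simps)
  qed
  have kk1: "k \<le> k1"
  proof -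
    have "(1 + b * k) / (b + 1) \<le> k1"
    proof -
      have "M / (b + 1) \<le> q" using H2 b by (simp add: field_simps)
      moreover have "1 / b + M / (b + 1) = (1 + b * k) / (b + 1)"
      proof -
        have "1 / b * (b + 1) + M = 1 + b * k" using b by (simp add: M_def field_simps)
        then show ?thesis using b by (simp add: add_divide_eq_iff mult.commute divide_simps)
      qed
      ultimately show ?thesis by (simp add: k1q)
    qed
    moreover have "k \<le> (1 + b * k) / (b + 1)" using k b by (simp add: field_simps)
    ultimately show ?thesis by linarith
  qed
  define r where "r = min 1 ((k - k1 / b) / q)"
  have rk1: "k1 \<le> r"
  proof -
    have "k1 * q + k1 / b = k1 * (1 / b + q)" by (simp add: algebra_simps)
    also have "\<dots> = k1\<^sup>2" by (simp flip: k1q add: power2_eq_square)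
    finally have "k1 * q \<le> k - k1 / b" using k1k by linarith
    then have "k1 \<le> (k - k1 / b) / q" using q0 by (simp add: pos_le_divide_eq)
    then show ?thesis using k11 by (simp add: r_def)
  qed
  have H11: "k \<le> k1 * r"
  proof -
    have "k * q \<le> k1 * (k - k1 / b)"
    proof -
      have "k1 * k1 / b \<le> k / b" using k1k b by (simp add: power2_eq_square divide_right_mono)
      then show ?thesis unfolding q_def by (simp add: algebra_simps)
    qed
    then have "k \<le> k1 * ((k - k1 / b) / q)" using q0 by (simp add: pos_le_divide_eq)
    then show ?thesis using kk1 by (simp add: r_def min_def)
  qed
  have rq: "q * r \<le> k - k1 / b"
  proof -
    have "r \<le> (k - k1 / b) / q" by (simp add: r_def)
    then show ?thesis using q0 by (simp add: pos_le_divide_eq mult.commute)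
  qed
  have "zero_free b M q k1 k r"
  proof
    show "q \<le> M" unfolding qeq using M bk k(3) by (simp add: field_simps)
    show "M * k \<le> q * (b - k)" using bk by (simp add: qeq)
    show "M * (q - 1 / b) \<le> q * (b + 1 / b - q)" using H4 by (simp add: q_def algebra_simps)
    show "q - 1 / b \<le> k" using H5 by (simp add: q_def)
    show "1 / b\<^sup>2 + M / b \<le> k" using b by (simp add: M_def field_simps power2_eq_square)
    have "k1 * r \<le> r * r" using rk1 k10 by (intro mult_right_mono) auto
    then show "k \<le> r\<^sup>2" using H11 by (simp add: power2_eq_square)
    show "k1 / b + M * k / min b (b + 1 / b - q) \<le> k" using H9 by (simp add: q_def algebra_simps)
    have "M * k * r / (b - k) = q * r" by (simp add: qeq)
    then show "k1 / b + M * k * r / (b - k) \<le> k" using rq by simp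
  qed (use b M q0 k1q k11 k0 rk1 k10 H2 k1k H11 in \<open>auto simp: r_def\<close>)
  then show ?thesis by (simp add: q_def r_def)
qed

text \<open>The values of \<open>k\<close> in the two ranges of \<open>b\<close> were fitted numerically.\<close>

lemma zero_free_large:
  fixes b :: real
  assumes b: "b \<ge> 57 / 20"
  defines "k \<equiv> b / (b + 2)"
  shows "\<exists>q k1 r. zero_free b (b * k - 1 / b) q k1 k r"
proof -
  define k1 where "k1 = (b\<^sup>2 + b + 2) / ((b + 1) * (b + 2))"
  have k1eq: "k1 = (1 - 2 * k / b + b * k\<^sup>2) / (b - k)"
  proof -
    have "1 - 2 * k / b + b * k\<^sup>2 = b * (b\<^sup>2 + b + 2) / (b + 2)\<^sup>2"
    proof -
      have "1 - 2 * k / b = b * (b + 2) / (b + 2)\<^sup>2" using b by (simp add: k_def divide_simps power2_eq_square)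
      moreover have "b * k\<^sup>2 = b * b\<^sup>2 / (b + 2)\<^sup>2" by (simp add: k_def power_divide)
      ultimately have "1 - 2 * k / b + b * k\<^sup>2 = (b * (b + 2) + b * b\<^sup>2) / (b + 2)\<^sup>2" by (simp add: add_divide_distrib)
      then show ?thesis by (simp add: algebra_simps)
    qed
    moreover have "b - k = b * (b + 1) / (b + 2)" using b by (simp add: k_def field_simps)
    ultimately show ?thesis using b by (simp add: k1_def power2_eq_square)
  qed
  define M where "M = b * k - 1 / b"
  have kb: "(b + 2) * k = b" using b by (simp add: k_def)
  have bb: "b * b \<ge> 57 / 20 * b" using b by (intro mult_right_mono) auto
  have bbb: "b * (b * b) \<ge> b + 3"
  proof -
    have "b * (b * b) \<ge> b * (57 / 20 * b)" using bb b by (intro mult_left_mono) auto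
    moreover have "b * (57 / 20 * b) = 57 / 20 * (b * b)" by simp
    ultimately show ?thesis using bb b by linarith
  qed
  have k1k: "k1\<^sup>2 \<le> k"
  proof -
    have "(b\<^sup>2 + b + 2)\<^sup>2 \<le> b * (b + 1)\<^sup>2 * (b + 2)"
    proof -
      have "b * (b * b) \<ge> b * (57 / 20 * b)" using bb b by (intro mult_left_mono) auto
      then have "2 * (b * (b * b)) \<ge> 2 * b + 4" using bb b by linarith
      then show ?thesis by (simp add: algebra_simps power2_eq_square)
    qed
    then have "(b\<^sup>2 + b + 2)\<^sup>2 * (b + 2) \<le> b * (b + 1)\<^sup>2 * (b + 2) * (b + 2)" using b by (intro mult_right_mono) auto
    then show ?thesis using b by (simp add: k1_def k_def power_divide power_mult_distrib divide_simps power2_eq_square mult_ac)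
  qed
  have "k1 * (b + 1) = (b\<^sup>2 + b + 2) / (b + 2)" using b by (simp add: k1_def)
  moreover have "b * k + 1 = (b\<^sup>2 + b + 2) / (b + 2)" using b by (simp add: k_def field_simps power2_eq_square)
  ultimately have k1b: "k1 * (b + 1) = b * k + 1" by simp
  have k1lt: "k1 < 1" using b by (simp add: k1_def divide_less_eq) (simp add: algebra_simps power2_eq_square)
  have k1b': "1 / b \<le> k1"
  proof -
    have "(b + 1) * (b + 2) \<le> b * (b\<^sup>2 + b + 2)"
    proof -
      have "b * (b * b) \<ge> b * (57 / 20 * b)" using bb b by (intro mult_left_mono) auto
      moreover have "b * (57 / 20 * b) = 57 / 20 * (b * b)" by simp
      ultimately have "b * (b * b) \<ge> b + 2" using bb b by linarith
      then show ?thesis by (simp add: algebra_simps power2_eq_square)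
    qed
    then show ?thesis using b by (simp add: k1_def pos_le_divide_eq pos_divide_le_eq mult.commute)
  qed
  \<comment> \<open>This \<open>k\<close> is the least value that H2 permits, so H2 is an
    equality.\<close>
  have Mk: "M = (k1 - 1 / b) * (b + 1)" using k1b b by (simp add: M_def left_diff_distrib field_simps)
  have Mpos: "M > 0"
  proof -
    have "b * k * b > 1 * 1" using b bbb by (simp add: k_def less_divide_eq mult_ac)
    then show ?thesis using b by (simp add: M_def field_simps)
  qed
  have "k \<ge> 2 / 5" using b by (simp add: k_def field_simps)
  have H5: "k1 - 2 / b \<le> k"
  proof -
    have "(k + 2 / b) * (b + 1) = b * k + k + 2 + 2 / b" using b by (simp add: distrib_left distrib_right mult.commute add_divide_distrib)
    then have "k1 * (b + 1) \<le> (k + 2 / b) * (b + 1)" using b \<open>k \<ge> 2 / 5\<close> by (simp add: k1b)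
    then show ?thesis using b by simp
  qed
  have "k < 1" using b by (simp add: k_def)
  then have bk: "b - k > 0" using b by simp
  have qq: "M * k / (b - k) = k1 - 1 / b"
  proof -
    have "b - k = k * (b + 1)" using kb by (simp add: algebra_simps)
    moreover have "k > 0" using b by (simp add: k_def)
    ultimately show ?thesis using b by (simp add: Mk)
  qed
  have "zero_free b M (k1 - 1 / b) k1 k (min 1 ((k - k1 / b) / (k1 - 1 / b)))"
    unfolding M_def k1eq
  proof (rule zero_free_of_kappa; (fold k1eq M_def)?)
    show "M * (k1 - 2 / b) \<le> (k1 - 1 / b) * (b + 2 / b - k1)"
    proof -
      have "(b + 1) * (k1 - 2 / b) \<le> b + 2 / b - k1"
      proof -
        have "(b + 2) * k1 \<le> b + 2 + 4 / b" using k1lt b by (smt (verit, best) divide_nonneg_nonneg mult_left_le)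
        then show ?thesis using b by (simp add: algebra_simps add_divide_distrib)
      qed
      then have "(k1 - 1 / b) * ((b + 1) * (k1 - 2 / b)) \<le> (k1 - 1 / b) * (b + 2 / b - k1)"
        using k1b' by (intro mult_left_mono) auto
      then show ?thesis by (simp add: Mk mult_ac)
    qed
    show "k1 / b + M * k / min b (b + 2 / b - k1) \<le> k"
    proof -
      have "k > 0" using b by (simp add: k_def)
      have "b - k \<le> min b (b + 2 / b - k1)" using H5 \<open>k > 0\<close> by simp
      then have "M * k / min b (b + 2 / b - k1) \<le> M * k / (b - k)"
        using bk Mpos \<open>k > 0\<close> by (intro divide_left_mono mult_pos_pos mult_nonneg_nonneg) auto
      then have "k1 / b + M * k / min b (b + 2 / b - k1) \<le> k1 / b + k1 - 1 / b" by (simp add: qq)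
      \<comment> \<open>Here k1 / b + q equals \<open>k\<close> exactly, which amounts to \<rho> =
        1.\<close>
      also have "\<dots> = (k1 * (b + 1) - 1) / b" using b by (simp add: field_simps)
      also have "\<dots> = k" using b by (simp add: k1b)
      finally show ?thesis .
    qed
  qed (use b k1k H5 Mpos in \<open>auto simp: k_def field_simps\<close>)
  then show ?thesis unfolding M_def by blast
qed

lemma zero_free_small:
  fixes b :: real
  assumes b: "b \<ge> 19 / 10" "b \<le> 57 / 20"
  defines "k \<equiv> (191 + 16 * b) / 400"
  shows "\<exists>q k1 r. zero_free b (b * k - 1 / b) q k1 k r"
proof -
  define k1 where "k1 = (1 - 2 * k / b + b * k\<^sup>2) / (b - k)"
  define M where "M = b * k - 1 / b"
  have k: "5535 / 10000 \<le> k" "k \<le> 6 / 10" using b by (auto simp: k_def)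
  have bk: "b - k > 0" using b k by simp
  \<comment> \<open>The constant has a square just below 5535/10000, the value of \<open>k\<close>
    at b = 19/10; this gives \<kappa>1^2 \<le> \<kappa>2.\<close>
  have k1: "k1 \<le> 743 / 1000"
  proof -
    have "b - 2 * k + b\<^sup>2 * k\<^sup>2 \<le> 743 / 1000 * (b * (b - k))"
      using small_k1[OF b] unfolding k_def[symmetric] by linarith
    then have "(1 - 2 * k / b + b * k\<^sup>2) * b \<le> 743 / 1000 * (b - k) * b"
      using b by (simp add: algebra_simps power2_eq_square)
    then have "1 - 2 * k / b + b * k\<^sup>2 \<le> 743 / 1000 * (b - k)" using b by simp
    then show ?thesis using bk by (simp add: k1_def pos_divide_le_eq)
  qed
  have Mpos: "M > 0"
  proof -
    have "19 / 10 * (5535 / 10000) \<le> b * k" using b k by (intro mult_mono) auto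
    moreover have "1 / b \<le> 1 / (19 / 10)" using b by (intro divide_left_mono) auto
    ultimately show ?thesis by (simp add: M_def)
  qed
  have M2: "M \<le> 171 / 100"
  proof -
    have "b * k \<le> 57 / 20 * (6 / 10)" using b k by (intro mult_mono) auto
    moreover have "1 / b > 0" using b by simp
    ultimately show ?thesis unfolding M_def by linarith
  qed
  have ib: "20 / 57 \<le> 1 / b" "1 / b \<le> 10 / 19" using b by (auto simp: field_simps)
  have k1l: "k1 - 1 / b \<ge> 1 / 5"
  proof -
    have "19 / 10 * (5535 / 10000) \<le> b * k" using b k by (intro mult_mono) auto
    then have "M \<ge> 1 / 2" using ib by (simp add: M_def)
    have "k1 * (b - k) = 1 - 2 * k / b + b * k\<^sup>2" using bk by (simp add: k1_def)
    moreover have "1 / b * (b - k) = 1 - k / b" using b by (simp add: field_simps)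
    moreover have "M * k = b * k\<^sup>2 - k / b" by (simp add: M_def algebra_simps power2_eq_square)
    ultimately have e: "(k1 - 1 / b) * (b - k) = M * k" by (simp add: left_diff_distrib)
    show ?thesis
    proof (rule ccontr)
      assume "\<not> ?thesis"
      then have "(k1 - 1 / b) * (b - k) < 1 / 5 * (b - k)" using bk by (intro mult_strict_right_mono) auto
      moreover have "1 / 2 * k \<le> M * k" using \<open>M \<ge> 1 / 2\<close> k by (intro mult_right_mono) auto
      moreover have "b * k - 1 / b \<le> M" by (simp add: M_def)
      moreover have "1 / 5 * (b - k) \<le> M * k"
      proof -
        have "M * k \<ge> (b * k - 10 / 19) * (5535 / 10000)"
          using ib k Mpos by (intro mult_mono) (auto simp: M_def)
        moreover have "b * k \<ge> b * (5535 / 10000)" using b k by (intro mult_left_mono) auto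
        ultimately show ?thesis using k b by argo
      qed
      ultimately show False using e by linarith
    qed
  qed
  have H9: "k1 / b + M * k / min b (b + 2 / b - k1) \<le> k"
  proof -
    \<comment> \<open>The slack 1/20 exceeds 743/1000 - 40/57, the largest possible value of k1 - 2
      / b.\<close>
    have m: "b - 1 / 20 \<le> min b (b + 2 / b - k1)" using ib k1 by simp
    have "M * k / min b (b + 2 / b - k1) \<le> M * k / (b - 1 / 20)"
      using m b Mpos k by (intro divide_left_mono mult_pos_pos mult_nonneg_nonneg) auto
    moreover have "k1 / b \<le> 743 / 1000 / b" using k1 b by (intro divide_right_mono) auto
    moreover have "743 / 1000 / b + M * k / (b - 1 / 20) \<le> k"
    proof -
      have "(743 / 1000 / b + M * k / (b - 1 / 20)) * (b * (b - 1 / 20))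
          = 743 / 1000 * (b - 1 / 20) + (b * M) * k"
        using b by (simp add: distrib_right)
      also have "b * M = b\<^sup>2 * k - 1" using b by (simp add: M_def field_simps power2_eq_square)
      also have "743 / 1000 * (b - 1 / 20) + (b\<^sup>2 * k - 1) * k \<le> k * (b * (b - 1 / 20))"
        using small_H9[OF b] unfolding k_def[symmetric] by (simp add: algebra_simps power2_eq_square)
      finally show ?thesis using b by (simp add: mult_le_cancel_right)
    qed
    ultimately show ?thesis by linarith
  qed
  have "zero_free b M (k1 - 1 / b) k1 k (min 1 ((k - k1 / b) / (k1 - 1 / b)))"
    unfolding M_def k1_def
  proof (rule zero_free_of_kappa; (fold k1_def M_def)?)
    show "b / (b + 2) \<le> k"
    proof -
      have "0 \<le> (57 / 20 - b) * (657 / 5 - 16 * b) + 751 / 100" using b by simp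
      then have "400 * b \<le> (191 + 16 * b) * (b + 2)" by (simp add: field_simps)
      then show ?thesis using b by (simp add: k_def pos_divide_le_eq)
    qed
    show "k1\<^sup>2 \<le> k"
    proof -
      have "k1\<^sup>2 \<le> (743 / 1000)\<^sup>2" using k1 k1l ib by (intro power_mono) auto
      then show ?thesis using k by (simp add: power2_eq_square)
    qed
    show "M * (k1 - 2 / b) \<le> (k1 - 1 / b) * (b + 2 / b - k1)"
    proof -
      have "k1 - 2 / b \<le> 1 / 20" using k1 ib by simp
      then have "M * (k1 - 2 / b) \<le> M * (1 / 20)" using Mpos by (intro mult_left_mono) auto
      moreover have "1 / 5 * 1 \<le> (k1 - 1 / b) * (b + 2 / b - k1)" using k1l k1 ib b by (intro mult_mono) auto
      ultimately show ?thesis using M2 by linarith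
    qed
  qed (use b k k1 ib H9 Mpos in \<open>auto\<close>)
  then show ?thesis unfolding M_def by blast
qed

lemma zero_free_params:
  fixes b c :: real
  assumes b: "b > 1" and c: "c < 0" and bc: "b + c > 2 - g b"
  obtains M q k1 k2 r where "zero_free b M q k1 k2 r" "1 / b - c < M"
proof -
  \<comment> \<open>As \<open>c\<close> is negative, the hypothesis forces g b > 2 - b. Below 19/10
    the first branch of \<open>g\<close> is nonpositive, and for the second branch g b \<le> 2 - b
    becomes \<open>low_bd\<close> after clearing the denominator.\<close>
  have b19: "b > 19 / 10"
  proof (rule ccontr)
    assume n: "\<not> b > 19 / 10"
    then have p: "0 \<le> b\<^sup>2 * ((2 - b) * (1 + b)) - 1" using low_bd[of b] b by simp
    have bb: "b\<^sup>2 > 1" using b by (simp add: one_less_power)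
    have "b\<^sup>2 + b - 1 > 0" using b bb by linarith
    then have "b * (b\<^sup>2 + b - 1) > 0" using b by simp
    then have d: "b ^ 3 + b\<^sup>2 - b > 0" by (simp add: algebra_simps power2_eq_square power3_eq_cube)
    have "(b - 1)\<^sup>2 \<le> (2 - b) * (b ^ 3 + b\<^sup>2 - b)"
      using p by (simp add: algebra_simps power2_eq_square power3_eq_cube)
    then have "(b - 1)\<^sup>2 / (b ^ 3 + b\<^sup>2 - b) \<le> 2 - b" using d by (simp add: pos_divide_le_eq)
    moreover have "(b - 2) / (b\<^sup>2 - 1) \<le> 0" using n bb by (simp add: divide_nonpos_pos)
    ultimately have "g b \<le> 2 - b" using n by (simp add: g_def)
    then show False using bc c by linarith
  qed
  \<comment> \<open>With M = b k - 1 / b, the bound on \<open>g\<close> says 2 - g b - b \<ge> 2 / b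
    - b k. The hypothesis then places \<open>c\<close> inside the disc of radius M around 1 /
    b.\<close>
  have ex: "\<exists>k q k1 r. zero_free b (b * k - 1 / b) q k1 k r \<and> g b \<le> b * k - 2 / b - b + 2"
  proof (cases "b \<ge> 57 / 20")
    case True
    define k where "k = b / (b + 2)"
    have kb: "b * k - 2 / b - b + 2 = 2 * (b - 2) / (b * (b + 2))"
      using True by (simp add: k_def divide_simps) (simp add: algebra_simps power2_eq_square)
    have b2: "b * b \<ge> 57 / 20 * b" using True by (intro mult_right_mono) auto
    have "(b - 2) / (b\<^sup>2 - 1) \<le> 2 * (b - 2) / (b * (b + 2))"
    proof -
      have "2 + 2 * b \<le> 57 / 20 * b" using True by simp
      then have "2 + 2 * b \<le> b * b" using b2 by linarith
      then have "b * (b + 2) \<le> 2 * (b\<^sup>2 - 1)" by (simp add: power2_eq_square algebra_simps)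
      then have "(b - 2) * (b * (b + 2)) \<le> (b - 2) * (2 * (b\<^sup>2 - 1))" using True by (intro mult_left_mono) auto
      moreover have "b\<^sup>2 - 1 > 0" using b by (simp add: one_less_power)
      moreover have "b * (b + 2) > 0" using b by simp
      ultimately show ?thesis by (simp add: pos_divide_le_eq pos_le_divide_eq) (simp add: algebra_simps)
    qed
    moreover have "(b - 1)\<^sup>2 / (b ^ 3 + b\<^sup>2 - b) \<le> 2 * (b - 2) / (b * (b + 2))"
    proof -
      have "0 \<le> b * b + 17 / 20 * b - 231 / 400" using b2 True by linarith
      then have "0 \<le> (b - 57 / 20) * (b * b + 17 / 20 * b - 231 / 400) + 2833 / 8000"
        using True by (intro add_nonneg_nonneg mult_nonneg_nonneg) auto
      then have "b * (b * b) \<ge> 2 * (b * b) + 3 * b - 2" by (simp add: field_simps)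
      then have "(b - 1)\<^sup>2 * (b + 2) \<le> 2 * (b - 2) * (b\<^sup>2 + b - 1)"
        by (simp add: power2_eq_square algebra_simps)
      then have *: "(b - 1)\<^sup>2 / (b\<^sup>2 + b - 1) \<le> 2 * (b - 2) / (b + 2)"
      proof -
        have "b\<^sup>2 + b - 1 > 0" unfolding power2_eq_square using b2 True by linarith
        then show ?thesis using \<open>(b - 1)\<^sup>2 * (b + 2) \<le> _\<close> True by (simp add: pos_divide_le_eq pos_le_divide_eq)
      qed
      have "(b - 1)\<^sup>2 / (b ^ 3 + b\<^sup>2 - b) = (b - 1)\<^sup>2 / (b\<^sup>2 + b - 1) / b"
        by (simp add: power2_eq_square power3_eq_cube algebra_simps)
      also have "\<dots> \<le> 2 * (b - 2) / (b + 2) / b" using * True by (intro divide_right_mono) auto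
      finally show ?thesis by (simp add: mult.commute)
    qed
    ultimately have "g b \<le> b * k - 2 / b - b + 2" by (simp add: g_def kb)
    then show ?thesis using zero_free_large[OF True] unfolding k_def by blast
  next
    case False
    define k where "k = (191 + 16 * b) / 400"
    have r: "19 / 10 \<le> b" "b \<le> 57 / 20" using False b19 by auto
    have b2: "b * b \<ge> 19 / 10 * b" using r by (intro mult_right_mono) auto
    have kb: "b * k - 2 / b - b + 2 = (b\<^sup>2 * k - 2 - b\<^sup>2 + 2 * b) / b"
      using r by (simp add: field_simps power2_eq_square)
    have "(b - 2) / (b\<^sup>2 - 1) \<le> (b\<^sup>2 * k - 2 - b\<^sup>2 + 2 * b) / b"
    proof -
      have "b * (b - 2) \<le> (b\<^sup>2 * k - 2 - b\<^sup>2 + 2 * b) * (b\<^sup>2 - 1)" using small_g1[OF r] by (simp add: k_def)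
      moreover have "b\<^sup>2 - 1 > 0" using b by (simp add: one_less_power)
      ultimately show ?thesis using r by (simp add: pos_divide_le_eq pos_le_divide_eq mult.commute)
    qed
    moreover have "(b - 1)\<^sup>2 / (b ^ 3 + b\<^sup>2 - b) \<le> (b\<^sup>2 * k - 2 - b\<^sup>2 + 2 * b) / b"
    proof -
      have "(b - 1)\<^sup>2 \<le> (b\<^sup>2 * k - 2 - b\<^sup>2 + 2 * b) * (b\<^sup>2 + b - 1)" using small_g2[OF r] by (simp add: k_def)
      moreover have "b\<^sup>2 + b - 1 > 0" unfolding power2_eq_square using b2 r by linarith
      ultimately have *: "(b - 1)\<^sup>2 / (b\<^sup>2 + b - 1) \<le> b\<^sup>2 * k - 2 - b\<^sup>2 + 2 * b" by (simp add: pos_divide_le_eq)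
      have "(b - 1)\<^sup>2 / (b ^ 3 + b\<^sup>2 - b) = (b - 1)\<^sup>2 / (b\<^sup>2 + b - 1) / b"
        by (simp add: power2_eq_square power3_eq_cube algebra_simps)
      also have "\<dots> \<le> (b\<^sup>2 * k - 2 - b\<^sup>2 + 2 * b) / b" using * r by (intro divide_right_mono) auto
      finally show ?thesis .
    qed
    ultimately have "g b \<le> b * k - 2 / b - b + 2" by (simp add: g_def kb)
    then show ?thesis using zero_free_small[OF r] unfolding k_def by blast
  qed
  then obtain k q k1 r where zf: "zero_free b (b * k - 1 / b) q k1 k r"
    and gb: "g b \<le> b * k - 2 / b - b + 2" by blast
  have "1 / b - c < b * k - 1 / b" using bc gb by simp
  with zf show ?thesis by (rule that)
qed

section \<open>The truncated recursion for the ratios\<close>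

text \<open>Neither tree encodes a natural number; they label vertices whose spin is fixed to 0 and 1.\<close>

definition pin0 :: data where "pin0 = Node (Node (Node Atom Atom) Atom) Atom"
definition pin1 :: data where "pin1 = Node (Node Atom (Node Atom Atom)) Atom"

lemma pin_neq [simp]: "pin0 \<noteq> pin1" "pin1 \<noteq> pin0"
  by (simp_all add: pin0_def pin1_def)

lemma enc_nat_pin [simp]: "enc_nat n \<noteq> pin0" "enc_nat n \<noteq> pin1" "pin0 \<noteq> enc_nat n" "pin1 \<noteq> enc_nat n"
  by (subst enc_nat.simps, simp add: pin0_def pin1_def enc_bit_def)+

definition sb :: "data \<Rightarrow> data \<Rightarrow> data \<times> data \<Rightarrow> data \<times> data" where
  "sb v w e = (if fst e = v then w else fst e, if snd e = v then w else snd e)"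

text \<open>The accumulator lets \<open>go\<close> join the edges already passed in the same sweep.
  The order is lost, which is harmless because partition sums depend only on the multiset of
  edges.\<close>

fun rsub :: "data \<Rightarrow> data \<Rightarrow> (data \<times> data) list \<Rightarrow> (data \<times> data) list \<Rightarrow> (data \<times> data) list" where
  "rsub v w [] acc = acc"
| "rsub v w (e # es) acc = rsub v w es (sb v w e # acc)"

lemma mset_rsub: "mset (rsub v w es acc) = mset (map (sb v w) es @ acc)"
  by (induction v w es acc rule: rsub.induct) auto

section \<open>Arithmetic of polynomials with natural coefficients\<close>

fun padd :: "nat list \<Rightarrow> nat list \<Rightarrow> nat list" where
  "padd [] ys = ys"
| "padd (x # xs) [] = x # xs"
| "padd (x # xs) (y # ys) = (x + y) # padd xs ys"

definition pscale :: "nat \<Rightarrow> nat list \<Rightarrow> nat list" where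
  "pscale c xs = map (times c) xs"

fun pmul :: "nat list \<Rightarrow> nat list \<Rightarrow> nat list" where
  "pmul [] ys = []"
| "pmul (x # xs) ys = padd (pscale x ys) (0 # pmul xs ys)"

text \<open>If \<open>XY\<close> represents \<open>x = X / Y\<close>, the result represents \<open>(1 + C x) / (B + x)\<close> for \<open>B = p / q\<close> and
  \<open>C = (q / p) (1 + (a / q\<^sup>2) z)\<close>, with denominators cleared so that all coefficients are natural numbers.\<close>

definition pfac :: "nat \<Rightarrow> nat \<Rightarrow> nat \<Rightarrow> nat list \<times> nat list \<Rightarrow> nat list \<times> nat list" where
  "pfac p q a XY = (let U = padd (pscale p (snd XY)) (pscale q (fst XY))
     in (padd (pscale q U) (0 # pscale a (fst XY)), pscale p U))"

definition other :: "data \<Rightarrow> data \<times> data \<Rightarrow> data option" where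
  "other v e = (if fst e = v then Some (snd e) else if snd e = v then Some (fst e) else None)"

text \<open>A fraction of polynomials in \<open>z\<close> agreeing to order \<open>N\<close> with the ratio at \<open>v\<close>.  The ends at \<open>v\<close> of its
  edges are moved from \<open>pin0\<close> to \<open>pin1\<close> one after another; each move contributes a factor that depends
  on the ratio at the other end, which is needed to one order less only.\<close>

function go :: "nat \<Rightarrow> nat \<Rightarrow> nat \<Rightarrow> nat \<Rightarrow> data \<Rightarrow> (data \<times> data) list \<Rightarrow> (data \<times> data) list \<Rightarrow> nat list \<times> nat list"
  where
  "go p q a N v pre [] = ([1], [1])"
| "go p q a N v pre (e # suf) = (case other v e of
     None \<Rightarrow> go p q a N v (e # pre) suf
   | Some w \<Rightarrow>
      (let A = pfac p q a (if w = pin0 then ([], [1]) else if w = pin1 then ([1], [])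
                 else case N of 0 \<Rightarrow> ([], [1]) | Suc n \<Rightarrow> go p q a n w [] (rsub v pin0 suf pre));
           X = go p q a N v ((pin1, w) # pre) suf
       in (pmul (fst A) (fst X), pmul (snd A) (snd X))))"
  by pat_completeness auto
termination
  by (relation "measures [\<lambda>(p, q, a, N, v, pre, es). N, \<lambda>(p, q, a, N, v, pre, es). length es]") auto

section \<open>Coefficient lists as power series, and congruence modulo a power of z\<close>

definition fl :: "nat list \<Rightarrow> complex fps" where
  "fl xs = Abs_fps (\<lambda>i. if i < length xs then of_nat (xs ! i) else 0)"

lemma fl_Nil [simp]: "fl [] = 0"
  by (simp add: fl_def fps_eq_iff)

lemma fl_Cons: "fl (x # xs) = of_nat x + fps_X * fl xs"
  by (rule fps_ext) (auto simp: fl_def fps_of_nat nth_Cons split: nat.split simp flip: fps_of_nat)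

lemma fl_padd: "fl (padd xs ys) = fl xs + fl ys"
  by (induction xs ys rule: padd.induct) (auto simp: fl_Cons algebra_simps)

lemma fl_pscale: "fl (pscale c xs) = of_nat c * fl xs"
  by (induction xs) (auto simp: fl_Cons pscale_def algebra_simps)

lemma fl_pmul: "fl (pmul xs ys) = fl xs * fl ys"
  by (induction xs) (auto simp: fl_Cons fl_padd fl_pscale algebra_simps)

definition agree :: "nat \<Rightarrow> complex fps \<Rightarrow> complex fps \<Rightarrow> bool" where
  "agree N f h \<longleftrightarrow> (\<exists>k. f - h = fps_X ^ N * k)"

lemma agree_refl [simp]: "agree N f f"
  by (auto simp: agree_def intro: exI[of _ 0])

lemma agree_0 [simp]: "agree 0 f h"
  by (auto simp: agree_def)

lemma agree_mult:
  assumes "agree N f h" "agree N f' h'" shows "agree N (f * f') (h * h')"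
proof -
  from assms obtain k k' where "f = h + fps_X ^ N * k" "f' = h' + fps_X ^ N * k'"
    unfolding agree_def by (metis add.commute diff_add_cancel)
  then have "f * f' - h * h' = fps_X ^ N * (k * f' + h * k')" by (simp add: algebra_simps)
  then show ?thesis unfolding agree_def by blast
qed

lemma agree_nth: "agree N f h \<Longrightarrow> i < N \<Longrightarrow> fps_nth f i = fps_nth h i"
proof -
  assume "agree N f h" "i < N"
  then obtain k where "f = h + fps_X ^ N * k" unfolding agree_def by (metis add.commute diff_add_cancel)
  with \<open>i < N\<close> show ?thesis by (simp add: fps_X_power_mult_nth)
qed

text \<open>The deviation of the output ratio from \<open>\<phi>\<close> is one order smaller than that of the input
  ratio from \<open>x\<close>, because \<open>x\<close> enters \<open>\<phi>\<close> only through the multiple \<open>X * x\<close>.\<close>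

lemma pfac_agree:
  fixes p q a :: nat
  assumes pq: "p > 0" "q > 0"
    and B: "B = fps_const (of_nat p / of_nat q)" and C: "C = fps_const (of_nat q / of_nat p) * (1 + fps_const (of_nat a / of_nat q ^ 2) * fps_X)"
    and ag: "agree N (fl (fst XY)) (fl (snd XY) * x)"
    and \<phi>: "\<phi> * (B + x) = 1 + C * x" and nz: "fps_nth (B + x) 0 \<noteq> 0"
  shows "agree (Suc N) (fl (fst (pfac p q a XY))) (fl (snd (pfac p q a XY)) * \<phi>)"
proof -
  define X where "X = fl (fst XY)"
  define Y where "Y = fl (snd XY)"
  define P where "P = (of_nat p :: complex fps)"
  define Q where "Q = (of_nat q :: complex fps)"
  define A where "A = (of_nat a :: complex fps)"
  obtain k where k: "X = Y * x + fps_X ^ N * k" using ag unfolding agree_def X_def Y_def by (metis add.commute diff_add_cancel)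
  define U where "U = P * Y + Q * X"
  have num: "fl (fst (pfac p q a XY)) = Q * U + fps_X * (A * X)"
    by (simp add: pfac_def Let_def fl_padd fl_pscale fl_Cons X_def Y_def P_def Q_def A_def U_def)
  have den: "fl (snd (pfac p q a XY)) = P * U"
    by (simp add: pfac_def Let_def fl_padd fl_pscale X_def Y_def P_def Q_def U_def)
  have QB: "Q * B = P" using pq by (simp add: Q_def P_def B fps_of_nat[symmetric] fps_const_mult[symmetric] del: fps_const_mult)
  have PC: "P * Q * C = Q * Q + A * fps_X"
  proof -
    have "P * Q * C = fps_const (of_nat q * of_nat q) * (1 + fps_const (of_nat a / of_nat q ^ 2) * fps_X)"
      using pq by (simp add: P_def Q_def C mult.assoc[symmetric] flip: fps_of_nat)
    also have "\<dots> = Q * Q + A * fps_X"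
      using pq by (simp add: Q_def A_def distrib_left mult.assoc[symmetric] power2_eq_square flip: fps_of_nat)
    finally show ?thesis .
  qed
  have U: "U = Q * Y * (B + x) + Q * (fps_X ^ N * k)"
    unfolding U_def by (simp add: QB[symmetric] k algebra_simps)
  have "inverse (B + x) * (B + x) = 1" using nz by (rule inverse_mult_eq_1)
  define I where "I = inverse (B + x)"
  have I: "I * (B + x) = 1" unfolding I_def by fact
  \<comment> \<open>Multiplying by \<open>Q * (B + x)\<close>, a unit, clears all fractions. The
    terms without \<open>A\<close> cancel, and the rest is a multiple of the difference between
    \<open>X\<close> and \<open>Y * x\<close>, with one extra factor \<open>fps_X\<close>.\<close>
  have L: "(Q * U + fps_X * (A * X) - P * U * \<phi>) * Q * (B + x)
      = fps_X ^ Suc N * (A * k * Q * B)"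
  proof -
    have "(Q * U + fps_X * (A * X) - P * U * \<phi>) * Q * (B + x)
        = Q * Q * U * (B + x) + fps_X * A * X * Q * (B + x) - P * Q * U * (1 + C * x)"
      by (simp add: \<phi>[symmetric] algebra_simps)
    also have "P * Q * U * (1 + C * x) = U * (P * Q + (P * Q * C) * x)" by (simp add: algebra_simps)
    also have "\<dots> = U * (Q * Q * B + (Q * Q + A * fps_X) * x)"
      unfolding PC by (simp add: QB[symmetric] mult_ac)
    also have "Q * Q * U * (B + x) + fps_X * A * X * Q * (B + x) - U * (Q * Q * B + (Q * Q + A * fps_X) * x)
       = A * fps_X * (X * Q * (B + x) - U * x)" by (simp add: algebra_simps)
    also have "X * Q * (B + x) - U * x = fps_X ^ N * k * Q * B"
      unfolding U k by (simp add: algebra_simps)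
    finally show ?thesis by (simp add: algebra_simps)
  qed
  define J where "J = (fps_const (1 / of_nat q) :: complex fps)"
  have J: "Q * J = 1" using pq by (simp add: Q_def J_def flip: fps_of_nat)
  have "Q * U + fps_X * (A * X) - P * U * \<phi> = (Q * U + fps_X * (A * X) - P * U * \<phi>) * (Q * J) * (I * (B + x))"
    by (simp only: I J mult_1_right)
  also have "\<dots> = (Q * U + fps_X * (A * X) - P * U * \<phi>) * Q * (B + x) * (J * I)" by (simp only: mult_ac)
  also have "\<dots> = fps_X ^ Suc N * (A * k * Q * B * (J * I))" unfolding L by (simp only: mult_ac)
  finally have "Q * U + fps_X * (A * X) - P * U * \<phi> = fps_X ^ Suc N * (A * k * Q * B * (J * I))" .
  then show ?thesis unfolding num den agree_def by blast
qed

text \<open>A vertex of fixed spin can be renamed to a pin in the edge list. Thus the recursion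
  always works with \<open>T\<close> = {pin1} and never stores which vertices are fixed.\<close>

lemma zs_subst1:
  assumes "pin1 \<in> T"
  shows "zs b c (\<lambda>_. 1) es (insert v T) F = zs b c (\<lambda>_. 1) (map (sb v pin1) es) T F"
proof -
  have "ew b c (insert v T \<union> S) e = ew b c (T \<union> S) (sb v pin1 e)" for S e
    using assms by (auto simp: ew_def sb_def)
  then have "map (ew b c (insert v T \<union> S)) es = map (ew b c (T \<union> S)) (map (sb v pin1) es)" for S by simp
  then show ?thesis unfolding zs_def wt_def by (intro sum.cong refl arg_cong2[where f = times]) (simp, metis)
qed

lemma zs_subst0:
  assumes "v \<notin> T \<union> F" "pin0 \<notin> T \<union> F"
  shows "zs b c (\<lambda>_. 1) es T F = zs b c (\<lambda>_. 1) (map (sb v pin0) es) T F"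
proof -
  have *: "ew b c (T \<union> S) e = ew b c (T \<union> S) (sb v pin0 e)" if "S \<subseteq> F" for S e
    using assms that by (auto simp: ew_def sb_def)
  have "prod_list (map (ew b c (T \<union> S)) es) = prod_list (map (ew b c (T \<union> S)) (map (sb v pin0) es))"
    if "S \<in> Pow F" for S
    unfolding map_map o_def by (rule arg_cong[OF map_cong[OF refl]], rule *) (use that in blast)
  then show ?thesis unfolding zs_def wt_def by (intro sum.cong refl arg_cong2[where f = times])
qed

lemma fps_nth_0_prod_list: "fps_nth (prod_list xs) 0 = prod_list (map (\<lambda>f. fps_nth f 0) xs)"
  for xs :: "complex fps list"
  by (induction xs) (auto simp: fps_mult_nth_0)

lemma zs_fps_0:
  "fps_nth (zs B C (\<lambda>_. 1) es T F) 0 = zs (fps_nth B 0) (fps_nth C 0) (\<lambda>_. 1) es T F"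
  for B C :: "complex fps"
proof -
  have "fps_nth (ew B C S e) 0 = ew (fps_nth B 0) (fps_nth C 0) S e" for S and e :: "'a \<times> 'a" by (simp add: ew_def)
  then show ?thesis by (simp add: zs_def wt_def fps_sum_nth fps_nth_0_prod_list o_def)
qed

lemma zs_of_real:
  "zs (of_real b) (of_real c) (\<lambda>_. 1) es T F = complex_of_real (zs b c (\<lambda>_. 1) es T F)"
proof -
  have "ew (of_real b) (of_real c) S e = complex_of_real (ew b c S e)" for S and e :: "'a \<times> 'a" by (simp add: ew_def)
  moreover have "prod_list (map (\<lambda>e. complex_of_real (h e)) xs) = of_real (prod_list (map h xs))" for h :: "'a \<times> 'a \<Rightarrow> real" and xs
    by (induction xs) auto
  ultimately show ?thesis by (simp add: zs_def wt_def)
qed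

lemma zs_pos:
  assumes "b > 0" "c > 0" "finite F"
  shows "zs b c (\<lambda>_. 1) es T F > (0 :: real)"
proof -
  have "prod_list (map (ew b c S) es) > 0" for S using assms by (induction es) (auto simp: ew_def)
  then show ?thesis unfolding zs_def wt_def using assms by (intro sum_pos) auto
qed

definition bfps :: "nat \<Rightarrow> nat \<Rightarrow> complex fps" where
  "bfps p q = fps_const (of_nat p / of_nat q)"

text \<open>The second parameter along the path. For \<open>a\<close> = q^2 + p g, the later choice,
  its value at z = -1 is - g / q.\<close>

definition cfps :: "nat \<Rightarrow> nat \<Rightarrow> nat \<Rightarrow> complex fps" where
  "cfps p q a = fps_const (of_nat q / of_nat p) * (1 + fps_const (of_nat a / of_nat q ^ 2) * fps_X)"

definition zf :: "nat \<Rightarrow> nat \<Rightarrow> nat \<Rightarrow> (data \<times> data) list \<Rightarrow> data set \<Rightarrow> data set \<Rightarrow> complex fps" where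
  "zf p q a = zs (bfps p q) (cfps p q a) (\<lambda>_. 1)"

text \<open>At z = 0 both parameters are positive, so every configuration contributes a positive
  weight. Hence partition sums are units in the ring of power series and ratios exist there.\<close>

lemma zf_0:
  assumes "p > 0" "q > 0" "finite F"
  obtains r where "r > 0" "fps_nth (zf p q a es T F) 0 = complex_of_real r"
proof -
  have "fps_nth (bfps p q) 0 = complex_of_real (real p / real q)" by (simp add: bfps_def)
  moreover have "fps_nth (cfps p q a) 0 = complex_of_real (real q / real p)" by (simp add: cfps_def fps_mult_nth_0)
  ultimately have "fps_nth (zf p q a es T F) 0 = complex_of_real (zs (real p / real q) (real q / real p) (\<lambda>_. 1) es T F)"
    by (simp only: zf_def zs_fps_0 zs_of_real)
  then show ?thesis using that zs_pos[of "real p / real q" "real q / real p" F es T] assms by simp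
qed

lemma zf_mset: "mset es = mset es' \<Longrightarrow> zf p q a es = zf p q a es'"
  unfolding zf_def by (intro ext zs_mset)

definition h0 :: "nat list \<Rightarrow> nat" where "h0 xs = (case xs of [] \<Rightarrow> 0 | x # _ \<Rightarrow> x)"

lemma fl_h0: "fps_nth (fl xs) 0 = of_nat (h0 xs)"
  by (auto simp: fl_def h0_def split: list.split)

lemma h0_padd: "h0 (padd xs ys) = h0 xs + h0 ys"
  by (induction xs ys rule: padd.induct) (auto simp: h0_def)

lemma h0_pscale: "h0 (pscale c xs) = c * h0 xs"
  by (cases xs) (auto simp: h0_def pscale_def)

lemma h0_pmul: "h0 (pmul xs ys) = h0 xs * h0 ys"
  by (cases xs) (auto simp: h0_padd h0_pscale, auto simp: h0_def)

lemma h0_pfac: "p > 0 \<Longrightarrow> q > 0 \<Longrightarrow> h0 (fst XY) > 0 \<or> h0 (snd XY) > 0 \<Longrightarrow> h0 (snd (pfac p q a XY)) > 0"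
  by (auto simp: pfac_def Let_def h0_padd h0_pscale)

text \<open>Loops at pins arise once both ends of an edge have been fixed. A loop at a free vertex
  is excluded, because \<open>go\<close> moves a single end of each edge.\<close>

definition simple_on :: "data set \<Rightarrow> (data \<times> data) list \<Rightarrow> bool" where
  "simple_on V es \<longleftrightarrow> (\<forall>e \<in> set es. fst e \<in> V \<union> {pin0, pin1} \<and> snd e \<in> V \<union> {pin0, pin1} \<and>
      (fst e = snd e \<longrightarrow> fst e \<in> {pin0, pin1}))"

lemma simple_on_Cons: "simple_on V (e # es) \<longleftrightarrow> simple_on V [e] \<and> simple_on V es"
  by (auto simp: simple_on_def)

lemma simple_on_append: "simple_on V (es @ es') \<longleftrightarrow> simple_on V es \<and> simple_on V es'"
  by (auto simp: simple_on_def)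

lemma simple_on_sb: "simple_on (insert v V) es \<Longrightarrow> w \<in> {pin0, pin1} \<Longrightarrow> simple_on V (map (sb v w) es)"
  by (auto simp: simple_on_def sb_def)

lemma simple_on_mset: "mset es = mset es' \<Longrightarrow> simple_on V es \<longleftrightarrow> simple_on V es'"
  unfolding simple_on_def by (metis set_mset_mset)

text \<open>Moving the end of \<open>e\<close> while the remaining ends are still at
  \<open>pin0\<close> changes the sum by a factor \<phi>; moving the remaining ends afterwards
  changes it by \<open>r\<close>, and the two telescope. The ratio \<open>x\<close> at the other end
  \<open>w\<close> enters \<phi> through \<open>pfac\<close>, which gains one order, so
  \<open>w\<close> is explored with \<open>N\<close> reduced by one. The positive constant term
  makes each denominator a unit.\<close>

lemma go_agree:
  assumes pq: "p > 0" "q > 0"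
  shows "finite F \<Longrightarrow> v \<notin> F \<union> {pin0, pin1} \<Longrightarrow> pin0 \<notin> F \<Longrightarrow> pin1 \<notin> F \<Longrightarrow>
    simple_on F pre \<Longrightarrow> simple_on (insert v F) suf \<Longrightarrow>
    (\<exists>r. zf p q a (pre @ map (sb v pin1) suf) {pin1} F = r * zf p q a (pre @ map (sb v pin0) suf) {pin1} F \<and>
      agree (Suc N) (fl (fst (go p q a N v pre suf))) (fl (snd (go p q a N v pre suf)) * r)) \<and>
    h0 (snd (go p q a N v pre suf)) > 0"
proof (induction N arbitrary: v pre suf F rule: less_induct)
  case (less N)
  note IHN = less.IH
  show ?case
    using less.prems
  proof (induction suf arbitrary: pre)
    case Nil
    show ?case by (intro conjI exI[of _ 1]) (simp_all add: fl_Cons h0_def)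
  next
    case (Cons e suf)
    note vF = Cons.prems(2)
    have sp: "simple_on (insert v F) [e]" "simple_on (insert v F) suf"
      using Cons.prems(6) simple_on_Cons[of _ e suf] by blast+
    show ?case
    proof (cases "other v e")
      case None
      then have sbe: "sb v w e = e" for w by (cases e) (auto simp: other_def sb_def split: if_splits)
      have "simple_on F [e]" using sp(1) None by (auto simp: simple_on_def other_def split: if_splits)
      then have "simple_on F (e # pre)" using Cons.prems(5) simple_on_Cons[of _ e pre] by blast
      from Cons.IH[OF Cons.prems(1-4) this sp(2)] None
      have IH: "(\<exists>r. zf p q a ((e # pre) @ map (sb v pin1) suf) {pin1} F = r * zf p q a ((e # pre) @ map (sb v pin0) suf) {pin1} F \<and>
        agree (Suc N) (fl (fst (go p q a N v pre (e # suf)))) (fl (snd (go p q a N v pre (e # suf))) * r)) \<and>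
        h0 (snd (go p q a N v pre (e # suf))) > 0" by simp
      have "zf p q a (pre @ map (sb v w) (e # suf)) = zf p q a ((e # pre) @ map (sb v w) suf)" for w
        by (rule zf_mset) (simp add: sbe)
      with IH show ?thesis by metis
    next
      case (Some w)
      define e1 where "e1 = (pin1, w)"
      define D where "D = pre @ map (sb v pin0) suf"
      have wv: "w \<noteq> v" using Some sp(1) vF by (auto simp: other_def simple_on_def split: if_splits)
      have wF: "w \<in> F \<union> {pin0, pin1}" using Some sp(1) wv by (auto simp: other_def simple_on_def split: if_splits)
      have sbe: "sb v z e = (z, w) \<or> sb v z e = (w, z)" for z
        using Some wv by (cases e) (auto simp: other_def sb_def split: if_splits)
      have ews: "ew b c S (sb v z e) = ew b c S (z, w)" for b c :: "complex fps" and S z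
        using sbe[of z] by (auto simp: ew_def)
      have zfc: "zf p q a (sb v z e # es) T F = zf p q a ((z, w) # es) T F" for z es T F
        unfolding zf_def zs_def wt_Cons ews by (rule refl)
      have "simple_on F ((pin1, w) # pre)" using Cons.prems(5) wF Cons.prems(2-4)
        by (auto simp: simple_on_def)
      from Cons.IH[OF Cons.prems(1-4) this sp(2)] obtain r where
        r: "zf p q a ((pin1, w) # pre @ map (sb v pin1) suf) {pin1} F = r * zf p q a ((pin1, w) # D) {pin1} F"
        and rag: "agree (Suc N) (fl (fst (go p q a N v ((pin1, w) # pre) suf))) (fl (snd (go p q a N v ((pin1, w) # pre) suf)) * r)"
        and rh: "h0 (snd (go p q a N v ((pin1, w) # pre) suf)) > 0" by (auto simp: D_def)
      define XY where "XY = (if w = pin0 then ([], [1]) else if w = pin1 then ([1], [])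
                 else case N of 0 \<Rightarrow> ([], [1]) | Suc n \<Rightarrow> go p q a n w [] (rsub v pin0 suf pre))"
      have goeq: "go p q a N v pre (e # suf) =
        (pmul (fst (pfac p q a XY)) (fst (go p q a N v ((pin1, w) # pre) suf)),
         pmul (snd (pfac p q a XY)) (snd (go p q a N v ((pin1, w) # pre) suf)))"
        using Some by (simp add: XY_def Let_def)
      have "(\<exists>\<phi>. zf p q a ((pin1, w) # D) {pin1} F = \<phi> * zf p q a ((pin0, w) # D) {pin1} F \<and>
         agree (Suc N) (fl (fst (pfac p q a XY))) (fl (snd (pfac p q a XY)) * \<phi>)) \<and>
         (h0 (fst XY) > 0 \<or> h0 (snd XY) > 0)"
      proof -
        have B1: "bfps p q = fps_const (of_nat p / of_nat q)" by (simp add: bfps_def)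
        have B2: "fps_const (of_nat q / of_nat p) * bfps p q = 1" using pq by (simp add: bfps_def)
        have B3: "fps_nth (bfps p q) 0 \<noteq> 0" using pq by (simp add: bfps_def)
        consider "w = pin0" | "w = pin1" | "w \<in> F" "w \<notin> {pin0, pin1}" using wF Cons.prems by auto
        then show ?thesis
        proof cases
          case 1
          have "zf p q a ((pin1, w) # D) {pin1} F = 1 * zf p q a D {pin1} F"
            unfolding zf_def using 1 Cons.prems by (intro zs_Cons) (auto simp: ew_def)
          moreover have "zf p q a ((pin0, w) # D) {pin1} F = bfps p q * zf p q a D {pin1} F"
            unfolding zf_def using 1 Cons.prems by (intro zs_Cons) (auto simp: ew_def)
          ultimately have "zf p q a ((pin1, w) # D) {pin1} F = fps_const (of_nat q / of_nat p) * zf p q a ((pin0, w) # D) {pin1} F"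
            using B2 by (simp add: mult.assoc[symmetric])
          moreover have XY: "XY = ([], [1])" using 1 by (simp add: XY_def)
          moreover have "agree (Suc N) (fl (fst (pfac p q a XY))) (fl (snd (pfac p q a XY)) * fps_const (of_nat q / of_nat p))"
            by (rule pfac_agree[OF pq B1 cfps_def[of p q a], of N XY 0]) (use XY B2 B3 in auto)
          ultimately show ?thesis by (auto simp: h0_def)
        next
          case 2
          have "zf p q a ((pin1, w) # D) {pin1} F = cfps p q a * zf p q a D {pin1} F"
            unfolding zf_def using 2 Cons.prems by (intro zs_Cons) (auto simp: ew_def)
          moreover have "zf p q a ((pin0, w) # D) {pin1} F = 1 * zf p q a D {pin1} F"
            unfolding zf_def using 2 Cons.prems by (intro zs_Cons) (auto simp: ew_def)
          \<comment> \<open>The ratio at a vertex of spin 1 is infinite, represented by the fraction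
            1 / 0; \<open>pfac\<close> turns it into the parameter itself.\<close>
          moreover have XY: "XY = ([1], [])" using 2 by (simp add: XY_def)
          moreover have "fl (fst (pfac p q a XY)) = fl (snd (pfac p q a XY)) * cfps p q a"
          proof -
            have "fl (fst (pfac p q a XY)) = of_nat q * of_nat q + fps_X * of_nat a"
              by (simp add: XY pfac_def Let_def fl_padd fl_pscale fl_Cons)
            moreover have "fl (snd (pfac p q a XY)) = of_nat p * of_nat q"
              by (simp add: XY pfac_def Let_def fl_padd fl_pscale fl_Cons)
            moreover have "of_nat p * of_nat q * cfps p q a = fps_const (of_nat q * of_nat q) * (1 + fps_const (of_nat a / of_nat q ^ 2) * fps_X)"
              using pq by (simp add: cfps_def mult.assoc[symmetric] flip: fps_of_nat)
            moreover have "\<dots> = of_nat q * of_nat q + of_nat a * fps_X"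
              using pq by (simp add: distrib_left mult.assoc[symmetric] power2_eq_square flip: fps_of_nat)
            ultimately show ?thesis by (simp add: mult.commute)
          qed
          ultimately show ?thesis by (auto simp: h0_def)
        next
          case 3
          define F' where "F' = F - {w}"
          have F': "finite F'" "w \<notin> F' \<union> {pin0, pin1}" "pin0 \<notin> F'" "pin1 \<notin> F'" "insert w F' = F"
            using 3 Cons.prems by (auto simp: F'_def)
          define z where "z = zf p q a D {pin1} F'"
          define z' where "z' = zf p q a D {w, pin1} F'"
          obtain rz where rz: "rz > 0" "fps_nth z 0 = complex_of_real rz"
            unfolding z_def using zf_0[OF pq F'(1)] by metis
          obtain rz' where rz': "rz' > 0" "fps_nth z' 0 = complex_of_real rz'"
            unfolding z'_def using zf_0[OF pq F'(1)] by metis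
          \<comment> \<open>The ratio at \<open>w\<close> with all its edges present except the one
            being moved.\<close>
          define x where "x = z' * inverse z"
          have xz: "z' = x * z" using rz by (simp add: x_def mult.assoc inverse_mult_eq_1)
          have x0: "fps_nth x 0 = complex_of_real (rz' / rz)" using rz rz' by (simp add: x_def fps_mult_nth_0 field_simps)
          have Bx: "fps_nth (bfps p q + x) 0 \<noteq> 0"
          proof -
            have "fps_nth (bfps p q + x) 0 = complex_of_real (real p / real q + rz' / rz)" by (simp add: x0 bfps_def)
            moreover have "real p / real q + rz' / rz > 0" using pq rz rz' by (simp add: add_pos_pos)
            ultimately show ?thesis by (metis of_real_eq_0_iff less_irrefl)
          qed
          define \<phi> where "\<phi> = (1 + cfps p q a * x) * inverse (bfps p q + x)"
          have \<phi>: "\<phi> * (bfps p q + x) = 1 + cfps p q a * x"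
            using Bx by (simp add: \<phi>_def mult.assoc inverse_mult_eq_1)
          have "zf p q a ((pin1, w) # D) {pin1} F = z + cfps p q a * z'"
          proof -
            have "zf p q a ((pin1, w) # D) {pin1} F' = 1 * z"
              unfolding zf_def z_def using F' by (intro zs_Cons) (auto simp: ew_def)
            moreover have "zf p q a ((pin1, w) # D) {w, pin1} F' = cfps p q a * z'"
              unfolding zf_def z'_def using F' by (intro zs_Cons) (auto simp: ew_def)
            ultimately show ?thesis
              using zs_split[OF Cons.prems(1) 3(1), of "bfps p q" "cfps p q a" "\<lambda>_. 1" "(pin1, w) # D" "{pin1}"]
              by (simp add: zf_def F'_def)
          qed
          moreover have "zf p q a ((pin0, w) # D) {pin1} F = bfps p q * z + z'"
          proof -
            have "zf p q a ((pin0, w) # D) {pin1} F' = bfps p q * z"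
              unfolding zf_def z_def using F' by (intro zs_Cons) (auto simp: ew_def)
            moreover have "zf p q a ((pin0, w) # D) {w, pin1} F' = 1 * z'"
              unfolding zf_def z'_def using F' by (intro zs_Cons) (auto simp: ew_def)
            ultimately show ?thesis
              using zs_split[OF Cons.prems(1) 3(1), of "bfps p q" "cfps p q a" "\<lambda>_. 1" "(pin0, w) # D" "{pin1}"]
              by (simp add: zf_def F'_def)
          qed
          ultimately have eq: "zf p q a ((pin1, w) # D) {pin1} F = \<phi> * zf p q a ((pin0, w) # D) {pin1} F"
          proof -
            assume 1: "zf p q a ((pin1, w) # D) {pin1} F = z + cfps p q a * z'"
              and 2: "zf p q a ((pin0, w) # D) {pin1} F = bfps p q * z + z'"
            have "\<phi> * (bfps p q * z + z') = \<phi> * (bfps p q + x) * z" by (simp add: xz algebra_simps)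
            also have "\<dots> = z + cfps p q a * z'" unfolding \<phi> by (simp add: xz algebra_simps)
            finally show ?thesis using 1 2 by simp
          qed
          have XYa: "agree N (fl (fst XY)) (fl (snd XY) * x) \<and> h0 (snd XY) > 0"
          proof (cases N)
            case 0
            \<comment> \<open>Agreement to order 0 is no condition, so the ratio may be replaced by
              0 / 1.\<close>
            then show ?thesis using 3 by (simp add: XY_def h0_def)
          next
            case (Suc n)
            define D' where "D' = rsub v pin0 suf pre"
            have D': "mset D' = mset D" by (simp add: D'_def D_def mset_rsub)
            have "simple_on F (map (sb v pin0) suf)" using sp(2) by (rule simple_on_sb) simp
            then have "simple_on F D" unfolding D_def using Cons.prems(5) by (simp add: simple_on_append)
            then have sD: "simple_on (insert w F') D'" using simple_on_mset[OF D'] F' by simp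
            have sN: "simple_on F' []" by (simp add: simple_on_def)
            have nN: "n < N" using Suc by simp
            have XY: "XY = go p q a n w [] D'" using 3 Suc by (simp add: XY_def D'_def)
            from IHN[OF nN F'(1-4) sN sD] obtain r' where
              r': "zf p q a (map (sb w pin1) D') {pin1} F' = r' * zf p q a (map (sb w pin0) D') {pin1} F'"
              "agree (Suc n) (fl (fst XY)) (fl (snd XY) * r')" "h0 (snd XY) > 0" by (auto simp: XY)
            have "zf p q a (map (sb w pin1) D') {pin1} F' = zf p q a D' {w, pin1} F'"
              unfolding zf_def by (rule zs_subst1[symmetric]) simp
            moreover have "zf p q a (map (sb w pin0) D') {pin1} F' = zf p q a D' {pin1} F'"
              unfolding zf_def using F' by (intro zs_subst0[symmetric]) auto
            ultimately have "z' = r' * z" using r'(1) zf_mset[OF D'] by (simp add: z_def z'_def)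
            then have "r' * z = x * z" using xz by metis
            moreover have "z \<noteq> 0"
            proof
              assume "z = 0"
              with rz(2) have "complex_of_real rz = 0" by simp
              with rz(1) show False by simp
            qed
            ultimately have "r' = x" by (metis mult_right_cancel)
            with r'(2,3) Suc show ?thesis by metis
          qed
          have "agree (Suc N) (fl (fst (pfac p q a XY))) (fl (snd (pfac p q a XY)) * \<phi>)"
            by (rule pfac_agree[OF pq B1 cfps_def[of p q a] conjunct1[OF XYa] \<phi> Bx])
          with eq have "\<exists>\<phi>. zf p q a ((pin1, w) # D) {pin1} F = \<phi> * zf p q a ((pin0, w) # D) {pin1} F \<and>
             agree (Suc N) (fl (fst (pfac p q a XY))) (fl (snd (pfac p q a XY)) * \<phi>)" by (intro exI[of _ \<phi>] conjI)
          then show ?thesis using XYa by (intro conjI disjI2) simp_all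
        qed
      qed
      then obtain \<phi> where \<phi>: "zf p q a ((pin1, w) # D) {pin1} F = \<phi> * zf p q a ((pin0, w) # D) {pin1} F"
         "agree (Suc N) (fl (fst (pfac p q a XY))) (fl (snd (pfac p q a XY)) * \<phi>)"
         "h0 (fst XY) > 0 \<or> h0 (snd XY) > 0" by (elim conjE exE) (rule that)
      have "zf p q a (pre @ map (sb v pin1) (e # suf)) {pin1} F = zf p q a ((pin1, w) # pre @ map (sb v pin1) suf) {pin1} F"
        by (subst zf_mset[of _ "sb v pin1 e # pre @ map (sb v pin1) suf"]) (simp_all only: zfc, simp)
      moreover have "zf p q a (pre @ map (sb v pin0) (e # suf)) {pin1} F = zf p q a ((pin0, w) # D) {pin1} F"
        by (subst zf_mset[of _ "sb v pin0 e # D"]) (simp_all only: zfc, simp add: D_def)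
      ultimately have zz: "zf p q a (pre @ map (sb v pin1) (e # suf)) {pin1} F
          = (\<phi> * r) * zf p q a (pre @ map (sb v pin0) (e # suf)) {pin1} F"
        by (simp only: r \<phi>(1) mult_ac)
      have "agree (Suc N) (fl (fst (go p q a N v pre (e # suf)))) (fl (snd (go p q a N v pre (e # suf))) * (\<phi> * r))"
        using agree_mult[OF \<phi>(2) rag] by (simp only: goeq fst_conv snd_conv fl_pmul mult_ac)
      moreover have "h0 (snd (go p q a N v pre (e # suf))) > 0"
        unfolding goeq snd_conv h0_pmul by (rule mult_pos_pos[OF h0_pfac[OF pq \<phi>(3)] rh])
      ultimately show ?thesis using zz by (intro conjI exI[of _ "\<phi> * r"])
    qed
  qed
qed

section \<open>Taylor approximation of the partition function\<close>

text \<open>With \<open>Y = y0 + T\<close>, the difference of the two lists is \<open>\<Sum>j\<le>n. y0 ^ (n - j) * (- T) ^ j\<close>, a multiple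
  of the truncation of \<open>1 / Y\<close>; the even and the odd terms are kept apart to stay in the natural numbers.\<close>

fun hor :: "nat \<Rightarrow> nat \<Rightarrow> nat list \<Rightarrow> nat list \<times> nat list \<times> nat" where
  "hor 0 y0 T = ([1], [], 1)"
| "hor (Suc n) y0 T = (let h = hor n y0 T; y = y0 * snd (snd h)
     in (padd [y] (pmul T (fst (snd h))), pmul T (fst h), y))"

text \<open>Evaluation at \<open>z = - 1\<close> of \<open>A - B\<close>, as a difference of two natural numbers.\<close>

fun alt :: "nat \<Rightarrow> nat list \<Rightarrow> nat list \<Rightarrow> nat \<times> nat" where
  "alt 0 A B = (0, 0)"
| "alt (Suc n) A B = (let r = alt n (tl A) (tl B) in (h0 A + snd r, h0 B + fst r))"

text \<open>The fraction represents 1 plus the Taylor polynomial of degree \<open>N\<close> at z =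
  -1, which is one factor of the telescoping product. This presupposes that the natural subtraction
  does not truncate; \<open>tay_ok\<close> records that.\<close>

definition tay :: "nat \<Rightarrow> nat list \<times> nat list \<Rightarrow> nat \<times> nat" where
  "tay N XY = (let y0 = h0 (snd XY); h = hor N y0 (0 # tl (snd XY));
     s = alt (Suc N) (pmul (fst XY) (fst h)) (pmul (fst XY) (fst (snd h)));
     d = y0 * snd (snd h) in (d + fst s - snd s, d))"

definition tay_ok :: "nat \<Rightarrow> nat list \<times> nat list \<Rightarrow> bool" where
  "tay_ok N XY = (let y0 = h0 (snd XY); h = hor N y0 (0 # tl (snd XY));
     s = alt (Suc N) (pmul (fst XY) (fst h)) (pmul (fst XY) (fst (snd h)));
     d = y0 * snd (snd h) in snd s \<le> d + fst s)"

lemma hor_value: "snd (snd (hor N y0 T)) = y0 ^ N"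
  by (induction N) (auto simp: Let_def)

text \<open>A telescoping geometric sum. In its use \<open>T\<close> has constant term 0, so the
  last power vanishes to order N + 1 and the difference of lists inverts \<open>Y\<close> up to a
  constant.\<close>

lemma hor_fl:
  assumes "fl Y = of_nat y0 + fl T"
  shows "fl Y * (fl (fst (hor N y0 T)) - fl (fst (snd (hor N y0 T)))) = of_nat y0 ^ Suc N - (- fl T) ^ Suc N"
proof -
  define y where "y = (of_nat y0 :: complex fps)"
  define F where "F N = fl (fst (hor N y0 T)) - fl (fst (snd (hor N y0 T)))" for N
  have F0: "F 0 = 1" by (simp add: F_def fl_Cons)
  have FS: "F (Suc N) = y ^ Suc N - fl T * F N" for N
    by (simp add: F_def Let_def fl_padd fl_pmul fl_Cons hor_value y_def algebra_simps)
  have "(y + fl T) * F N = y ^ Suc N - (- fl T) ^ Suc N" for N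
  proof (induction N)
    case (Suc N)
    have "(y + fl T) * F (Suc N) = (y + fl T) * y ^ Suc N - fl T * ((y + fl T) * F N)"
      by (simp only: FS algebra_simps)
    also have "\<dots> = y ^ Suc (Suc N) - (- fl T) ^ Suc (Suc N)" unfolding Suc.IH by (simp add: algebra_simps)
    finally show ?case .
  qed (simp add: F0)
  then show ?thesis using assms by (simp add: F_def y_def)
qed

lemma fl_tl: "fps_nth (fl (tl A)) i = fps_nth (fl A) (Suc i)"
  by (cases A) (auto simp: fl_def)

text \<open>Horner's rule at -1, where exchanging the two components is the change of sign.\<close>

lemma alt_value:
  "of_nat (fst (alt n A B)) - of_nat (snd (alt n A B)) = (\<Sum>j<n. (-1) ^ j * fps_nth (fl A - fl B) j)"
proof (induction n A B rule: alt.induct)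
  case (2 n A B)
  have "(\<Sum>j<Suc n. (-1) ^ j * fps_nth (fl A - fl B) j)
      = fps_nth (fl A - fl B) 0 - (\<Sum>j<n. (-1) ^ j * fps_nth (fl (tl A) - fl (tl B)) j)"
    by (subst sum.lessThan_Suc_shift) (simp add: fl_tl sum_negf[symmetric])
  also have "\<dots> = of_nat (h0 A) - of_nat (h0 B) - (of_nat (fst (alt n (tl A) (tl B))) - of_nat (snd (alt n (tl A) (tl B))))"
    using 2 by (simp add: fl_h0)
  finally show ?case by (simp add: Let_def)
qed simp

lemma tay_value:
  assumes ag: "agree (Suc N) (fl (fst XY)) (fl (snd XY) * r)" and h: "h0 (snd XY) > 0"
  obtains d s t where "d > 0" "tay N XY = (d + s - t, d)" "tay_ok N XY \<longleftrightarrow> t \<le> d + s"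
    "(of_nat s - of_nat t) / of_nat d = (\<Sum>j\<le>N. (-1) ^ j * fps_nth r j)"
proof -
  define X where "X = fst XY"
  define Y where "Y = snd XY"
  define y0 where "y0 = h0 Y"
  define T where "T = 0 # tl Y"
  define H where "H = hor N y0 T"
  define s t where "s = fst (alt (Suc N) (pmul X (fst H)) (pmul X (fst (snd H))))"
    and "t = snd (alt (Suc N) (pmul X (fst H)) (pmul X (fst (snd H))))"
  define d where "d = y0 ^ Suc N"
  have "Y \<noteq> []" using h by (auto simp: Y_def h0_def)
  then have flY: "fl Y = of_nat y0 + fl T" by (cases Y) (auto simp: fl_Cons T_def y0_def h0_def)
  define F where "F = fl (fst H) - fl (fst (snd H))"
  have "(- fl T) ^ Suc N = fps_X ^ Suc N * (- fl (tl Y)) ^ Suc N"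
    by (simp add: T_def fl_Cons flip: power_mult_distrib)
  then have "fl Y * F = of_nat d - fps_X ^ Suc N * (- fl (tl Y)) ^ Suc N"
    using hor_fl[OF flY, of N] by (simp add: F_def H_def d_def)
  then have "fl Y * F - of_nat d = fps_X ^ Suc N * (- ((- fl (tl Y)) ^ Suc N))" by simp
  then have "agree (Suc N) (fl Y * F) (of_nat d)" unfolding agree_def by blast
  then have 1: "agree (Suc N) (fl Y * F * r) (of_nat d * r)" by (rule agree_mult) simp
  have 2: "agree (Suc N) (fl X * F) (fl Y * r * F)" using ag unfolding X_def Y_def by (rule agree_mult) simp
  have co: "fps_nth (fl X * F) j = of_nat d * fps_nth r j" if "j \<le> N" for j
  proof -
    have "fps_nth (fl X * F) j = fps_nth (fl Y * F * r) j" using agree_nth[OF 2, of j] that by (simp add: mult_ac)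
    also have "\<dots> = fps_nth (of_nat d * r) j" using agree_nth[OF 1, of j] that by simp
    also have "\<dots> = of_nat d * fps_nth r j" by (simp flip: fps_of_nat)
    finally show ?thesis .
  qed
  have "fl (pmul X (fst H)) - fl (pmul X (fst (snd H))) = fl X * F"
    by (simp add: fl_pmul F_def right_diff_distrib)
  then have "of_nat s - of_nat t = (\<Sum>j\<le>N. (-1) ^ j * fps_nth (fl X * F) j)"
    unfolding s_def t_def alt_value lessThan_Suc_atMost by simp
  also have "\<dots> = (\<Sum>j\<le>N. (-1) ^ j * (of_nat d * fps_nth r j))"
    by (intro sum.cong refl arg_cong2[where f = times] co) simp
  also have "\<dots> = of_nat d * (\<Sum>j\<le>N. (-1) ^ j * fps_nth r j)" by (simp add: sum_distrib_left mult_ac)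
  finally have e: "of_nat s - of_nat t = of_nat d * (\<Sum>j\<le>N. (-1) ^ j * fps_nth r j)" .
  have d0: "d > 0" using h by (simp add: d_def y0_def Y_def)
  show ?thesis
  proof (rule that[OF d0])
    show "tay N XY = (d + s - t, d)"
      by (simp add: tay_def Let_def d_def s_def t_def H_def T_def y0_def X_def Y_def hor_value)
    show "tay_ok N XY \<longleftrightarrow> t \<le> d + s"
      by (simp add: tay_ok_def Let_def d_def s_def t_def H_def T_def y0_def X_def Y_def hor_value)
    show "(of_nat s - of_nat t) / of_nat d = (\<Sum>j\<le>N. (-1) ^ j * fps_nth r j)" using e d0 by simp
  qed
qed

text \<open>Cauchy's estimate on the circle of radius R bounds the n-th coefficient by R^(-n); at -1
  the remainder is dominated by a geometric tail.\<close>

lemma taylor_error: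
  fixes f :: "complex \<Rightarrow> complex"
  assumes hol: "f holomorphic_on ball 0 R" and cont: "continuous_on (cball 0 R) f" and R: "R > 1"
    and bd: "\<And>z. cmod z = R \<Longrightarrow> cmod (f z) \<le> 1" and fps: "f has_fps_expansion r"
  shows "cmod ((\<Sum>j\<le>N. (-1) ^ j * fps_nth r j) - f (-1)) \<le> (1 / R) ^ Suc N / (1 - 1 / R)"
proof -
  have c: "cmod (fps_nth r n) \<le> (1 / R) ^ n" for n
  proof -
    have "cmod ((deriv ^^ n) f 0) \<le> fact n * 1 / R ^ n"
      using R bd by (intro Cauchy_inequality[OF hol cont]) auto
    then have "cmod ((deriv ^^ n) f 0) / fact n \<le> (fact n * 1 / R ^ n) / fact n" by (intro divide_right_mono) auto
    then show ?thesis unfolding fps_nth_fps_expansion[OF fps] by (simp add: norm_divide power_divide)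
  qed
  have "(\<lambda>n. fps_nth r n * (-1) ^ n) sums f (-1)"
    using hol R by (intro has_fps_expansion_imp_sums_complex[OF fps, of "ereal R"]) auto
  then have "(\<lambda>n. fps_nth r (n + Suc N) * (-1) ^ (n + Suc N)) sums (f (-1) - (\<Sum>j<Suc N. fps_nth r j * (-1) ^ j))"
    by (rule sums_split_initial_segment)
  then have e: "(\<Sum>n. fps_nth r (n + Suc N) * (-1) ^ (n + Suc N)) = f (-1) - (\<Sum>j\<le>N. (-1) ^ j * fps_nth r j)"
    by (simp add: sums_iff lessThan_Suc_atMost mult.commute)
  have g: "(\<lambda>n. (1 / R) ^ Suc N * (1 / R) ^ n) sums ((1 / R) ^ Suc N * (1 / (1 - 1 / R)))"
    using R by (intro sums_mult geometric_sums) auto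
  have "cmod (\<Sum>n. fps_nth r (n + Suc N) * (-1) ^ (n + Suc N)) \<le> (\<Sum>n. (1 / R) ^ Suc N * (1 / R) ^ n)"
  proof (rule norm_suminf_le)
    show "summable (\<lambda>n. (1 / R) ^ Suc N * (1 / R) ^ n)" using g by (rule sums_summable)
    show "cmod (fps_nth r (n + Suc N) * (- 1) ^ (n + Suc N)) \<le> (1 / R) ^ Suc N * (1 / R) ^ n" for n
      using c[of "n + Suc N"] by (simp add: norm_mult norm_power power_add mult_ac)
  qed
  also have "\<dots> = (1 / R) ^ Suc N / (1 - 1 / R)" using g by (simp add: sums_iff)
  finally show ?thesis using e by (simp add: norm_minus_commute)
qed

text \<open>The weight of the configuration with all spins 0, where every edge has weight p / q. The
  telescoping product starts from it.\<close>

fun ebase :: "nat \<Rightarrow> nat \<Rightarrow> (data \<times> data) list \<Rightarrow> nat \<times> nat" where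
  "ebase p q [] = (1, 1)"
| "ebase p q (e # es) = (p * fst (ebase p q es), q * snd (ebase p q es))"

lemma ebase: "ebase p q es = (p ^ length es, q ^ length es)"
  by (induction es) auto

text \<open>A loop at \<open>v\<close> has weight \<open>\<beta>\<close> or \<open>\<gamma>\<close> according to the spin of \<open>v\<close>, like the product of an edge to a
  vertex of spin 0 and an edge to a vertex of spin 1.\<close>

fun deloop :: "(data \<times> data) list \<Rightarrow> (data \<times> data) list" where
  "deloop [] = []"
| "deloop (e # es) = (if fst e = snd e then (fst e, pin0) # (fst e, pin1) # deloop es else e # deloop es)"

text \<open>The factor for \<open>v\<close> is taken with the earlier vertices at spin 0 and the
  later ones free, so that the product telescopes.\<close>

fun vloop :: "nat \<Rightarrow> nat \<Rightarrow> nat \<Rightarrow> nat \<Rightarrow> nat \<times> nat \<Rightarrow> data list \<Rightarrow> (data \<times> data) list \<Rightarrow> nat \<times> nat" where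
  "vloop p q a N bs [] es = bs"
| "vloop p q a N bs (v # vs) es = (let s = tay N (go p q a N v [] es);
     r = vloop p q a N bs vs (rsub v pin0 es []) in (fst s * fst r, snd s * snd r))"

fun vloop_ok :: "nat \<Rightarrow> nat \<Rightarrow> nat \<Rightarrow> nat \<Rightarrow> data list \<Rightarrow> (data \<times> data) list \<Rightarrow> bool" where
  "vloop_ok p q a N [] es \<longleftrightarrow> True"
| "vloop_ok p q a N (v # vs) es \<longleftrightarrow>
     tay_ok N (go p q a N v [] es) \<and> vloop_ok p q a N vs (rsub v pin0 es [])"

section \<open>Partition sums as analytic functions of z\<close>

lemma zs_has_fps:
  assumes "finite F" "c has_fps_expansion C"
  shows "(\<lambda>z. zs b (c z) (\<lambda>_. 1) es T F) has_fps_expansion zs (fps_const b) C (\<lambda>_. 1) es T F"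
proof -
  have ew: "(\<lambda>z. ew b (c z) S e) has_fps_expansion ew (fps_const b) C S e" for S and e :: "'a \<times> 'a"
    using assms(2) by (auto simp: ew_def)
  have "(\<lambda>z. prod_list (map (ew b (c z) S) es)) has_fps_expansion prod_list (map (ew (fps_const b) C S) es)" for S
    by (induction es) (auto intro!: fps_expansion_intros ew)
  then show ?thesis unfolding zs_def wt_def by (auto intro!: has_fps_expansion_sum simp: assms)
qed

lemma zs_holomorphic:
  assumes "c holomorphic_on A"
  shows "(\<lambda>z. zs b (c z) (\<lambda>_. 1) es T F) holomorphic_on A"
proof -
  have ew: "(\<lambda>z. ew b (c z) S e) holomorphic_on A" for S and e :: "'a \<times> 'a"
    using assms by (cases "fst e \<in> S"; cases "snd e \<in> S") (auto simp: ew_def)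
  have "(\<lambda>z. prod_list (map (ew b (c z) S) es)) holomorphic_on A" for S
    by (induction es) (auto intro!: holomorphic_intros ew)
  then show ?thesis unfolding zs_def wt_def by (auto intro!: holomorphic_intros)
qed

text \<open>The target parameter is - \<open>g\<close> / \<open>q\<close>, and \<open>M0\<close>
  puts it strictly inside the disc. Here \<open>g\<close> is a natural number that hides the
  function of the theorem, and the bound \<open>q\<close> of \<open>zero_free\<close> is called
  \<open>q'\<close>.\<close>

locale approx = zero_free \<beta> M q' \<kappa>1 \<kappa>2 \<rho> for \<beta> M q' \<kappa>1 \<kappa>2 \<rho> +
  fixes p q g :: nat
  assumes p: "p > 0" and q: "q > 0" and bpq: "\<beta> = real p / real q"
    and M0: "1 / \<beta> + real g / real q < M"
begin

definition a where "a = q\<^sup>2 + p * g"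

text \<open>The radius in z at which the path reaches the boundary of the disc of radius
  \<open>M\<close>.\<close>

definition R where "R = M / (1 / \<beta> + real g / real q)"

lemma beta_pos: "1 / \<beta> + real g / real q > 0" using beta by (simp add: add_pos_nonneg)

lemma R1: "R > 1" unfolding R_def using M0 beta_pos by simp

text \<open>The path from \<open>1 / \<beta>\<close>, where the model is trivial since \<open>\<beta>\<gamma> = 1\<close>, at \<open>z = 0\<close> to the target at \<open>z = - 1\<close>.\<close>

definition cz :: "complex \<Rightarrow> complex" where
  "cz z = of_nat q / of_nat p * (1 + of_nat a / of_nat q ^ 2 * z)"

lemma cz_eq: "cz z = of_real (1 / \<beta>) + of_real (1 / \<beta> + real g / real q) * z"
proof -
  have "cz z = of_nat q / of_nat p + of_nat q / of_nat p * (of_nat a / of_nat q ^ 2) * z"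
    by (simp add: cz_def algebra_simps)
  also have "of_nat q / of_nat p * (of_nat a / of_nat q ^ 2) = complex_of_real (real q / real p * (real a / real q ^ 2))" by simp
  also have "real q / real p * (real a / real q ^ 2) = 1 / \<beta> + real g / real q"
    using p q by (simp add: a_def bpq field_simps power2_eq_square)
  finally show ?thesis using p q by (simp add: bpq)
qed

lemma cz_dist: "cmod z \<le> R \<Longrightarrow> cmod (cz z - of_real (1 / \<beta>)) \<le> M"
proof -
  assume "cmod z \<le> R"
  then have "(1 / \<beta> + real g / real q) * cmod z \<le> (1 / \<beta> + real g / real q) * R"
    using beta_pos by (intro mult_left_mono) auto
  also have "\<dots> = M" using beta_pos by (simp add: R_def)
  finally show ?thesis using beta_pos by (simp add: cz_eq norm_mult del: of_real_add of_real_divide)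
qed

lemma cz_fps: "cz has_fps_expansion cfps p q a"
proof -
  have "(\<lambda>z. of_nat q / of_nat p * (1 + of_nat a / of_nat q ^ 2 * z)) has_fps_expansion cfps p q a"
    unfolding cfps_def by (intro fps_expansion_intros)
  then show ?thesis by (simp add: cz_def[abs_def])
qed

lemma cz_m1: "cz (- 1) = of_real (- (real g / real q))" by (simp add: cz_eq)

abbreviation zr :: "(data \<times> data) list \<Rightarrow> data set \<Rightarrow> data set \<Rightarrow> real" where
  "zr \<equiv> zs \<beta> (- (real g / real q)) (\<lambda>_. 1)"

text \<open>As a function of z the ratio is holomorphic and bounded by 1 for |z| \<le> R, since the
  denominator has no zeros and \<open>lev\<close> holds throughout, and \<open>r\<close> is its
  expansion at 0. At z = -1 the ratio is real and at least - \<kappa>1; the factor 1 plus the ratio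
  is therefore bounded away from 0, which later turns absolute errors into relative ones.\<close>

lemma ratio_approx:
  assumes "finite F" "v \<notin> F" "zf p q a es {v} F = r * zf p q a es {} F"
  shows "zr es {} F \<noteq> 0" "\<bar>1 + zr es {v} F / zr es {} F\<bar> \<ge> 1 - \<kappa>1" "1 + zr es {v} F / zr es {} F > 0"
    "cmod ((\<Sum>j\<le>N. (-1) ^ j * fps_nth r j) - of_real (zr es {v} F / zr es {} F)) \<le> (1 / R) ^ Suc N / (1 - 1 / R)"
proof -
  define f where "f z = zs (of_real \<beta>) (cz z) (\<lambda>_. 1) es {v} F / zs (of_real \<beta>) (cz z) (\<lambda>_. 1) es {} F" for z
  have lev: "zs (of_real \<beta>) (cz z) (\<lambda>_. 1) es {} F \<noteq> 0" "lev (dg es {v} F) (f z)" if "cmod z \<le> R" for z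
    using zs_lev[OF cz_dist[OF that] assms(1), of "{v}" "\<lambda>_. 1" es] assms(2) by (auto simp: f_def)
  have fz: "f z = zs (of_real \<beta>) (cz z) (\<lambda>_. 1) es {v} F / zs (of_real \<beta>) (cz z) (\<lambda>_. 1) es {} F" for z
    by (simp add: f_def)
  have m1: "f (-1) = of_real (zr es {v} F / zr es {} F)"
    unfolding f_def cz_m1 zs_of_real by simp
  have n1: "cmod (-1 :: complex) \<le> R" using R1 by simp
  show "zr es {} F \<noteq> 0" using lev(1)[OF n1] unfolding cz_m1 zs_of_real by simp
  define w where "w = zr es {v} F / zr es {} F"
  have w: "1 + w \<ge> 1 - \<kappa>1" 
  proof (cases "dg es {v} F = 0")
    case True
    then obtain k where "0 \<le> k" "complex_of_real w = of_real k" using lev(2)[OF n1] by (auto simp: lev_def m1 w_def)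
    then show ?thesis using k1_pos by (simp only: of_real_eq_iff)
  next
    case False
    then have "cmod (complex_of_real w) \<le> \<kappa>1" using lev_k1[OF lev(2)[OF n1]] by (simp add: m1 w_def del: of_real_divide)
    then show ?thesis by simp
  qed
  then show "1 + zr es {v} F / zr es {} F > 0" "\<bar>1 + zr es {v} F / zr es {} F\<bar> \<ge> 1 - \<kappa>1"
    using k1(2) by (auto simp: w_def)
  have hol: "f holomorphic_on cball 0 R"
  proof -
    have "cz holomorphic_on cball 0 R" unfolding cz_def by (auto intro!: holomorphic_intros)
    then show ?thesis unfolding f_def using lev(1) by (intro holomorphic_intros zs_holomorphic) auto
  qed
  have exp: "f has_fps_expansion r"
  proof -
    have B: "fps_const (of_real \<beta>) = bfps p q" by (simp add: bfps_def bpq)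
    have "(\<lambda>z. zs (of_real \<beta>) (cz z) (\<lambda>_. 1) es T F) has_fps_expansion zf p q a es T F" for T
      using zs_has_fps[OF assms(1) cz_fps, of "of_real \<beta>" es T] by (simp add: B zf_def)
    moreover obtain k where "k > 0" "fps_nth (zf p q a es {} F) 0 = complex_of_real k"
      using zf_0[OF p q assms(1)] by metis
    then have nz: "fps_nth (zf p q a es {} F) 0 \<noteq> 0" by simp
    ultimately have "f has_fps_expansion (zf p q a es {v} F / zf p q a es {} F)"
      unfolding f_def by (intro has_fps_expansion_divide')
    also have "zf p q a es {v} F / zf p q a es {} F = r"
      unfolding assms(3) using nz by (metis fps_zero_nth nonzero_mult_div_cancel_right)
    finally show ?thesis .
  qed
  have "cmod ((\<Sum>j\<le>N. (-1) ^ j * fps_nth r j) - f (- 1)) \<le> (1 / R) ^ Suc N / (1 - 1 / R)"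
  proof (rule taylor_error)
    show "f holomorphic_on ball 0 R" using hol by (rule holomorphic_on_subset) auto
    show "continuous_on (cball 0 R) f" using hol by (rule holomorphic_on_imp_continuous_on)
    show "cmod (f z) \<le> 1" if "cmod z = R" for z using lev_norm1[OF lev(2)[of z]] that by simp
  qed (use R1 exp in auto)
  then show "cmod ((\<Sum>j\<le>N. (-1) ^ j * fps_nth r j) - of_real (zr es {v} F / zr es {} F)) \<le> (1 / R) ^ Suc N / (1 - 1 / R)"
    unfolding m1 .
qed

text \<open>The relative error of one factor: the Taylor error divided by the lower bound 1 -
  \<kappa>1 of the factor.\<close>

definition err where "err N = (1 / R) ^ Suc N / (1 - 1 / R) / (1 - \<kappa>1)"

text \<open>The last hypothesis is the loop invariant: with \<open>pin1\<close> at spin 1,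
  \<open>cur\<close> has the same weight as \<open>es\<close> for every choice of spins at the
  vertices still to come, the treated ones being at spin 0. Relative errors of the factors compound
  to (1 + err N)^n - 1.\<close>

lemma vloop_approx:
  fixes es :: "(data \<times> data) list"
  assumes N: "err N \<le> 1"
  shows "distinct vs \<Longrightarrow> pin0 \<notin> set vs \<Longrightarrow> pin1 \<notin> set vs \<Longrightarrow> simple_on (set vs) cur \<Longrightarrow> snd bs > 0 \<Longrightarrow>
    real (fst bs) / real (snd bs) = zr es {} {} \<Longrightarrow>
    (\<And>S. S \<subseteq> set vs \<Longrightarrow> prod_list (map (ew (bfps p q) (cfps p q a) (insert pin1 S)) cur)
        = prod_list (map (ew (bfps p q) (cfps p q a) S) es)) \<Longrightarrow>
    vloop_ok p q a N vs cur \<and> snd (vloop p q a N bs vs cur) > 0 \<and>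
    \<bar>real (fst (vloop p q a N bs vs cur)) / real (snd (vloop p q a N bs vs cur)) - zr es {} (set vs)\<bar>
      \<le> ((1 + err N) ^ length vs - 1) * \<bar>zr es {} (set vs)\<bar>"
proof (induction vs arbitrary: cur)
  case (Cons v vs)
  define F where "F = set vs"
  have F: "finite F" "v \<notin> F" "set (v # vs) = insert v F" using Cons.prems by (auto simp: F_def)
  have pins: "v \<noteq> pin0" "v \<noteq> pin1" "pin0 \<notin> F" "pin1 \<notin> F" using Cons.prems by (auto simp: F_def)
  have sm: "simple_on (insert v F) cur" using Cons.prems(4) F by simp
  define XY where "XY = go p q a N v [] cur"
  have sn: "simple_on F []" by (simp add: simple_on_def)
  obtain r where r: "zf p q a (map (sb v pin1) cur) {pin1} F = r * zf p q a (map (sb v pin0) cur) {pin1} F"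
    "agree (Suc N) (fl (fst XY)) (fl (snd XY) * r)" "h0 (snd XY) > 0"
    using go_agree[OF p q F(1) _ pins(3,4) sn sm] F(2) pins by (auto simp: XY_def)
  have tr: "zf p q a cur (insert pin1 T) F = zf p q a es T F" if "T \<subseteq> {v}" for T
  proof -
    have "prod_list (map (ew (bfps p q) (cfps p q a) (insert pin1 T \<union> S)) cur)
        = prod_list (map (ew (bfps p q) (cfps p q a) (T \<union> S)) es)" if "S \<in> Pow F" for S
      using Cons.prems(7)[of "T \<union> S"] that \<open>T \<subseteq> {v}\<close> by (auto simp: F_def)
    then show ?thesis unfolding zf_def zs_def wt_def by (intro sum.cong refl arg_cong2[where f = times]) auto
  qed
  have "zf p q a (map (sb v pin1) cur) {pin1} F = zf p q a cur {v, pin1} F"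
    unfolding zf_def by (rule zs_subst1[symmetric]) simp
  moreover have "zf p q a (map (sb v pin0) cur) {pin1} F = zf p q a cur {pin1} F"
    unfolding zf_def using F pins by (intro zs_subst0[symmetric]) auto
  ultimately have zr: "zf p q a es {v} F = r * zf p q a es {} F"
    using r(1) tr[of "{}"] tr[of "{v}"] by (simp add: insert_commute)
  note ra = ratio_approx[OF F(1,2) zr]
  define w where "w = 1 + zr es {v} F / zr es {} F"
  obtain d s t where dst: "d > 0" "tay N XY = (d + s - t, d)" "tay_ok N XY \<longleftrightarrow> t \<le> d + s"
    "(of_nat s - of_nat t) / of_nat d = (\<Sum>j\<le>N. (-1) ^ j * fps_nth r j)"
    using tay_value[OF r(2,3)] by metis
  have k1': "1 - \<kappa>1 > 0" using k1 by simp
  have er: "(1 / R) ^ Suc N / (1 - 1 / R) = err N * (1 - \<kappa>1)" using k1' by (simp add: err_def)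
  have "cmod (of_real ((real s - real t) / real d) - of_real (w - 1)) \<le> err N * (1 - \<kappa>1)"
    using ra(4)[of N] er dst(4) by (simp add: w_def)
  then have "\<bar>(real s - real t) / real d - (w - 1)\<bar> \<le> err N * (1 - \<kappa>1)"
    unfolding of_real_diff[symmetric] norm_of_real .
  moreover have "(real s - real t) / real d - (w - 1) = 1 + (real s - real t) / real d - w" by simp
  ultimately have e1: "\<bar>1 + (real s - real t) / real d - w\<bar> \<le> err N * (1 - \<kappa>1)" by simp
  also have "\<dots> \<le> err N * w"
  proof (rule mult_left_mono)
    show "1 - \<kappa>1 \<le> w" using ra(2,3) by (simp add: w_def)
    show "0 \<le> err N" using k1' R1 by (simp add: err_def)
  qed
  finally have e2: "\<bar>1 + (real s - real t) / real d - w\<bar> \<le> err N * w" .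
  have wpos: "w > 0" using ra(3) by (simp add: w_def)
  \<comment> \<open>A relative error of at most 1 keeps the approximate factor nonnegative, and that
    is precisely the absence of truncation in \<open>tay\<close>.\<close>
  have "1 + (real s - real t) / real d \<ge> 0"
    using e2 N wpos by (smt (verit) mult_left_le_one_le mult_less_cancel_right1 mult_right_mono)
  then have tds: "t \<le> d + s" using dst(1) by (simp add: field_simps)
  then have val: "real (d + s - t) / real d = 1 + (real s - real t) / real d" using dst(1) by (simp add: field_simps of_nat_diff)
  define V where "V = vloop p q a N bs vs (rsub v pin0 cur [])"
  have IH: "vloop_ok p q a N vs (rsub v pin0 cur []) \<and> snd V > 0 \<and> \<bar>real (fst V) / real (snd V) - zr es {} F\<bar> \<le> ((1 + err N) ^ length vs - 1) * \<bar>zr es {} F\<bar>"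
    unfolding V_def F_def
  proof (rule Cons.IH)
    have m: "mset (rsub v pin0 cur []) = mset (map (sb v pin0) cur)" by (simp add: mset_rsub)
    show "simple_on (set vs) (rsub v pin0 cur [])"
      unfolding simple_on_mset[OF m] using sm unfolding F_def by (rule simple_on_sb) simp
    fix S assume S: "S \<subseteq> set vs"
    have "ew (bfps p q) (cfps p q a) (insert pin1 S) (sb v pin0 e) = ew (bfps p q) (cfps p q a) (insert pin1 S) e" for e
      using S F(2) pins by (auto simp: ew_def sb_def F_def)
    then have "map (ew (bfps p q) (cfps p q a) (insert pin1 S)) (map (sb v pin0) cur) = map (ew (bfps p q) (cfps p q a) (insert pin1 S)) cur"
      by simp
    then have "prod_list (map (ew (bfps p q) (cfps p q a) (insert pin1 S)) (rsub v pin0 cur []))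
       = prod_list (map (ew (bfps p q) (cfps p q a) (insert pin1 S)) cur)"
      using m by (metis mset_map prod_mset_prod_list)
    also have "\<dots> = prod_list (map (ew (bfps p q) (cfps p q a) S) es)" using Cons.prems(7)[of S] S by auto
    finally show "prod_list (map (ew (bfps p q) (cfps p q a) (insert pin1 S)) (rsub v pin0 cur []))
       = prod_list (map (ew (bfps p q) (cfps p q a) S) es)" .
  qed (use Cons.prems in auto)
  have veq: "vloop p q a N bs (v # vs) cur = ((d + s - t) * fst V, d * snd V)"
    by (simp add: Let_def V_def dst(2) flip: XY_def)
  have zsp: "zr es {} (insert v F) = zr es {} F * w"
    using zs_split[of "insert v F" v \<beta> _ "\<lambda>_. 1" es "{}"] F ra(1) by (simp add: w_def field_simps)
  define x where "x = real (d + s - t) / real d"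
  define y where "y = real (fst V) / real (snd V)"
  define z where "z = zr es {} F"
  have xw: "\<bar>x - w\<bar> \<le> err N * w" using e2 val by (simp add: x_def)
  have yz: "\<bar>y - z\<bar> \<le> ((1 + err N) ^ length vs - 1) * \<bar>z\<bar>" using IH by (simp add: y_def z_def)
  have x0: "0 \<le> x" by (simp add: x_def)
  have xle: "x \<le> (1 + err N) * w" using xw by (simp add: algebra_simps abs_le_iff)
  have "\<bar>x * y - z * w\<bar> = \<bar>x * (y - z) + (x - w) * z\<bar>" by (simp add: algebra_simps)
  also have "\<dots> \<le> x * \<bar>y - z\<bar> + \<bar>x - w\<bar> * \<bar>z\<bar>" using abs_triangle_ineq[of "x * (y - z)" "(x - w) * z"] x0 by (simp add: abs_mult)
  also have "\<dots> \<le> (1 + err N) * w * (((1 + err N) ^ length vs - 1) * \<bar>z\<bar>) + err N * w * \<bar>z\<bar>"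
    using xle yz xw x0 by (intro add_mono mult_mono mult_right_mono) auto
  also have "\<dots> = ((1 + err N) ^ length (v # vs) - 1) * \<bar>z * w\<bar>" using wpos by (simp add: abs_mult algebra_simps)
  finally have "\<bar>x * y - z * w\<bar> \<le> ((1 + err N) ^ length (v # vs) - 1) * \<bar>z * w\<bar>" .
  moreover have "real (fst (vloop p q a N bs (v # vs) cur)) / real (snd (vloop p q a N bs (v # vs) cur)) = x * y"
    by (simp add: veq x_def y_def del: vloop.simps)
  moreover have "vloop_ok p q a N (v # vs) cur" using IH dst(3) tds by (simp add: XY_def)
  moreover have "snd (vloop p q a N bs (v # vs) cur) > 0" using IH dst(1) by (simp add: veq del: vloop.simps)
  ultimately show ?case using zsp F(3) by (simp only: z_def)
qed auto

lemma deloop_ew: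
  assumes "\<forall>e \<in> set es. fst e \<notin> {pin0, pin1} \<and> snd e \<notin> {pin0, pin1}" "pin0 \<notin> S"
  shows "prod_list (map (ew b c (insert pin1 S)) (deloop es)) = prod_list (map (ew b c S) es)"
  using assms by (induction es) (auto simp: ew_def)

lemma deloop_simple:
  assumes "\<forall>e \<in> set es. fst e \<in> V \<and> snd e \<in> V" "pin0 \<notin> V" "pin1 \<notin> V"
  shows "simple_on V (deloop es)"
  using assms by (induction es) (auto simp: simple_on_def)

theorem vloop_correct:
  assumes vs: "distinct vs" "pin0 \<notin> set vs" "pin1 \<notin> set vs" and es: "\<forall>e \<in> set es. fst e \<in> set vs \<and> snd e \<in> set vs"
    and e: "err N * real (length vs) * 2 \<le> min \<epsilon> 1" "err N \<le> 1"
  defines "V \<equiv> vloop p q a N (ebase p q es) vs (deloop es)"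
  shows "vloop_ok p q a N vs (deloop es) \<and> snd V > 0 \<and>
    \<bar>real (fst V) / real (snd V) - zr es {} (set vs)\<bar> \<le> \<epsilon> * \<bar>zr es {} (set vs)\<bar>"
proof -
  have e0: "err N \<ge> 0" using k1(2) R1 by (simp add: err_def)
  have "vloop_ok p q a N vs (deloop es) \<and> snd V > 0 \<and>
    \<bar>real (fst V) / real (snd V) - zr es {} (set vs)\<bar> \<le> ((1 + err N) ^ length vs - 1) * \<bar>zr es {} (set vs)\<bar>"
    unfolding V_def
  proof (rule vloop_approx[OF e(2) vs])
    show "simple_on (set vs) (deloop es)" using es vs by (intro deloop_simple)
    show "snd (ebase p q es) > 0" using q by (simp add: ebase)
    have "prod_list (map (ew \<beta> c {}) es) = \<beta> ^ length es" for c by (induction es) (auto simp: ew_def)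
    then show "real (fst (ebase p q es)) / real (snd (ebase p q es)) = zr es {} {}"
      by (simp add: ebase zs_empty wt_def bpq power_divide)
    show "prod_list (map (ew (bfps p q) (cfps p q a) (insert pin1 S)) (deloop es)) = prod_list (map (ew (bfps p q) (cfps p q a) S) es)"
      if "S \<subseteq> set vs" for S using es vs that by (intro deloop_ew) auto
  qed
  \<comment> \<open>With t = n err N \<le> 1 the left-hand side is at most e^t - 1 \<le> t + t^2
    \<le> 2 t.\<close>
  moreover have "(1 + err N) ^ length vs - 1 \<le> \<epsilon>"
  proof -
    have x: "0 \<le> real (length vs) * err N" "real (length vs) * err N \<le> 1" using e e0 by (auto simp: mult_ac)
    have "(1 + err N) ^ length vs \<le> exp (err N) ^ length vs" using e0 by (intro power_mono) auto
    also have "\<dots> = exp (real (length vs) * err N)" by (simp flip: exp_of_nat_mult)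
    also have "\<dots> \<le> 1 + real (length vs) * err N + (real (length vs) * err N)\<^sup>2" using x by (rule exp_bound)
    also have "(real (length vs) * err N)\<^sup>2 \<le> real (length vs) * err N" using x by (simp add: power2_eq_square mult_left_le)
    finally show ?thesis using e(1) by (simp add: mult_ac)
  qed
  ultimately show ?thesis by (meson abs_ge_zero mult_right_mono order_trans)
qed

end

section \<open>The program\<close>

lemma option_pair_eqI: "(\<And>v t. x = Some (v, t) \<longleftrightarrow> y = Some (v, t)) \<Longrightarrow> x = y"
  by (cases x; cases y) auto

text \<open>Evaluation as a partial function, so that programs can be run by rewriting.\<close>

definition evr :: "program \<Rightarrow> data list \<Rightarrow> expr \<Rightarrow> (data \<times> nat) option" where
  "evr P env e = (if \<exists>v t. eval P env e v t then Some (THE vt. eval P env e (fst vt) (snd vt)) else None)"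

lemma evr_Some: "evr P env e = Some (v, t) \<longleftrightarrow> eval P env e v t"
proof -
  have "(THE vt. eval P env e (fst vt) (snd vt)) = (w, s)" if "eval P env e w s" for w s
    using that eval_deterministic by (intro the_equality) fastforce+
  then show ?thesis unfolding evr_def by (auto dest: eval_deterministic)
qed

text \<open>Bind for options of pairs, curried so that a program runs by simplification.\<close>

fun seq :: "(data \<times> nat) option \<Rightarrow> (data \<Rightarrow> nat \<Rightarrow> (data \<times> nat) option) \<Rightarrow> (data \<times> nat) option" where
  "seq None f = None"
| "seq (Some (v, t)) f = f v t"

lemma seq_Some: "seq x f = Some y \<longleftrightarrow> (\<exists>v t. x = Some (v, t) \<and> f v t = Some y)"
  by (cases x) auto

lemma evr_Var [simp]: "evr P env (EVar i) = (if i < length env then Some (env ! i, 1) else None)"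
  by (rule option_pair_eqI) (auto simp: evr_Some elim: eval_elims intro: eval.intros[simplified])

lemma evr_Atom [simp]: "evr P env EAtom = Some (Atom, 1)"
  by (rule option_pair_eqI) (auto simp: evr_Some elim: eval_elims intro: eval.intros[simplified])

lemma evr_Pair [simp]: "evr P env (EPair e1 e2) =
    seq (evr P env e1) (\<lambda>v1 t1. seq (evr P env e2) (\<lambda>v2 t2. Some (Node v1 v2, t1 + t2 + 1)))"
  by (rule option_pair_eqI) (auto simp: evr_Some seq_Some elim!: eval_elims intro: eval.intros[simplified])

lemma evr_Fst [simp]: "evr P env (EFst e) = seq (evr P env e) (\<lambda>v t. Some (dfst v, t + 1))"
  by (rule option_pair_eqI) (auto simp: evr_Some seq_Some elim!: eval_elims intro: eval.intros[simplified])

lemma evr_Snd [simp]: "evr P env (ESnd e) = seq (evr P env e) (\<lambda>v t. Some (dsnd v, t + 1))"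
  by (rule option_pair_eqI) (auto simp: evr_Some seq_Some elim!: eval_elims intro: eval.intros[simplified])

lemma eval_If: "eval P env (EIf c e1 e2) w u \<longleftrightarrow>
    (\<exists>v t s. eval P env c v t \<and> eval P env (if v = Atom then e2 else e1) w s \<and> u = t + s + 1)"
proof
  assume "eval P env (EIf c e1 e2) w u"
  then show "\<exists>v t s. eval P env c v t \<and> eval P env (if v = Atom then e2 else e1) w s \<and> u = t + s + 1"
  proof cases
    case (eval_If_true v t s)
    then show ?thesis by (intro exI[of _ v] exI[of _ t] exI[of _ s]) simp
  next
    case (eval_If_false t s)
    then show ?thesis by (intro exI[of _ Atom] exI[of _ t] exI[of _ s]) simp
  qed
next
  assume "\<exists>v t s. eval P env c v t \<and> eval P env (if v = Atom then e2 else e1) w s \<and> u = t + s + 1"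
  then obtain v t s where "eval P env c v t" "eval P env (if v = Atom then e2 else e1) w s" "u = t + s + 1" by blast
  then show "eval P env (EIf c e1 e2) w u"
    using eval_If_true[of P env c v t e1 w s e2] eval_If_false[of P env c t e2 w s e1] by (cases "v = Atom") auto
qed

lemma evr_If [simp]: "evr P env (EIf c e1 e2) = seq (evr P env c) (\<lambda>v t.
    seq (evr P env (if v = Atom then e2 else e1)) (\<lambda>w s. Some (w, t + s + 1)))"
  by (rule option_pair_eqI) (auto simp: evr_Some seq_Some eval_If simp del: if_split)

lemma evr_Let [simp]: "evr P env (ELet e1 e2) = seq (evr P env e1) (\<lambda>v t.
    seq (evr P (v # env) e2) (\<lambda>w s. Some (w, t + s + 1)))"
  by (rule option_pair_eqI) (auto simp: evr_Some seq_Some elim!: eval_elims intro: eval.intros[simplified])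

lemma evr_Call: "evr P env (ECall f e) = (if f < length P then seq (evr P env e) (\<lambda>v t.
    seq (evr P [v] (P ! f)) (\<lambda>w s. Some (w, t + s + 1))) else None)"
  by (rule option_pair_eqI) (auto simp: evr_Some seq_Some elim!: eval_elims intro: eval.intros[simplified])

fun cst :: "data \<Rightarrow> expr" where
  "cst Atom = EAtom"
| "cst (Node a b) = EPair (cst a) (cst b)"

lemma evr_cst [simp]: "evr P env (cst d) = Some (d, 2 * size d + 1)"
  by (induction d) auto

fun nest :: "nat \<Rightarrow> expr \<Rightarrow> expr" where
  "nest 0 e = e"
| "nest (Suc n) e = EPair EAtom (nest n e)"

lemma evr_nest: "evr P env e = Some (v, t) \<Longrightarrow> evr P env (nest n e) = Some ((Node Atom ^^ n) v, t + 2 * n)"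
  by (induction n) auto

text \<open>Arguments are nested pairs.  A fuel argument is an arbitrary tree, whose right spine is a
  unary number.\<close>

definition b_main :: "expr" where
  "b_main =
    ELet (EFst (EVar 0)) (ELet (ESnd (EVar 1)) (ELet (ECall 19 (ECall 18 (EPair (ESnd (EFst (EVar
    0))) (EPair (ESnd (EVar 0)) (ECall 17 (EFst (EVar 1))))))) (ELet (ECall 16 (EPair (EVar 0)
    (EPair (ECall 15 (ESnd (EVar 2))) (EPair (EFst (EVar 2)) (ECall 14 (ESnd (EVar 2))))))) (EPair
    (EPair EAtom (EFst (EVar 0))) (ESnd (EVar 0))))))"

definition b_eq :: "expr" where
  "b_eq =
    EIf (EFst (EVar 0)) (EIf (ESnd (EVar 0)) (EIf (ECall 1 (EPair (EFst (EFst (EVar 0))) (EFst (ESnd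
    (EVar 0))))) (ECall 1 (EPair (ESnd (EFst (EVar 0))) (ESnd (ESnd (EVar 0))))) EAtom) EAtom)
    (EIf (ESnd (EVar 0)) EAtom (EPair EAtom EAtom))"

definition b_add :: "expr" where
  "b_add =
    ELet (EFst (EVar 0)) (ELet (EFst (ESnd (EVar 1))) (ELet (ESnd (ESnd (EVar 2))) (EIf (EIf (EVar
    1) (EPair EAtom EAtom) (EVar 0)) (ELet (EIf (EVar 2) (EIf (EFst (EVar 1)) (EIf (EFst (EVar
    0)) (EPair (EPair EAtom EAtom) (EPair EAtom EAtom)) (EPair EAtom (EPair EAtom
    EAtom))) (EIf (EFst (EVar 0)) (EPair EAtom (EPair EAtom EAtom)) (EPair (EPair EAtom
    EAtom) EAtom))) (EIf (EFst (EVar 1)) (EIf (EFst (EVar 0)) (EPair EAtom (EPair EAtom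
    EAtom)) (EPair (EPair EAtom EAtom) EAtom)) (EIf (EFst (EVar 0)) (EPair (EPair EAtom
    EAtom) EAtom) (EPair EAtom EAtom)))) (EPair (EFst (EVar 0)) (ECall 2 (EPair (ESnd (EVar
    0)) (EPair (ESnd (EVar 2)) (ESnd (EVar 1))))))) (EIf (EVar 2) (EPair (EPair EAtom EAtom)
    EAtom) EAtom))))"

definition b_mul :: "expr" where
  "b_mul =
    ELet (EFst (EVar 0)) (ELet (ESnd (EVar 1)) (EIf (EVar 1) (ELet (ECall 3 (EPair (ESnd (EVar 1))
    (EVar 0))) (ELet (EIf (EVar 0) (EPair EAtom (EVar 0)) EAtom) (EIf (EFst (EVar 3)) (ECall 2
    (EPair EAtom (EPair (EVar 2) (EVar 0)))) (EVar 0)))) EAtom))"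

definition b_sub :: "expr" where
  "b_sub =
    ELet (EFst (EVar 0)) (ELet (EFst (ESnd (EVar 1))) (ELet (ESnd (ESnd (EVar 2))) (EIf (EVar 1)
    (ELet (EIf (EVar 2) (EIf (EFst (EVar 1)) (EIf (EFst (EVar 0)) (EPair (EPair EAtom EAtom)
    (EPair EAtom EAtom)) (EPair EAtom EAtom)) (EIf (EFst (EVar 0)) (EPair EAtom (EPair
    EAtom EAtom)) (EPair (EPair EAtom EAtom) (EPair EAtom EAtom)))) (EIf (EFst (EVar 1))
    (EIf (EFst (EVar 0)) (EPair EAtom EAtom) (EPair (EPair EAtom EAtom) EAtom)) (EIf (EFst
    (EVar 0)) (EPair (EPair EAtom EAtom) (EPair EAtom EAtom)) (EPair EAtom EAtom))))
    (ELet (ECall 4 (EPair (ESnd (EVar 0)) (EPair (ESnd (EVar 2)) (ESnd (EVar 1))))) (EIf (EFst (EVar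
    1)) (EPair (EPair EAtom EAtom) (EVar 0)) (EIf (EVar 0) (EPair EAtom (EVar 0)) EAtom))))
    EAtom)))"

definition b_padd :: "expr" where
  "b_padd =
    ELet (EFst (EVar 0)) (ELet (ESnd (EVar 1)) (EIf (EVar 1) (EIf (EVar 0) (EPair (ECall 2 (EPair
    EAtom (EPair (EFst (EVar 1)) (EFst (EVar 0))))) (ECall 5 (EPair (ESnd (EVar 1)) (ESnd (EVar
    0))))) (EVar 1)) (EVar 0)))"

definition b_pscale :: "expr" where
  "b_pscale =
    ELet (EFst (EVar 0)) (ELet (ESnd (EVar 1)) (EIf (EVar 0) (EPair (ECall 3 (EPair (EVar 1) (EFst
    (EVar 0)))) (ECall 6 (EPair (EVar 1) (ESnd (EVar 0))))) EAtom))"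

definition b_pmul :: "expr" where
  "b_pmul =
    ELet (EFst (EVar 0)) (ELet (ESnd (EVar 1)) (EIf (EVar 1) (ECall 5 (EPair (ECall 6 (EPair (EFst
    (EVar 1)) (EVar 0))) (EPair EAtom (ECall 7 (EPair (ESnd (EVar 1)) (EVar 0)))))) EAtom))"

definition b_rsub :: "expr" where
  "b_rsub =
    ELet (EFst (EVar 0)) (ELet (EFst (ESnd (EVar 1))) (ELet (ESnd (ESnd (EVar 2))) (EIf (EVar 1)
    (ELet (EFst (EVar 1)) (ECall 8 (EPair (EVar 3) (EPair (ESnd (EVar 2)) (EPair (EPair (EIf (ECall
    1 (EPair (EFst (EVar 0)) (EFst (EVar 3)))) (ESnd (EVar 3)) (EFst (EVar 0))) (EIf (ECall 1 (EPair
    (ESnd (EVar 0)) (EFst (EVar 3)))) (ESnd (EVar 3)) (ESnd (EVar 0)))) (EVar 1)))))) (EVar 0))))"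

definition b_pfac :: "nat \<Rightarrow> nat \<Rightarrow> nat \<Rightarrow> expr" where
  "b_pfac p q a =
    ELet (EFst (EVar 0)) (ELet (ESnd (EVar 1)) (ELet (ECall 5 (EPair (ECall 6 (EPair ((cst (enc_nat
    p))) (EVar 0))) (ECall 6 (EPair ((cst (enc_nat q))) (EVar 1))))) (EPair (ECall 5 (EPair (ECall 6
    (EPair ((cst (enc_nat q))) (EVar 0))) (EPair EAtom (ECall 6 (EPair ((cst (enc_nat a))) (EVar
    2)))))) (ECall 6 (EPair ((cst (enc_nat p))) (EVar 0))))))"

definition b_go :: "expr" where
  "b_go =
    ELet (EFst (EVar 0)) (ELet (EFst (ESnd (EVar 1))) (ELet (EFst (ESnd (ESnd (EVar 2)))) (ELet
    (ESnd (ESnd (ESnd (EVar 3)))) (EIf (EVar 0) (ELet (EFst (EVar 0)) (ELet (ESnd (EVar 1)) (ELet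
    (EIf (ECall 1 (EPair (EFst (EVar 1)) (EVar 4))) (EPair EAtom (ESnd (EVar 1))) (EIf (ECall 1
    (EPair (ESnd (EVar 1)) (EVar 4))) (EPair EAtom (EFst (EVar 1))) EAtom)) (EIf (EVar 0) (ELet
    (ESnd (EVar 0)) (ELet (ECall 9 (EIf (ECall 1 (EPair (EVar 0) ((cst pin0)))) (EPair EAtom
    (EPair (EPair (EPair EAtom EAtom) EAtom) EAtom)) (EIf (ECall 1 (EPair (EVar 0) ((cst
    pin1)))) (EPair (EPair (EPair (EPair EAtom EAtom) EAtom) EAtom) EAtom) (EIf (EVar 7)
    (ECall 10 (EPair (ESnd (EVar 7)) (EPair (EVar 0) (EPair EAtom (ECall 8 (EPair (EPair (EVar 6)
    ((cst pin0))) (EPair (EVar 2) (EVar 5)))))))) (EPair EAtom (EPair (EPair (EPair EAtom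
    EAtom) EAtom) EAtom)))))) (ELet (ECall 10 (EPair (EVar 8) (EPair (EVar 7) (EPair (EPair
    (EPair ((cst pin1)) (EVar 1)) (EVar 6)) (EVar 3))))) (EPair (ECall 7 (EPair (EFst (EVar 1))
    (EFst (EVar 0)))) (ECall 7 (EPair (ESnd (EVar 1)) (ESnd (EVar 0)))))))) (ECall 10 (EPair (EVar
    6) (EPair (EVar 5) (EPair (EPair (EVar 2) (EVar 4)) (EVar 1))))))))) (EPair (EPair (EPair (EPair
    EAtom EAtom) EAtom) EAtom) (EPair (EPair (EPair EAtom EAtom) EAtom) EAtom))))))"

definition b_hor :: "expr" where
  "b_hor =
    ELet (EFst (EVar 0)) (ELet (EFst (ESnd (EVar 1))) (ELet (ESnd (ESnd (EVar 2))) (EIf (EVar 2)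
    (ELet (ECall 11 (EPair (ESnd (EVar 2)) (EPair (EVar 1) (EVar 0)))) (ELet (ECall 3 (EPair (EVar
    2) (ESnd (ESnd (EVar 0))))) (EPair (ECall 5 (EPair (EPair (EVar 0) EAtom) (ECall 7 (EPair
    (EVar 2) (EFst (ESnd (EVar 1))))))) (EPair (ECall 7 (EPair (EVar 2) (EFst (EVar 1)))) (EVar
    0))))) (EPair (EPair (EPair (EPair EAtom EAtom) EAtom) EAtom) (EPair EAtom (EPair
    (EPair EAtom EAtom) EAtom))))))"

definition b_alt :: "expr" where
  "b_alt =
    ELet (EFst (EVar 0)) (ELet (EFst (ESnd (EVar 1))) (ELet (ESnd (ESnd (EVar 2))) (EIf (EVar 2)
    (ELet (ECall 12 (EPair (ESnd (EVar 2)) (EPair (ESnd (EVar 1)) (ESnd (EVar 0))))) (EPair (ECall 2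
    (EPair EAtom (EPair (EFst (EVar 2)) (ESnd (EVar 0))))) (ECall 2 (EPair EAtom (EPair (EFst
    (EVar 1)) (EFst (EVar 0))))))) (EPair EAtom EAtom))))"

definition b_tay :: "expr" where
  "b_tay =
    ELet (EFst (EVar 0)) (ELet (EFst (ESnd (EVar 1))) (ELet (ESnd (ESnd (EVar 2))) (ELet (ECall 11
    (EPair (EVar 2) (EPair (EFst (EVar 0)) (EPair EAtom (ESnd (EVar 0)))))) (ELet (ECall 12 (EPair
    (EPair EAtom (EVar 3)) (EPair (ECall 7 (EPair (EVar 2) (EFst (EVar 0)))) (ECall 7 (EPair (EVar
    2) (EFst (ESnd (EVar 0)))))))) (ELet (ECall 3 (EPair (EFst (EVar 2)) (ESnd (ESnd (EVar 1)))))
    (EPair (ECall 4 (EPair EAtom (EPair (ECall 2 (EPair EAtom (EPair (EVar 0) (EFst (EVar 1)))))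
    (ESnd (EVar 1))))) (EVar 0)))))))"

definition b_deloop :: "expr" where
  "b_deloop =
    EIf (EVar 0) (ELet (EFst (EVar 0)) (ELet (ECall 14 (ESnd (EVar 1))) (EIf (ECall 1 (EPair (EFst
    (EVar 1)) (ESnd (EVar 1)))) (EPair (EPair (EFst (EVar 1)) ((cst pin0))) (EPair (EPair (EFst
    (EVar 1)) ((cst pin1))) (EVar 0))) (EPair (EVar 1) (EVar 0))))) EAtom"

definition b_ebase :: "nat \<Rightarrow> nat \<Rightarrow> expr" where
  "b_ebase p q =
    EIf (EVar 0) (ELet (ECall 15 (ESnd (EVar 0))) (EPair (ECall 3 (EPair ((cst (enc_nat p))) (EFst
    (EVar 0)))) (ECall 3 (EPair ((cst (enc_nat q))) (ESnd (EVar 0)))))) (EPair (EPair (EPair EAtom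
    EAtom) EAtom) (EPair (EPair EAtom EAtom) EAtom))"

definition b_vloop :: "expr" where
  "b_vloop =
    ELet (EFst (EVar 0)) (ELet (EFst (ESnd (EVar 1))) (ELet (EFst (ESnd (ESnd (EVar 2)))) (ELet
    (ESnd (ESnd (ESnd (EVar 3)))) (EIf (EVar 1) (ELet (EFst (EVar 1)) (ELet (ECall 13 (EPair (EVar
    4) (ECall 10 (EPair (EVar 4) (EPair (EVar 0) (EPair EAtom (EVar 1))))))) (ELet (ECall 16
    (EPair (EVar 5) (EPair (EVar 4) (EPair (ESnd (EVar 3)) (ECall 8 (EPair (EPair (EVar 1) ((cst
    pin0))) (EPair (EVar 2) EAtom))))))) (EPair (ECall 3 (EPair (EFst (EVar 1)) (EFst (EVar 0))))
    (ECall 3 (EPair (ESnd (EVar 1)) (ESnd (EVar 0)))))))) (EVar 2)))))"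

definition b_cnt :: "expr" where
  "b_cnt =
    EIf (EVar 0) (ECall 2 (EPair (EPair EAtom EAtom) (EPair EAtom (ECall 17 (ESnd (EVar
    0)))))) EAtom"

text \<open>Computes the fuel: bit lengths are right spines, so a logarithm of a quotient is
  obtained by cancelling nodes of two binary numbers, without any division. The result is again
  significant only through its spine.\<close>

definition b_ldiff :: "expr" where
  "b_ldiff =
    ELet (EFst (EVar 0)) (ELet (EFst (ESnd (EVar 1))) (ELet (ESnd (ESnd (EVar 2))) (EIf (EVar 1)
    (EIf (EVar 2) (ECall 18 (EPair (ESnd (EVar 2)) (EPair (ESnd (EVar 1)) (EVar 0)))) (EPair EAtom
    (ECall 18 (EPair EAtom (EPair (ESnd (EVar 1)) (EVar 0)))))) (EPair EAtom (EVar 0)))))"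

text \<open>Multiplies a unary number by the constant \<open>K\<close>.\<close>

definition b_stretch :: "nat \<Rightarrow> expr" where
  "b_stretch K =
    EIf (EVar 0) (nest K (ECall 19 (ESnd (EVar 0)))) EAtom"

text \<open>Calls refer to positions in this list. \<open>p\<close>, \<open>q\<close>,
  \<open>a\<close> and \<open>K\<close> are compiled into the bodies; no degree bound is passed, so
  the same program serves both claims of the theorem.\<close>

definition prog :: "nat \<Rightarrow> nat \<Rightarrow> nat \<Rightarrow> nat \<Rightarrow> program" where
  "prog p q a K = [b_main, b_eq, b_add, b_mul, b_sub, b_padd, b_pscale, b_pmul, b_rsub, b_pfac p q a, b_go, b_hor, b_alt, b_tay, b_deloop, b_ebase p q, b_vloop, b_cnt, b_ldiff, b_stretch K]"

section \<open>Binary numbers, their lengths and the cost of arithmetic\<close>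

lemma enc_nat_0 [simp]: "enc_nat 0 = Atom"
  by (subst enc_nat.simps) simp

lemma enc_nat_pos: "n > 0 \<Longrightarrow> enc_nat n = Node (enc_bit (odd n)) (enc_nat (n div 2))"
  by (subst enc_nat.simps) simp

lemma enc_nat_1 [simp]: "enc_nat (Suc 0) = Node (Node Atom Atom) Atom"
  by (subst enc_nat.simps) (simp add: enc_bit_def)

lemma dfst_enc_nat [simp]: "dfst (enc_nat n) = enc_bit (odd n)"
  by (subst enc_nat.simps) (simp add: enc_bit_def)

lemma dsnd_enc_nat [simp]: "dsnd (enc_nat n) = enc_nat (n div 2)"
  by (cases "n = 0") (auto simp: enc_nat_pos)

lemma enc_nat_Atom [simp]: "enc_nat n = Atom \<longleftrightarrow> n = 0"
  by (subst enc_nat.simps) simp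

lemma enc_bit_simps [simp]: "enc_bit True = Node Atom Atom" "enc_bit False = Atom" "enc_bit b = Atom \<longleftrightarrow> \<not> b"
  by (auto simp: enc_bit_def)

fun bl :: "nat \<Rightarrow> nat" where
  "bl n = (if n = 0 then 0 else Suc (bl (n div 2)))"

declare bl.simps [simp del]

lemma bl_0 [simp]: "bl 0 = 0" by (subst bl.simps) simp

lemma bl_pos: "n > 0 \<Longrightarrow> bl n = Suc (bl (n div 2))" by (subst bl.simps) simp

lemma bl_le: "bl n \<le> k \<longleftrightarrow> n < 2 ^ k"
proof (induction n arbitrary: k rule: less_induct)
  case (less n)
  show ?case
  proof (cases "n = 0")
    case False
    show ?thesis
    proof (cases k)
      case (Suc j)
      have "bl n \<le> k \<longleftrightarrow> n div 2 < 2 ^ j" using False Suc less[of "n div 2" j] by (simp add: bl_pos)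
      also have "\<dots> \<longleftrightarrow> n < 2 ^ k" unfolding Suc by auto
      finally show ?thesis .
    qed (use False in \<open>simp add: bl_pos\<close>)
  qed simp
qed

fun spine :: "data \<Rightarrow> nat" where
  "spine Atom = 0"
| "spine (Node a b) = Suc (spine b)"

lemma spine_enc_nat [simp]: "spine (enc_nat n) = bl n"
  by (induction n rule: bl.induct) (subst enc_nat.simps, subst bl.simps, simp)

locale lisp =
  fixes p q a K :: nat
begin

definition fn :: "nat \<Rightarrow> data \<Rightarrow> (data \<times> nat) option" where
  "fn k x = evr (prog p q a K) [x] (prog p q a K ! k)"

lemma call [simp]: "k < 20 \<Longrightarrow> evr (prog p q a K) env (ECall k e)
    = seq (evr (prog p q a K) env e) (\<lambda>v t. seq (fn k v) (\<lambda>w s. Some (w, t + s + 1)))"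
  by (simp add: evr_Call fn_def prog_def)

lemma fn_unfold:
  "fn 0 x = evr (prog p q a K) [x] b_main"
  "fn 1 x = evr (prog p q a K) [x] b_eq"
  "fn (Suc 0) x = evr (prog p q a K) [x] b_eq"
  "fn 2 x = evr (prog p q a K) [x] b_add"
  "fn 3 x = evr (prog p q a K) [x] b_mul"
  "fn 4 x = evr (prog p q a K) [x] b_sub"
  "fn 5 x = evr (prog p q a K) [x] b_padd"
  "fn 6 x = evr (prog p q a K) [x] b_pscale"
  "fn 7 x = evr (prog p q a K) [x] b_pmul"
  "fn 8 x = evr (prog p q a K) [x] b_rsub"
  "fn 9 x = evr (prog p q a K) [x] (b_pfac p q a)"
  "fn 10 x = evr (prog p q a K) [x] b_go"
  "fn 11 x = evr (prog p q a K) [x] b_hor"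
  "fn 12 x = evr (prog p q a K) [x] b_alt"
  "fn 13 x = evr (prog p q a K) [x] b_tay"
  "fn 14 x = evr (prog p q a K) [x] b_deloop"
  "fn 15 x = evr (prog p q a K) [x] (b_ebase p q)"
  "fn 16 x = evr (prog p q a K) [x] b_vloop"
  "fn 17 x = evr (prog p q a K) [x] b_cnt"
  "fn 18 x = evr (prog p q a K) [x] b_ldiff"
  "fn 19 x = evr (prog p q a K) [x] (b_stretch K)"
  by (simp_all add: fn_def prog_def)

text \<open>An upper bound in place of the exact step count, so that costs can be composed by
  monotonicity.\<close>

definition returns :: "nat \<Rightarrow> data \<Rightarrow> data \<Rightarrow> nat \<Rightarrow> bool" where
  "returns k x y T \<longleftrightarrow> (\<exists>t \<le> T. fn k x = Some (y, t))"

lemma returnsE: "returns k x y T \<Longrightarrow> (\<And>t. t \<le> T \<Longrightarrow> fn k x = Some (y, t) \<Longrightarrow> thesis) \<Longrightarrow> thesis"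
  by (auto simp: returns_def)

lemma returns_mono: "returns k x y T \<Longrightarrow> T \<le> T' \<Longrightarrow> returns k x y T'"
  by (auto simp: returns_def intro: order_trans)

text \<open>Both trees are descended together, so the size of the first one alone bounds the
  cost.\<close>

lemma fn_eq: "returns (Suc 0) (Node d d') (enc_bit (d = d')) (30 * (2 * size d + 1))"
proof (induction d arbitrary: d')
  case Atom
  show ?case by (cases d') (simp_all add: returns_def fn_unfold b_eq_def)
next
  case (Node d1 d2)
  show ?case
  proof (cases d')
    case (Node d1' d2')
    obtain t1 where t1: "t1 \<le> 30 * (2 * size d1 + 1)" "fn (Suc 0) (Node d1 d1') = Some (enc_bit (d1 = d1'), t1)"
      using Node.IH(1) by (rule returnsE)
    obtain t2 where t2: "t2 \<le> 30 * (2 * size d2 + 1)" "fn (Suc 0) (Node d2 d2') = Some (enc_bit (d2 = d2'), t2)"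
      using Node.IH(2) by (rule returnsE)
    have "fn (Suc 0) (Node (Node d1 d2) (Node d1' d2')) = evr (prog p q a K) [Node (Node d1 d2) (Node d1' d2')] b_eq"
      by (rule fn_unfold)
    then show ?thesis using t1 t2 Node by (cases "d1 = d1'") (simp_all add: returns_def b_eq_def)
  qed (simp add: returns_def fn_unfold b_eq_def)
qed

lemma fn_add: "returns 2 (Node (enc_bit c) (Node (enc_nat m) (enc_nat n)))
    (enc_nat (m + n + of_bool c)) (60 * (bl m + bl n + 1))"
proof (induction "m + n" arbitrary: m n c rule: less_induct)
  case less
  have unf: "fn 2 (Node (enc_bit c) (Node (enc_nat m) (enc_nat n)))
    = evr (prog p q a K) [Node (enc_bit c) (Node (enc_nat m) (enc_nat n))] b_add" by (rule fn_unfold)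
  show ?case
  proof (cases "m = 0 \<and> n = 0")
    case True
    then show ?thesis by (cases c) (simp_all add: returns_def fn_unfold b_add_def)
  next
    case False
    define c' where "c' = ((odd m \<and> odd n) \<or> (c \<and> (odd m \<or> odd n)))"
    have lt: "m div 2 + n div 2 < m + n" using False by linarith
    obtain t where t: "t \<le> 60 * (bl (m div 2) + bl (n div 2) + 1)"
      "fn 2 (Node (enc_bit c') (Node (enc_nat (m div 2)) (enc_nat (n div 2))))
        = Some (enc_nat (m div 2 + n div 2 + of_bool c'), t)"
      using less[OF lt] by (rule returnsE)
    have e: "enc_nat (m + n + of_bool c) = Node (enc_bit (odd (m + n + of_bool c))) (enc_nat (m div 2 + n div 2 + of_bool c'))"
    proof -
      have "(m + n + of_bool c) div 2 = m div 2 + n div 2 + of_bool c'"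
        unfolding c'_def by (cases c; cases "odd m"; cases "odd n") (auto elim!: oddE evenE)
      then show ?thesis using False by (simp add: enc_nat_pos)
    qed
    have b: "bl (m div 2) + bl (n div 2) + 1 \<le> bl m + bl n"
      using False by (cases "m = 0"; cases "n = 0") (auto simp: bl_pos)
    have "\<exists>s \<le> t + 50. fn 2 (Node (enc_bit c) (Node (enc_nat m) (enc_nat n))) = Some (enc_nat (m + n + of_bool c), s)"
      unfolding unf e using t(2) False unfolding c'_def
      by (cases c; cases "odd m"; cases "odd n"; cases "m = 0"; cases "n = 0") (simp_all add: b_add_def)
    then show ?thesis using t(1) b by (auto simp: returns_def)
  qed
qed

lemma fn_add': "m < 2 ^ k \<Longrightarrow> n < 2 ^ k \<Longrightarrow> returns 2 (Node Atom (Node (enc_nat m) (enc_nat n))) (enc_nat (m + n)) (60 * (2 * k + 1))"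
  using fn_add[of False m n] by (auto elim!: returns_mono simp flip: bl_le)

definition Tmul :: "nat \<Rightarrow> nat" where "Tmul k = (k + 1) * (60 * (4 * k + 1) + 40)"

lemma fn_mul:
  assumes "n < 2 ^ k"
  shows "m < 2 ^ k \<Longrightarrow> returns 3 (Node (enc_nat m) (enc_nat n)) (enc_nat (m * n)) (Tmul k)"
proof -
  define c where "c = 60 * (4 * k + 1) + 40"
  have "m < 2 ^ k \<Longrightarrow> returns 3 (Node (enc_nat m) (enc_nat n)) (enc_nat (m * n)) (bl m * c + 20)"
  proof (induction m rule: less_induct)
    case (less m)
    have unf: "fn 3 (Node (enc_nat m) (enc_nat n))
      = evr (prog p q a K) [Node (enc_nat m) (enc_nat n)] b_mul" by (rule fn_unfold)
    show ?case
    proof (cases "m = 0")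
      case True
      then show ?thesis by (simp add: returns_def fn_unfold b_mul_def)
    next
      case False
      define r where "r = (m div 2) * n"
      have "m div 2 < 2 ^ k" using less(2) by (meson div_le_dividend le_less_trans)
      then obtain t where t: "t \<le> bl (m div 2) * c + 20" "fn 3 (Node (enc_nat (m div 2)) (enc_nat n)) = Some (enc_nat r, t)"
        using less(1)[of "m div 2"] less(2) False by (auto simp: r_def elim!: returnsE)
      have d: "(if r = 0 then Atom else Node Atom (enc_nat r)) = enc_nat (2 * r)"
        by (auto simp: enc_nat_pos[of "2 * r"])
      have "2 * r \<le> m * n" using mult_le_mono1[of "2 * (m div 2)" m n] by (simp add: r_def)
      also have "m * n < 2 ^ k * 2 ^ k" using assms less(2) by (intro mult_strict_mono) auto
      finally have "2 * r < 2 ^ (2 * k)" by (simp add: mult_2 power_add)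
      moreover have "n < 2 ^ (2 * k)" using assms by (rule less_le_trans) simp
      ultimately obtain s where s: "s \<le> 60 * (4 * k + 1)" "fn 2 (Node Atom (Node (enc_nat n) (enc_nat (2 * r)))) = Some (enc_nat (n + 2 * r), s)"
        using fn_add'[of n "2 * k" "2 * r"] by (auto elim!: returnsE)
      have "m = 2 * (m div 2) + of_bool (odd m)" using mult_div_mod_eq[of 2 m] by (simp only: mod_2_eq_odd)
      then have "m * n = (2 * (m div 2) + of_bool (odd m)) * n" by (rule arg_cong)
      then have mn: "m * n = 2 * r + of_bool (odd m) * n" by (simp only: r_def add_mult_distrib mult.assoc)
      have "\<exists>u \<le> t + s + 40. fn 3 (Node (enc_nat m) (enc_nat n)) = Some (enc_nat (m * n), u)"
        unfolding unf mn using t(2) s(2) False d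
        by (cases "odd m"; cases "r = 0") (simp_all add: b_mul_def add.commute)
      moreover have "t + s + 40 \<le> bl m * c + 20" using t(1) s(1) False by (simp add: bl_pos c_def algebra_simps)
      ultimately show ?thesis unfolding returns_def by (meson order_trans)
    qed
  qed
  moreover have "bl m * c + 20 \<le> Tmul k" if "m < 2 ^ k"
  proof -
    have "bl m * c \<le> k * c" using that by (intro mult_le_mono1) (simp add: bl_le)
    then show ?thesis by (simp add: Tmul_def c_def algebra_simps)
  qed
  ultimately show "m < 2 ^ k \<Longrightarrow> returns 3 (Node (enc_nat m) (enc_nat n)) (enc_nat (m * n)) (Tmul k)"
    using returns_mono by blast
qed

lemma fn_sub: "n + of_bool c \<le> m \<Longrightarrow> returns 4 (Node (enc_bit c) (Node (enc_nat m) (enc_nat n)))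
    (enc_nat (m - n - of_bool c)) (60 * (bl m + 1))"
proof (induction m arbitrary: n c rule: less_induct)
  case (less m)
  have unf: "fn 4 (Node (enc_bit c) (Node (enc_nat m) (enc_nat n)))
    = evr (prog p q a K) [Node (enc_bit c) (Node (enc_nat m) (enc_nat n))] b_sub" by (rule fn_unfold)
  show ?case
  proof (cases "m = 0")
    case True
    then show ?thesis using less.prems by (simp add: returns_def fn_unfold b_sub_def)
  next
    case False
    define c' where "c' = (of_bool (odd m) < of_bool (odd n) + of_bool c + (0::nat))"
    define d where "d = (odd m \<noteq> (odd n \<noteq> c))"
    have m2: "m = 2 * (m div 2) + of_bool (odd m)" "n = 2 * (n div 2) + of_bool (odd n)"
      using mult_div_mod_eq[of 2 m] mult_div_mod_eq[of 2 n] by (simp_all only: mod_2_eq_odd)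
    define m' n' where "m' = m div 2" and "n' = n div 2"
    define om on where "om = odd m" and "on = odd n"
    have m3: "m = 2 * m' + of_bool om" "n = 2 * n' + of_bool on"
      using m2 unfolding m'_def n'_def om_def on_def by blast+
    have le: "n' + of_bool c' \<le> m'"
      using less.prems m3 unfolding c'_def om_def[symmetric] on_def[symmetric]
      by (cases c; cases om; cases on) auto
    obtain t where t: "t \<le> 60 * (bl m' + 1)"
      "fn 4 (Node (enc_bit c') (Node (enc_nat m') (enc_nat n'))) = Some (enc_nat (m' - n' - of_bool c'), t)"
      using less(1)[of m' n' c'] le False by (auto simp: m'_def elim!: returnsE)
    define r where "r = m' - n' - of_bool c'"
    have mr: "m - n - of_bool c = 2 * r + of_bool d"
      using less.prems m3 le unfolding r_def c'_def d_def om_def[symmetric] on_def[symmetric]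
      by (cases c; cases om; cases on) auto
    \<comment> \<open>A zero digit in front of an empty remainder must not be stored: encodings have
      no leading zeros.\<close>
    have e: "enc_nat (2 * r + of_bool d) = (if d then Node (Node Atom Atom) (enc_nat r) else if r = 0 then Atom else Node Atom (enc_nat r))"
      by (auto simp: enc_nat_pos)
    have t2: "fn 4 (Node (enc_bit c') (Node (enc_nat (m div 2)) (enc_nat (n div 2)))) = Some (enc_nat r, t)"
      using t(2) by (simp add: m'_def n'_def r_def)
    have "\<exists>s \<le> t + 50. fn 4 (Node (enc_bit c) (Node (enc_nat m) (enc_nat n))) = Some (enc_nat (m - n - of_bool c), s)"
      unfolding unf mr e using t2 False unfolding c'_def d_def
      by (cases c; cases "odd m"; cases "odd n"; cases "r = 0") (simp_all add: b_sub_def)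
    moreover have "t + 50 \<le> 60 * (bl m + 1)" using t(1) False by (simp add: bl_pos m'_def)
    ultimately show ?thesis unfolding returns_def by (meson order_trans)
  qed
qed

end

section \<open>Running times\<close>

definition encp :: "nat list \<Rightarrow> data" where "encp xs = enc_list (map enc_nat xs)"
definition ence :: "(data \<times> data) list \<Rightarrow> data" where "ence es = enc_list (map (\<lambda>(x, y). Node x y) es)"

lemma encp_simps [simp]: "encp [] = Atom" "encp (x # xs) = Node (enc_nat x) (encp xs)"
  by (simp_all add: encp_def)

lemma ence_simps [simp]: "ence [] = Atom" "ence (e # es) = Node (Node (fst e) (snd e)) (ence es)"
  by (cases e; simp add: ence_def)+

lemma dfst_encp [simp]: "dfst (encp xs) = enc_nat (h0 xs)" by (cases xs) (auto simp: h0_def)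
lemma dsnd_encp [simp]: "dsnd (encp xs) = encp (tl xs)" by (cases xs) auto
lemma encp_Atom [simp]: "encp xs = Atom \<longleftrightarrow> xs = []" by (cases xs) auto

lemma size_enc_nat: "size (enc_nat n) \<le> 2 * bl n"
proof (induction n rule: less_induct)
  case (less n)
  show ?case
  proof (cases "n = 0")
    case False
    then have "size (enc_nat (n div 2)) \<le> 2 * bl (n div 2)" by (intro less) auto
    then show ?thesis using False by (simp add: enc_nat_pos bl_pos enc_bit_def)
  qed simp
qed

section \<open>Size measures for coefficient lists\<close>

definition lt :: "nat \<Rightarrow> nat list \<Rightarrow> bool" where "lt k xs \<longleftrightarrow> (\<forall>x \<in> set xs. x < 2 ^ k)"

text \<open>One number bounds both the length and the bit length, so that all costs become functions
  of a single variable.\<close>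

definition pb :: "nat \<Rightarrow> nat list \<Rightarrow> bool" where "pb k xs \<longleftrightarrow> length xs \<le> k \<and> lt k xs"

lemma lt_simps [simp]: "lt k []" "lt k (x # xs) \<longleftrightarrow> x < 2 ^ k \<and> lt k xs"
  by (auto simp: lt_def)

lemma lt_mono: "lt k xs \<Longrightarrow> k \<le> k' \<Longrightarrow> lt k' xs"
  unfolding lt_def by (meson less_le_trans power_increasing one_le_numeral)

lemma pb_mono: "pb k xs \<Longrightarrow> k \<le> k' \<Longrightarrow> pb k' xs"
  unfolding pb_def using lt_mono by fastforce

lemma h0_less: "lt k xs \<Longrightarrow> h0 xs < 2 ^ k"
  by (cases xs) (auto simp: h0_def)

lemma length_padd: "length (padd xs ys) = max (length xs) (length ys)"
  by (induction xs ys rule: padd.induct) auto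

lemma lt_padd: "lt k xs \<Longrightarrow> lt k ys \<Longrightarrow> lt (Suc k) (padd xs ys)"
  by (induction xs ys rule: padd.induct) (auto intro: lt_mono)

lemma length_pscale [simp]: "length (pscale c xs) = length xs" by (simp add: pscale_def)

lemma lt_pscale: "c < 2 ^ j \<Longrightarrow> lt k xs \<Longrightarrow> lt (j + k) (pscale c xs)"
  by (auto simp: lt_def pscale_def power_add intro!: mult_strict_mono)

lemma length_pmul: "length (pmul xs ys) \<le> length xs + length ys"
  by (induction xs) (auto simp: length_padd)

lemma padd_le: "\<forall>x \<in> set xs. x \<le> A \<Longrightarrow> \<forall>y \<in> set ys. y \<le> B \<Longrightarrow> \<forall>z \<in> set (padd xs ys). z \<le> A + (B :: nat)"
  by (induction xs ys rule: padd.induct) (auto intro: trans_le_add1 trans_le_add2)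

lemma pmul_le: "\<forall>y \<in> set ys. y \<le> B \<Longrightarrow> \<forall>z \<in> set (pmul xs ys). z \<le> sum_list xs * B"
proof (induction xs)
  case (Cons x xs)
  have "\<forall>z \<in> set (padd (pscale x ys) (0 # pmul xs ys)). z \<le> x * B + sum_list xs * B"
    using Cons by (intro padd_le) (auto simp: pscale_def)
  then show ?case by (simp add: algebra_simps)
qed simp

lemma sum_list_lt: "lt k xs \<Longrightarrow> sum_list xs \<le> length xs * 2 ^ k"
  by (induction xs) auto

text \<open>A coefficient of the product is at most the sum of all coefficients of \<open>xs\<close>
  times the largest one of \<open>ys\<close>; that sum is below 2^(2 j), since there are at most j <
  2^j summands.\<close>

lemma lt_pmul:
  assumes "pb j xs" "lt k ys"
  shows "lt (2 * j + k) (pmul xs ys)"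
proof -
  have "\<forall>y \<in> set ys. y \<le> 2 ^ k - 1" using assms(2) by (auto simp: lt_def)
  then have z: "\<forall>z \<in> set (pmul xs ys). z \<le> sum_list xs * (2 ^ k - 1)" by (rule pmul_le)
  have "sum_list xs \<le> length xs * 2 ^ j" using assms(1) by (intro sum_list_lt) (simp add: pb_def)
  also have "\<dots> \<le> 2 ^ j * 2 ^ j" using assms(1) order_trans[OF _ less_imp_le[OF less_exp[of j]]] by (intro mult_le_mono1) (auto simp: pb_def)
  finally have "sum_list xs * (2 ^ k - 1) \<le> 2 ^ j * 2 ^ j * (2 ^ k - 1)" by (rule mult_le_mono1)
  also have "\<dots> < 2 ^ j * 2 ^ j * 2 ^ k" by simp
  also have "\<dots> = 2 ^ (2 * j + k)" by (simp add: power_add mult_2)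
  finally show ?thesis using z unfolding lt_def by (meson le_less_trans)
qed

text \<open>The asymmetry matters: the accumulated product is always the second argument and enters
  with factor 1, so sizes grow linearly in the number of factors instead of doubling.\<close>

lemma pb_pmul: "pb j xs \<Longrightarrow> pb k ys \<Longrightarrow> pb (2 * j + k) (pmul xs ys)"
  using lt_pmul[of j xs k ys] length_pmul[of xs ys] by (auto simp: pb_def)

lemma pb_pfac:
  assumes "pb k X" "pb k Y" "p < 2 ^ k" "q < 2 ^ k" "a < 2 ^ k"
  shows "pb (3 * k + 2) (fst (pfac p q a (X, Y)))" "pb (3 * k + 2) (snd (pfac p q a (X, Y)))"
proof -
  define U where "U = padd (pscale p Y) (pscale q X)"
  have U: "length U \<le> k" "lt (2 * k + 1) U"
    using assms lt_padd[of "k + k" "pscale p Y" "pscale q X"] lt_pscale[of p k k Y] lt_pscale[of q k k X]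
    by (auto simp: U_def length_padd pb_def mult_2)
  have "lt (3 * k + 1) (pscale q U)" "lt (3 * k + 1) (pscale p U)"
    using lt_pscale[of _ k "2 * k + 1" U] U assms by (auto simp: algebra_simps)
  moreover have "lt (3 * k + 1) (0 # pscale a X)"
    using lt_mono[OF lt_pscale[of a k k X], of "3 * k + 1"] assms by (auto simp: pb_def)
  ultimately have "lt (3 * k + 2) (padd (pscale q U) (0 # pscale a X))" "lt (3 * k + 2) (pscale p U)"
    using lt_padd[of "3 * k + 1" "pscale q U" "0 # pscale a X"] by (auto intro: lt_mono)
  then show "pb (3 * k + 2) (fst (pfac p q a (X, Y)))" "pb (3 * k + 2) (snd (pfac p q a (X, Y)))"
    using U(1) assms(1) by (auto simp: pfac_def Let_def U_def[symmetric] pb_def length_padd)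
qed

definition lsz :: "nat \<Rightarrow> (data \<times> data) list \<Rightarrow> bool" where
  "lsz s es \<longleftrightarrow> (\<forall>e \<in> set es. size (fst e) \<le> s \<and> size (snd e) \<le> s)"

lemma lsz_simps [simp]: "lsz s []" "lsz s (e # es) \<longleftrightarrow> size (fst e) \<le> s \<and> size (snd e) \<le> s \<and> lsz s es"
  by (auto simp: lsz_def)

section \<open>Cost of polynomial arithmetic and of substitution\<close>

context lisp
begin

lemma returnsI: "fn k x = Some (y, t) \<Longrightarrow> t \<le> T \<Longrightarrow> returns k x y T"
  by (auto simp: returns_def)

lemma Tmul_mono: "k \<le> k' \<Longrightarrow> Tmul k \<le> Tmul k'"
  unfolding Tmul_def by (intro mult_le_mono add_le_mono) auto

definition Tpadd :: "nat \<Rightarrow> nat" where "Tpadd k = (k + 1) * (60 * (2 * k + 1) + 40)"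

lemma Tpadd_mono: "k \<le> k' \<Longrightarrow> Tpadd k \<le> Tpadd k'"
  unfolding Tpadd_def by (intro mult_le_mono add_le_mono) auto

lemma fn_padd:
  assumes "length xs \<le> k" "lt k xs" "lt k ys"
  shows "returns 5 (Node (encp xs) (encp ys)) (encp (padd xs ys)) (Tpadd k)"
proof -
  define c where "c = 60 * (2 * k + 1) + 40"
  have "lt k xs \<Longrightarrow> lt k ys \<Longrightarrow> returns 5 (Node (encp xs) (encp ys)) (encp (padd xs ys)) (length xs * c + 20)"
  proof (induction xs ys rule: padd.induct)
    case (3 x xs y ys)
    then obtain t where t: "t \<le> length xs * c + 20" "fn 5 (Node (encp xs) (encp ys)) = Some (encp (padd xs ys), t)"
      by (auto elim!: returnsE)
    obtain s where s: "s \<le> 60 * (2 * k + 1)" "fn 2 (Node Atom (Node (enc_nat x) (enc_nat y))) = Some (enc_nat (x + y), s)"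
      using fn_add'[of x k y] 3 by (auto elim!: returnsE)
    have "\<exists>u \<le> t + s + 35. fn 5 (Node (encp (x # xs)) (encp (y # ys))) = Some (encp (padd (x # xs) (y # ys)), u)"
      unfolding fn_unfold(7)[of "Node (encp (x # xs)) (encp (y # ys))"] using t(2) s(2) by (simp add: b_padd_def)
    moreover have "t + s + 35 \<le> length (x # xs) * c + 20" using t(1) s(1) by (simp add: c_def)
    ultimately show ?case unfolding returns_def by (meson order_trans)
  qed (simp_all add: returns_def fn_unfold b_padd_def)
  moreover have "length xs * c + 20 \<le> Tpadd k"
  proof -
    have "length xs * c \<le> k * c" using assms by (intro mult_le_mono1)
    then show ?thesis by (simp add: Tpadd_def c_def algebra_simps)
  qed
  ultimately show ?thesis using assms returns_mono by blast
qed

definition Tpscale :: "nat \<Rightarrow> nat" where "Tpscale k = (k + 1) * (Tmul k + 40)"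

lemma Tpscale_mono: "k \<le> k' \<Longrightarrow> Tpscale k \<le> Tpscale k'"
  unfolding Tpscale_def by (intro mult_le_mono add_le_mono Tmul_mono) auto

lemma fn_pscale:
  assumes "c < 2 ^ k" "length xs \<le> k" "lt k xs"
  shows "returns 6 (Node (enc_nat c) (encp xs)) (encp (pscale c xs)) (Tpscale k)"
proof -
  have "lt k xs \<Longrightarrow> returns 6 (Node (enc_nat c) (encp xs)) (encp (pscale c xs)) (length xs * (Tmul k + 40) + 20)"
  proof (induction xs)
    case Nil
    show ?case by (simp add: returns_def fn_unfold b_pscale_def pscale_def)
  next
    case (Cons x xs)
    then obtain t where t: "t \<le> length xs * (Tmul k + 40) + 20" "fn 6 (Node (enc_nat c) (encp xs)) = Some (encp (pscale c xs), t)"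
      by (auto elim!: returnsE)
    obtain s where s: "s \<le> Tmul k" "fn 3 (Node (enc_nat c) (enc_nat x)) = Some (enc_nat (c * x), s)"
      using fn_mul[of x k c] Cons assms by (auto elim!: returnsE)
    have "\<exists>u \<le> t + s + 35. fn 6 (Node (enc_nat c) (encp (x # xs))) = Some (encp (pscale c (x # xs)), u)"
      unfolding fn_unfold(8)[of "Node (enc_nat c) (encp (x # xs))"] using t(2) s(2) by (simp add: b_pscale_def pscale_def)
    moreover have "t + s + 35 \<le> length (x # xs) * (Tmul k + 40) + 20" using t(1) s(1) by simp
    ultimately show ?case unfolding returns_def by (meson order_trans)
  qed
  moreover have "length xs * (Tmul k + 40) + 20 \<le> Tpscale k"
  proof -
    have "length xs * (Tmul k + 40) \<le> k * (Tmul k + 40)" using assms by (intro mult_le_mono1)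
    then show ?thesis by (simp add: Tpscale_def algebra_simps)
  qed
  ultimately show ?thesis using assms returns_mono by blast
qed

definition Tpmul :: "nat \<Rightarrow> nat" where "Tpmul k = (k + 1) * (Tpscale k + Tpadd (4 * k) + 60)"

lemma Tpmul_mono: "k \<le> k' \<Longrightarrow> Tpmul k \<le> Tpmul k'"
  unfolding Tpmul_def by (intro mult_le_mono add_le_mono Tpscale_mono Tpadd_mono) auto

lemma fn_pmul:
  assumes "pb k xs" "pb k ys"
  shows "returns 7 (Node (encp xs) (encp ys)) (encp (pmul xs ys)) (Tpmul k)"
proof -
  define c where "c = Tpscale k + Tpadd (4 * k) + 60"
  have "pb k xs \<Longrightarrow> returns 7 (Node (encp xs) (encp ys)) (encp (pmul xs ys)) (length xs * c + 20)"
  proof (induction xs)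
    case Nil
    show ?case by (simp add: returns_def fn_unfold b_pmul_def)
  next
    case (Cons x xs)
    have xs: "pb k xs" "x < 2 ^ k" using Cons.prems by (auto simp: pb_def)
    obtain t where t: "t \<le> length xs * c + 20" "fn 7 (Node (encp xs) (encp ys)) = Some (encp (pmul xs ys), t)"
      using Cons.IH[OF xs(1)] by (rule returnsE)
    obtain s where s: "s \<le> Tpscale k" "fn 6 (Node (enc_nat x) (encp ys)) = Some (encp (pscale x ys), s)"
      using fn_pscale[of x k ys] xs assms by (auto simp: pb_def elim!: returnsE)
    have l1: "lt (4 * k) (pscale x ys)" using lt_mono[OF lt_pscale[of x k k ys]] xs assms by (auto simp: pb_def)
    have l2: "lt (4 * k) (0 # pmul xs ys)" using lt_mono[OF lt_pmul[of k xs k ys]] xs assms by (auto simp: pb_def)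
    have "returns 5 (Node (encp (pscale x ys)) (encp (0 # pmul xs ys))) (encp (padd (pscale x ys) (0 # pmul xs ys))) (Tpadd (4 * k))"
      using l1 l2 assms by (intro fn_padd) (auto simp: pb_def)
    then obtain r where r: "r \<le> Tpadd (4 * k)"
      "fn 5 (Node (encp (pscale x ys)) (encp (0 # pmul xs ys))) = Some (encp (padd (pscale x ys) (0 # pmul xs ys)), r)"
      by (rule returnsE)
    have "\<exists>u \<le> t + s + r + 50. fn 7 (Node (encp (x # xs)) (encp ys)) = Some (encp (pmul (x # xs) ys), u)"
      unfolding fn_unfold(9)[of "Node (encp (x # xs)) (encp ys)"] using t(2) s(2) r(2) by (simp add: b_pmul_def)
    moreover have "t + s + r + 50 \<le> length (x # xs) * c + 20" using t(1) s(1) r(1) by (simp add: c_def)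
    ultimately show ?case unfolding returns_def by (meson order_trans)
  qed
  moreover have "length xs * c + 20 \<le> Tpmul k"
  proof -
    have "length xs * c \<le> k * c" using assms by (intro mult_le_mono1) (simp add: pb_def)
    then show ?thesis by (simp add: Tpmul_def c_def algebra_simps)
  qed
  ultimately show ?thesis using assms returns_mono by blast
qed

definition Teq :: "nat \<Rightarrow> nat" where "Teq s = 30 * (2 * s + 1)"

lemma fn_eq': "size d \<le> s \<Longrightarrow> returns (Suc 0) (Node d d') (enc_bit (d = d')) (Teq s)"
  using fn_eq by (rule returns_mono) (simp add: Teq_def)

definition Trsub :: "nat \<Rightarrow> nat \<Rightarrow> nat" where "Trsub s m = m * (2 * Teq s + 80) + 30"

lemma fn_rsub:
  "lsz s es \<Longrightarrow> returns 8 (Node (Node v w) (Node (ence es) (ence acc))) (ence (rsub v w es acc)) (Trsub s (length es))"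
proof (induction es arbitrary: acc)
  case Nil
  show ?case by (simp add: returns_def fn_unfold b_rsub_def Trsub_def)
next
  case (Cons e es)
  obtain t1 where t1: "t1 \<le> Teq s" "fn (Suc 0) (Node (fst e) v) = Some (enc_bit (fst e = v), t1)"
    using fn_eq'[of "fst e" s v] Cons.prems by (auto elim!: returnsE)
  obtain t2 where t2: "t2 \<le> Teq s" "fn (Suc 0) (Node (snd e) v) = Some (enc_bit (snd e = v), t2)"
    using fn_eq'[of "snd e" s v] Cons.prems by (auto elim!: returnsE)
  have l: "lsz s es" using Cons.prems by simp
  obtain t where t: "t \<le> Trsub s (length es)"
    "fn 8 (Node (Node v w) (Node (ence es) (ence (sb v w e # acc)))) = Some (ence (rsub v w es (sb v w e # acc)), t)"
    using Cons.IH[OF l, of "sb v w e # acc"] by (rule returnsE)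
  have "\<exists>u \<le> t + t1 + t2 + 80. fn 8 (Node (Node v w) (Node (ence (e # es)) (ence acc))) = Some (ence (rsub v w (e # es) acc), u)"
    unfolding fn_unfold(10)[of "Node (Node v w) (Node (ence (e # es)) (ence acc))"] using t(2) t1(2) t2(2)
    by (cases "fst e = v"; cases "snd e = v") (simp_all add: b_rsub_def sb_def)
  moreover have "t + t1 + t2 + 80 \<le> Trsub s (length (e # es))" using t(1) t1(1) t2(1) by (simp add: Trsub_def)
  ultimately show ?case unfolding returns_def by (meson order_trans)
qed

definition Tpfac :: "nat \<Rightarrow> nat" where "Tpfac k = 5 * Tpscale (3 * k + 2) + 2 * Tpadd (3 * k + 2) + 20 * k + 200"

lemma Tpfac_mono: "k \<le> k' \<Longrightarrow> Tpfac k \<le> Tpfac k'"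
  unfolding Tpfac_def by (intro add_le_mono mult_le_mono Tpscale_mono Tpadd_mono) auto

lemma size_const: "n < 2 ^ k \<Longrightarrow> size (enc_nat n) \<le> 2 * k"
  using size_enc_nat[of n] by (auto simp flip: bl_le)

lemma fn_pfac:
  assumes "pb k X" "pb k Y" "p < 2 ^ k" "q < 2 ^ k" "a < 2 ^ k"
  shows "returns 9 (Node (encp X) (encp Y)) (Node (encp (fst (pfac p q a (X, Y)))) (encp (snd (pfac p q a (X, Y))))) (Tpfac k)"
proof -
  define W where "W = 3 * k + 2"
  define U where "U = padd (pscale p Y) (pscale q X)"
  have up: "n < 2 ^ k \<Longrightarrow> n < 2 ^ W" for n :: nat by (erule less_le_trans, rule power_increasing) (auto simp: W_def)
  have k: "p < 2 ^ W" "q < 2 ^ W" "a < 2 ^ W" using assms up by auto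
  have XY: "pb W X" "pb W Y" using assms pb_mono by (auto simp: W_def)
  have l1: "lt (2 * k) (pscale p Y)" "lt (2 * k) (pscale q X)" "lt (2 * k) (pscale a X)"
    using lt_pscale[of _ k k] assms by (auto simp: pb_def mult_2)
  have U: "length U \<le> W" "lt (2 * k + 1) U" using lt_padd[OF l1(1,2)] assms by (auto simp: U_def length_padd pb_def W_def)
  have l2: "lt W (pscale q U)" using lt_mono[OF lt_pscale[OF assms(4) U(2)], of W] by (simp add: W_def)
  have l3: "lt W (pscale p Y)" "lt W (pscale q X)" "lt W (0 # pscale a X)" "lt W U" using l1 U lt_mono[of _ _ W] by (auto simp: W_def)
  obtain t1 where t1: "t1 \<le> Tpscale W" "fn 6 (Node (enc_nat p) (encp Y)) = Some (encp (pscale p Y), t1)"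
    using fn_pscale[OF k(1), of Y] XY by (auto simp: pb_def elim!: returnsE)
  obtain t2 where t2: "t2 \<le> Tpscale W" "fn 6 (Node (enc_nat q) (encp X)) = Some (encp (pscale q X), t2)"
    using fn_pscale[OF k(2), of X] XY by (auto simp: pb_def elim!: returnsE)
  obtain t3 where t3: "t3 \<le> Tpadd W" "fn 5 (Node (encp (pscale p Y)) (encp (pscale q X))) = Some (encp U, t3)"
    using fn_padd[of "pscale p Y" W "pscale q X"] l3 XY by (auto simp: pb_def U_def elim!: returnsE)
  obtain t4 where t4: "t4 \<le> Tpscale W" "fn 6 (Node (enc_nat q) (encp U)) = Some (encp (pscale q U), t4)"
    using fn_pscale[OF k(2), of U] U l3 by (auto simp: pb_def elim!: returnsE)
  obtain t5 where t5: "t5 \<le> Tpscale W" "fn 6 (Node (enc_nat a) (encp X)) = Some (encp (pscale a X), t5)"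
    using fn_pscale[OF k(3), of X] XY by (auto simp: pb_def elim!: returnsE)
  obtain t6 where t6: "t6 \<le> Tpadd W" "fn 5 (Node (encp (pscale q U)) (Node Atom (encp (pscale a X)))) = Some (encp (padd (pscale q U) (0 # pscale a X)), t6)"
    using fn_padd[of "pscale q U" W "0 # pscale a X"] l2 l3 U by (auto simp: pb_def elim!: returnsE)
  obtain t7 where t7: "t7 \<le> Tpscale W" "fn 6 (Node (enc_nat p) (encp U)) = Some (encp (pscale p U), t7)"
    using fn_pscale[OF k(1), of U] U l3 by (auto simp: pb_def elim!: returnsE)
  have pf: "fst (pfac p q a (X, Y)) = padd (pscale q U) (0 # pscale a X)" "snd (pfac p q a (X, Y)) = pscale p U"
    by (simp_all add: pfac_def Let_def U_def)
  define T where "T = t1 + t2 + t3 + t4 + t5 + t6 + t7 + 4 * size (enc_nat p) + 4 * size (enc_nat q) + 2 * size (enc_nat a) + 100"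
  have "\<exists>u \<le> T. fn 9 (Node (encp X) (encp Y)) = Some (Node (encp (fst (pfac p q a (X, Y)))) (encp (snd (pfac p q a (X, Y)))), u)"
    unfolding fn_unfold(11) pf using t1(2) t2(2) t3(2) t4(2) t5(2) t6(2) t7(2) by (simp add: b_pfac_def T_def)
  moreover have "T \<le> Tpfac k"
  proof -
    have "Tpfac k = 5 * Tpscale W + 2 * Tpadd W + 20 * k + 200" by (simp only: Tpfac_def W_def)
    then show ?thesis unfolding T_def
      using t1(1) t2(1) t3(1) t4(1) t5(1) t6(1) t7(1) size_const[OF assms(3)] size_const[OF assms(4)] size_const[OF assms(5)]
      by linarith
  qed
  ultimately show ?thesis unfolding returns_def by (meson order_trans)
qed

end

section \<open>Degrees and the growth of coefficients in the recursion\<close>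

definition dgr :: "data \<Rightarrow> (data \<times> data) list \<Rightarrow> nat" where
  "dgr v es = length (filter (\<lambda>e. other v e \<noteq> None) es)"

lemma dgr_simps [simp]: "dgr v [] = 0" "dgr v (e # es) = of_bool (other v e \<noteq> None) + dgr v es"
  "dgr v (es @ es') = dgr v es + dgr v es'"
  by (auto simp: dgr_def)

lemma dgr_mset: "mset es = mset es' \<Longrightarrow> dgr v es = dgr v es'"
  unfolding dgr_def by (metis mset_filter size_mset)

lemma dgr_sb: "w \<noteq> z \<Longrightarrow> dgr w (map (sb v z) es) \<le> dgr w es"
  by (induction es) (auto simp: other_def sb_def)

text \<open>Pins may have arbitrarily many edges; \<open>go\<close> never recurses into a
  pin.\<close>

definition dgb :: "nat \<Rightarrow> (data \<times> data) list \<Rightarrow> bool" where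
  "dgb D es \<longleftrightarrow> (\<forall>w. w \<noteq> pin0 \<longrightarrow> w \<noteq> pin1 \<longrightarrow> dgr w es \<le> D)"

lemma dgb_rsub: "dgb D (pre @ suf) \<Longrightarrow> dgb D (rsub v pin0 suf pre)"
  unfolding dgb_def
proof (intro allI impI)
  fix w assume "\<forall>w. w \<noteq> pin0 \<longrightarrow> w \<noteq> pin1 \<longrightarrow> dgr w (pre @ suf) \<le> D" and w: "w \<noteq> pin0" "w \<noteq> pin1"
  then have "dgr w pre + dgr w suf \<le> D" by auto
  moreover have "dgr w (rsub v pin0 suf pre) = dgr w (map (sb v pin0) suf @ pre)" by (rule dgr_mset) (rule mset_rsub)
  ultimately show "dgr w (rsub v pin0 suf pre) \<le> D" using dgr_sb[OF w(1), of v suf] by simp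
qed

lemma dgb_pin1:
  assumes "dgb D (pre @ e # suf)" "other v e = Some w"
  shows "dgb D (((pin1, w) # pre) @ suf)"
  unfolding dgb_def
proof (intro allI impI)
  fix w' assume w': "w' \<noteq> pin0" "w' \<noteq> pin1"
  have "of_bool (other w' (pin1, w) \<noteq> None) \<le> (of_bool (other w' e \<noteq> None) :: nat)"
    using assms(2) w' by (auto simp: other_def split: if_splits)
  then show "dgr w' (((pin1, w) # pre) @ suf) \<le> D" using assms(1) w' by (fastforce simp: dgb_def)
qed

text \<open>A bound on the degrees and the bit lengths of the coefficients of the polynomials computed by \<open>go\<close>.\<close>

fun ch :: "nat \<Rightarrow> nat \<Rightarrow> nat \<Rightarrow> nat" where
  "ch D c 0 = 1"
| "ch D c (Suc n) = 1 + D * (6 * ch D c n + 6 * c + 4)"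

lemma ch_pos: "ch D c n \<ge> 1" by (cases n) auto

lemma ch_Suc_le: "D \<ge> 1 \<Longrightarrow> ch D c n \<le> ch D c (Suc n)"
proof -
  assume "D \<ge> 1"
  then have "6 * ch D c n + 6 * c + 4 \<le> D * (6 * ch D c n + 6 * c + 4)" by simp
  then show ?thesis unfolding ch.simps by linarith
qed

lemma ch_bound: "ch D c n \<le> (6 * D + 6 * c + 5) ^ (n + 1)"
proof (induction n)
  case (Suc n)
  define B where "B = 6 * D + 6 * c + 5"
  have B1: "B \<le> B ^ (n + 1)" by (simp add: B_def)
  have "ch D c (Suc n) \<le> 1 + D * (6 * c + 4) + 6 * D * B ^ (n + 1)" using mult_le_mono2[OF Suc, of "6 * D"] unfolding B_def[symmetric] by (simp add: algebra_simps)
  also have "1 + D * (6 * c + 4) \<le> (6 * c + 5) * B" by (simp add: B_def algebra_simps)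
  also have "\<dots> \<le> (6 * c + 5) * B ^ (n + 1)" using B1 by (intro mult_le_mono2)
  also have "(6 * c + 5) * B ^ (n + 1) + 6 * D * B ^ (n + 1) = B ^ (Suc n + 1)"
    by (simp add: B_def algebra_simps)
  finally show ?case by (simp add: B_def)
qed simp

lemma pb_one: "k \<ge> 1 \<Longrightarrow> pb k []" "k \<ge> 1 \<Longrightarrow> pb k [Suc 0]"
  using power_increasing[of 1 k "2::nat"] by (auto simp: pb_def)

lemma go_pb:
  assumes c: "p < 2 ^ c" "q < 2 ^ c" "a < 2 ^ c" and D: "D \<ge> 1"
  shows "dgb D (pre @ suf) \<Longrightarrow> pb (1 + dgr v suf * (6 * ch D c N + 6 * c + 4)) (fst (go p q a N v pre suf)) \<and>
     pb (1 + dgr v suf * (6 * ch D c N + 6 * c + 4)) (snd (go p q a N v pre suf))"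
proof (induction N arbitrary: v pre suf rule: less_induct)
  case (less N)
  note IHN = less.IH
  show ?case using less.prems
  proof (induction suf arbitrary: pre)
    case Nil
    then show ?case by (simp add: pb_one)
  next
    case (Cons e suf)
    define f where "f = 6 * ch D c N + 6 * c + 4"
    show ?case
    proof (cases "other v e")
      case None
      have "dgb D ((e # pre) @ suf)" using Cons.prems by (simp add: dgb_def algebra_simps)
      from Cons.IH[OF this] None show ?thesis by simp
    next
      case (Some w)
      define XY where "XY = (if w = pin0 then ([], [1]) else if w = pin1 then ([1], [])
                 else case N of 0 \<Rightarrow> ([], [1]) | Suc n \<Rightarrow> go p q a n w [] (rsub v pin0 suf pre))"
      define k where "k = ch D c N + c"
      have k1: "k \<ge> 1" using ch_pos[of D c N] by (simp add: k_def)
      have XY: "pb k (fst XY) \<and> pb k (snd XY)"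
      proof (cases "w = pin0 \<or> w = pin1 \<or> N = 0")
        case True
        then show ?thesis using k1 by (auto simp: XY_def pb_one)
      next
        case False
        then obtain n where n: "N = Suc n" by (cases N) auto
        have "dgb D (pre @ suf)" using Cons.prems by (fastforce simp: dgb_def)
        then have dD: "dgb D ([] @ rsub v pin0 suf pre)" using dgb_rsub by simp
        then have "dgr w (rsub v pin0 suf pre) \<le> D" using False by (simp add: dgb_def)
        then have "1 + dgr w (rsub v pin0 suf pre) * (6 * ch D c n + 6 * c + 4) \<le> k"
          using n by (simp add: k_def trans_le_add1)
        then show ?thesis using IHN[OF _ dD, of n w] n False pb_mono by (auto simp: XY_def)
      qed
      have "x < 2 ^ c \<Longrightarrow> x < 2 ^ k" for x :: nat by (erule less_le_trans, rule power_increasing) (auto simp: k_def)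
      then have pf: "pb (3 * k + 2) (fst (pfac p q a XY))" "pb (3 * k + 2) (snd (pfac p q a XY))"
        using pb_pfac[of k "fst XY" "snd XY" p q a] XY c by auto
      have goeq: "go p q a N v pre (e # suf) =
        (pmul (fst (pfac p q a XY)) (fst (go p q a N v ((pin1, w) # pre) suf)),
         pmul (snd (pfac p q a XY)) (snd (go p q a N v ((pin1, w) # pre) suf)))"
        using Some by (simp add: XY_def Let_def)
      have IH: "pb (1 + dgr v suf * f) (fst (go p q a N v ((pin1, w) # pre) suf))"
        "pb (1 + dgr v suf * f) (snd (go p q a N v ((pin1, w) # pre) suf))"
        using Cons.IH[OF dgb_pin1[OF Cons.prems Some]] by (simp_all add: f_def)
      \<comment> \<open>One more edge at \<open>v\<close> multiplies by an output of
        \<open>pfac\<close> of size 3 k + 2, counted twice by \<open>pb_pmul\<close>. This is the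
        origin of the summand in \<open>ch\<close>.\<close>
      have "2 * (3 * k + 2) + (1 + dgr v suf * f) = 1 + dgr v (e # suf) * f" using Some by (simp add: k_def f_def)
      then show ?thesis using pb_pmul[OF pf(1) IH(1)] pb_pmul[OF pf(2) IH(2)] by (simp only: goeq fst_conv snd_conv f_def)
    qed
  qed
qed

lemma size_pins [simp]: "size pin0 = 3" "size pin1 = 3" by (simp_all add: pin0_def pin1_def)

lemma lsz_rsub: "lsz s es \<Longrightarrow> lsz s acc \<Longrightarrow> size w \<le> s \<Longrightarrow> lsz s (rsub v w es acc)"
  by (induction es arbitrary: acc) (auto simp: sb_def)

lemma length_rsub: "length (rsub v w es acc) = length es + length acc"
  by (induction es arbitrary: acc) auto

section \<open>Cost of the recursion for the ratios\<close>

context lisp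
begin

definition KK :: "nat \<Rightarrow> nat" where
  "KK W = 4 * Teq W + Trsub W W + Tpfac W + 2 * Tpmul W + 600"

text \<open>One level scans at most \<open>W\<close> edges at cost \<open>KK\<close> each and makes
  at most \<open>D\<close> calls on the level below, so the depth enters only as (D + 1)^n.\<close>

fun Tc :: "nat \<Rightarrow> nat \<Rightarrow> nat \<Rightarrow> nat" where
  "Tc W D 0 = 0"
| "Tc W D (Suc n) = 60 + W * KK W + D * Tc W D n"

lemma Tc_bound: "Tc W D n \<le> (60 + W * KK W) * (D + 1) ^ n"
proof (induction n)
  case (Suc n)
  have "Tc W D (Suc n) \<le> (60 + W * KK W) + D * ((60 + W * KK W) * (D + 1) ^ n)"
    using mult_le_mono2[OF Suc, of D] by simp
  also have "\<dots> \<le> (60 + W * KK W) * (D + 1) ^ n + D * ((60 + W * KK W) * (D + 1) ^ n)" by simp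
  also have "\<dots> = (60 + W * KK W) * (D + 1) ^ Suc n" by (simp add: algebra_simps)
  finally show ?case .
qed simp

lemma Trsub_mono: "m \<le> m' \<Longrightarrow> Trsub s m \<le> Trsub s m'" by (simp add: Trsub_def)

text \<open>A single level of the recursion, by induction over the edges still to be moved. The
  calls at neighbours form the hypothesis \<open>child\<close>, which the induction over the fuel
  supplies.\<close>

lemma fn_go_step:
  assumes c: "p < 2 ^ c" "q < 2 ^ c" "a < 2 ^ c" and D: "D \<ge> 1" and W3: "3 \<le> W"
    and W: "3 * (ch D c (spine f) + c) + 2 \<le> W" "ch D c (Suc (spine f)) \<le> W"
    and v: "size v \<le> W" "v \<noteq> pin0" "v \<noteq> pin1"
    and child: "\<And>w es. f \<noteq> Atom \<Longrightarrow> dgb D es \<Longrightarrow> lsz W es \<Longrightarrow> size w \<le> W \<Longrightarrow> length es \<le> W \<Longrightarrow>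
      w \<noteq> pin0 \<Longrightarrow> w \<noteq> pin1 \<Longrightarrow>
      returns 10 (Node (dsnd f) (Node w (Node Atom (ence es))))
      (Node (encp (fst (go p q a (spine (dsnd f)) w [] es))) (encp (snd (go p q a (spine (dsnd f)) w [] es)))) (Tc W D (spine f))"
  shows "dgb D (pre @ suf) \<Longrightarrow> lsz W (pre @ suf) \<Longrightarrow> length pre + length suf \<le> W \<Longrightarrow>
    returns 10 (Node f (Node v (Node (ence pre) (ence suf))))
      (Node (encp (fst (go p q a (spine f) v pre suf))) (encp (snd (go p q a (spine f) v pre suf))))
      (60 + length suf * KK W + dgr v suf * Tc W D (spine f))"
proof (induction suf arbitrary: pre)
  case Nil
  show ?case by (simp add: returns_def fn_unfold b_go_def)
next
  case (Cons e suf)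
  define N where "N = spine f"
  have ls: "lsz W pre" "lsz W suf" "size (fst e) \<le> W" "size (snd e) \<le> W" using Cons.prems(2) by (auto simp: lsz_def)
  have unf: "fn 10 (Node f (Node v (Node (ence pre) (ence (e # suf))))) =
     evr (prog p q a K) [Node f (Node v (Node (ence pre) (ence (e # suf))))] b_go" by (rule fn_unfold)
  obtain t1 where t1: "t1 \<le> Teq W" "fn (Suc 0) (Node (fst e) v) = Some (enc_bit (fst e = v), t1)"
    using fn_eq'[OF ls(3), of v] by (rule returnsE)
  obtain t2 where t2: "t2 \<le> Teq W" "fn (Suc 0) (Node (snd e) v) = Some (enc_bit (snd e = v), t2)"
    using fn_eq'[OF ls(4), of v] by (rule returnsE)
  show ?case
  proof (cases "other v e")
    case None
    have "dgb D ((e # pre) @ suf)" using Cons.prems by (simp add: dgb_def algebra_simps)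
    moreover have "lsz W ((e # pre) @ suf)" using ls by (auto simp: lsz_def)
    moreover have "length (e # pre) + length suf \<le> W" using Cons.prems by simp
    ultimately obtain t where t: "t \<le> 60 + length suf * KK W + dgr v suf * Tc W D (spine f)"
      "fn 10 (Node f (Node v (Node (ence (e # pre)) (ence suf)))) =
       Some (Node (encp (fst (go p q a (spine f) v (e # pre) suf))) (encp (snd (go p q a (spine f) v (e # pre) suf))), t)"
      using Cons.IH returnsE by blast
    have ne: "fst e \<noteq> v" "snd e \<noteq> v" using None by (auto simp: other_def split: if_splits)
    have "\<exists>u \<le> t + t1 + t2 + 100. fn 10 (Node f (Node v (Node (ence pre) (ence (e # suf))))) =
       Some (Node (encp (fst (go p q a (spine f) v pre (e # suf)))) (encp (snd (go p q a (spine f) v pre (e # suf)))), u)"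
      unfolding unf using t(2) t1(2) t2(2) ne None by (simp add: b_go_def)
    moreover have "t + t1 + t2 + 100 \<le> 60 + length (e # suf) * KK W + dgr v (e # suf) * Tc W D (spine f)"
      using t(1) t1(1) t2(1) by (simp add: KK_def None)
    ultimately show ?thesis unfolding returns_def by (meson order_trans)
  next
    case (Some w)
    have w: "size w \<le> W" using Some ls by (auto simp: other_def split: if_splits)
    define es' where "es' = rsub v pin0 suf pre"
    define XY where "XY = (if w = pin0 then ([], [1]) else if w = pin1 then ([1], [])
       else case N of 0 \<Rightarrow> ([], [1]) | Suc n \<Rightarrow> go p q a n w [] es')"
    define X where "X = go p q a N v ((pin1, w) # pre) suf"
    define A where "A = pfac p q a XY"
    have goeq: "go p q a (spine f) v pre (e # suf) = (pmul (fst A) (fst X), pmul (snd A) (snd X))"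
      unfolding XY_def A_def X_def N_def es'_def using Some by (simp add: Let_def)
    define k where "k = ch D c N + c"
    have kW: "3 * k + 2 \<le> W" using W(1) by (simp add: k_def N_def)
    have k1: "k \<ge> 1" using ch_pos[of D c N] by (simp add: k_def)
    have dps: "dgb D (pre @ suf)" using Cons.prems by (fastforce simp: dgb_def)
    have des: "dgb D es'" unfolding es'_def using dgb_rsub[OF dps] .
    have les: "lsz W es'" unfolding es'_def using ls W3 by (intro lsz_rsub) auto
    have nes: "length es' \<le> W" unfolding es'_def using Cons.prems by (simp add: length_rsub)
    have XYb: "pb k (fst XY) \<and> pb k (snd XY)"
    proof (cases "w = pin0 \<or> w = pin1 \<or> N = 0")
      case True
      then show ?thesis using k1 by (auto simp: XY_def pb_one)
    next
      case False
      then obtain n where n: "N = Suc n" by (cases N) auto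
      have "dgr w es' \<le> D" using False des by (simp add: dgb_def)
      then have "1 + dgr w es' * (6 * ch D c n + 6 * c + 4) \<le> k"
        using n by (simp add: k_def trans_le_add1)
      then show ?thesis using go_pb[OF c D, of "[]" es' w n] des n False pb_mono by (auto simp: XY_def)
    qed
    have ck: "x < 2 ^ c \<Longrightarrow> x < 2 ^ k" for x :: nat by (erule less_le_trans, rule power_increasing) (auto simp: k_def)
    obtain t9 where t9: "t9 \<le> Tpfac k" "fn 9 (Node (encp (fst XY)) (encp (snd XY))) = Some (Node (encp (fst A)) (encp (snd A)), t9)"
      using fn_pfac[of k "fst XY" "snd XY"] XYb ck c unfolding A_def by (auto elim!: returnsE)
    have Ab: "pb W (fst A)" "pb W (snd A)"
      using pb_pfac[of k "fst XY" "snd XY" p q a] XYb ck c pb_mono[OF _ kW] unfolding A_def by auto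
    have d1: "dgb D (((pin1, w) # pre) @ suf)" using dgb_pin1[OF Cons.prems(1) Some] .
    have "dgr v suf \<le> D" using v Cons.prems(1) by (fastforce simp: dgb_def)
    then have "1 + dgr v suf * (6 * ch D c N + 6 * c + 4) \<le> ch D c (Suc N)" by simp
    then have bW: "1 + dgr v suf * (6 * ch D c N + 6 * c + 4) \<le> W" using W(2) unfolding N_def by linarith
    have Xb: "pb W (fst X)" "pb W (snd X)" using go_pb[OF c D d1, of v N] pb_mono[OF _ bW] unfolding X_def by auto
    have "lsz W (((pin1, w) # pre) @ suf)" using ls w W3 by (auto simp: lsz_def)
    moreover have "length ((pin1, w) # pre) + length suf \<le> W" using Cons.prems by simp
    ultimately obtain t where t: "t \<le> 60 + length suf * KK W + dgr v suf * Tc W D (spine f)"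
      "fn 10 (Node f (Node v (Node (Node (Node pin1 w) (ence pre)) (ence suf)))) = Some (Node (encp (fst X)) (encp (snd X)), t)"
      using Cons.IH[OF d1] unfolding X_def N_def by (auto elim!: returnsE)
    obtain m1 where m1: "m1 \<le> Tpmul W" "fn 7 (Node (encp (fst A)) (encp (fst X))) = Some (encp (pmul (fst A) (fst X)), m1)"
      using fn_pmul[OF Ab(1) Xb(1)] by (rule returnsE)
    obtain m2 where m2: "m2 \<le> Tpmul W" "fn 7 (Node (encp (snd A)) (encp (snd X))) = Some (encp (pmul (snd A) (snd X)), m2)"
      using fn_pmul[OF Ab(2) Xb(2)] by (rule returnsE)
    obtain e1 where e1: "e1 \<le> Teq W" "fn (Suc 0) (Node w pin0) = Some (enc_bit (w = pin0), e1)"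
      using fn_eq'[OF w, of pin0] by (rule returnsE)
    obtain e2 where e2: "e2 \<le> Teq W" "fn (Suc 0) (Node w pin1) = Some (enc_bit (w = pin1), e2)"
      using fn_eq'[OF w, of pin1] by (rule returnsE)
    obtain r where r: "r \<le> Trsub W (length suf)" "fn 8 (Node (Node v pin0) (Node (ence suf) (ence pre))) = Some (ence es', r)"
      using fn_rsub[OF ls(2), of v pin0 pre] unfolding es'_def by (rule returnsE)
    have rW: "Trsub W (length suf) \<le> Trsub W W" using Cons.prems(3) by (intro Trsub_mono) simp
    have fW: "Tpfac k \<le> Tpfac W" using kW by (intro Tpfac_mono) simp
    have ex: "\<exists>u s. s \<le> Tc W D (spine f) \<and> u \<le> t + t1 + t2 + e1 + e2 + r + s + t9 + m1 + m2 + 400 \<and>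
       fn 10 (Node f (Node v (Node (ence pre) (ence (e # suf))))) =
       Some (Node (encp (fst (go p q a (spine f) v pre (e # suf)))) (encp (snd (go p q a (spine f) v pre (e # suf)))), u)"
    proof (cases "w = pin0 \<or> w = pin1 \<or> f = Atom")
      case True
      have XYd: "Node (encp (fst XY)) (encp (snd XY)) =
        (if w = pin0 then Node Atom (Node (Node (Node Atom Atom) Atom) Atom) else if w = pin1
         then Node (Node (Node (Node Atom Atom) Atom) Atom) Atom else Node Atom (Node (Node (Node Atom Atom) Atom) Atom))"
        using True by (auto simp: XY_def N_def)
      note t9' = t9(2)[unfolded XYd]
      have "\<exists>u \<le> t + t1 + t2 + e1 + e2 + t9 + m1 + m2 + 400. fn 10 (Node f (Node v (Node (ence pre) (ence (e # suf))))) =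
         Some (Node (encp (fst (go p q a (spine f) v pre (e # suf)))) (encp (snd (go p q a (spine f) v pre (e # suf)))), u)"
        unfolding unf goeq fst_conv snd_conv using True Some t9' t(2) t1(2) t2(2) e1(2) e2(2) m1(2) m2(2)
        by (cases "fst e = v"; cases "w = pin0"; cases "w = pin1")
           (auto simp: b_go_def other_def split: if_splits)
      then obtain u where "u \<le> t + t1 + t2 + e1 + e2 + t9 + m1 + m2 + 400" "fn 10 (Node f (Node v (Node (ence pre) (ence (e # suf))))) =
         Some (Node (encp (fst (go p q a (spine f) v pre (e # suf)))) (encp (snd (go p q a (spine f) v pre (e # suf)))), u)" by blast
      then show ?thesis by (intro exI[of _ u] exI[of _ "0 :: nat"] conjI) (assumption | simp)+
    next
      case False
      then obtain s where s: "s \<le> Tc W D (spine f)" "fn 10 (Node (dsnd f) (Node w (Node Atom (ence es')))) =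
          Some (Node (encp (fst (go p q a (spine (dsnd f)) w [] es'))) (encp (snd (go p q a (spine (dsnd f)) w [] es'))), s)"
        using child[OF _ des les w nes] by (auto elim!: returnsE)
      have "XY = go p q a (spine (dsnd f)) w [] es'" using False by (cases f) (auto simp: XY_def N_def)
      note s' = s(2)[folded this]
      have "\<exists>u \<le> t + t1 + t2 + e1 + e2 + r + s + t9 + m1 + m2 + 400. fn 10 (Node f (Node v (Node (ence pre) (ence (e # suf))))) =
         Some (Node (encp (fst (go p q a (spine f) v pre (e # suf)))) (encp (snd (go p q a (spine f) v pre (e # suf)))), u)"
        unfolding unf goeq fst_conv snd_conv using False Some s' t9(2) t(2) t1(2) t2(2) e1(2) e2(2) r(2) m1(2) m2(2)
        by (cases "fst e = v") (auto simp: b_go_def other_def split: if_splits)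
      then show ?thesis using s(1) by blast
    qed
    then obtain u s where us: "s \<le> Tc W D (spine f)" "u \<le> t + t1 + t2 + e1 + e2 + r + s + t9 + m1 + m2 + 400"
       "fn 10 (Node f (Node v (Node (ence pre) (ence (e # suf))))) =
       Some (Node (encp (fst (go p q a (spine f) v pre (e # suf)))) (encp (snd (go p q a (spine f) v pre (e # suf)))), u)" by blast
    have "length (e # suf) * KK W = KK W + length suf * KK W" "dgr v (e # suf) * Tc W D (spine f) = Tc W D (spine f) + dgr v suf * Tc W D (spine f)"
      using Some by simp_all
    then have "u \<le> 60 + length (e # suf) * KK W + dgr v (e # suf) * Tc W D (spine f)"
      using us(1,2) t(1) t1(1) t2(1) e1(1) e2(1) r(1) rW t9(1) fW m1(1) m2(1) unfolding KK_def by linarith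
    with us(3) show ?thesis by (rule returnsI)
  qed
qed

lemma fn_go:
  assumes c: "p < 2 ^ c" "q < 2 ^ c" "a < 2 ^ c" and D: "D \<ge> 1" and W3: "3 \<le> W"
  shows "3 * (ch D c (spine f) + c) + 2 \<le> W \<Longrightarrow> ch D c (Suc (spine f)) \<le> W \<Longrightarrow>
    size v \<le> W \<Longrightarrow> v \<noteq> pin0 \<Longrightarrow> v \<noteq> pin1 \<Longrightarrow> dgb D es \<Longrightarrow> lsz W es \<Longrightarrow> length es \<le> W \<Longrightarrow>
    returns 10 (Node f (Node v (Node Atom (ence es))))
      (Node (encp (fst (go p q a (spine f) v [] es))) (encp (snd (go p q a (spine f) v [] es)))) (Tc W D (Suc (spine f)))"
proof (induction f arbitrary: v es)
  case Atom
  have "returns 10 (Node Atom (Node v (Node (ence []) (ence es))))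
      (Node (encp (fst (go p q a (spine Atom) v [] es))) (encp (snd (go p q a (spine Atom) v [] es))))
      (60 + length es * KK W + dgr v es * Tc W D (spine Atom))"
    using Atom by (intro fn_go_step[OF c D W3]) auto
  moreover have "60 + length es * KK W + dgr v es * Tc W D (spine Atom) \<le> Tc W D (Suc (spine Atom))"
    using Atom by simp
  ultimately show ?case using returns_mono by fastforce
next
  case (Node f1 f)
  have m: "ch D c (spine f) \<le> ch D c (spine (Node f1 f))" using ch_Suc_le[OF D] by simp
  have ch: "3 * (ch D c (spine f) + c) + 2 \<le> W" using Node.prems(1) m by (meson add_le_mono1 mult_le_mono2 order_trans)
  have ch2: "ch D c (Suc (spine f)) \<le> W" using Node.prems(1) by (simp del: ch.simps)
  have "returns 10 (Node (Node f1 f) (Node v (Node (ence []) (ence es))))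
      (Node (encp (fst (go p q a (spine (Node f1 f)) v [] es))) (encp (snd (go p q a (spine (Node f1 f)) v [] es))))
      (60 + length es * KK W + dgr v es * Tc W D (spine (Node f1 f)))"
  proof (rule fn_go_step[OF c D W3 Node.prems(1-5)])
    fix w and es' :: "(data \<times> data) list"
    assume "dgb D es'" "lsz W es'" "size w \<le> W" "length es' \<le> W" "w \<noteq> pin0" "w \<noteq> pin1"
    from Node.IH(2)[OF ch ch2 this(3,5,6,1,2,4)]
    show "returns 10 (Node (dsnd (Node f1 f)) (Node w (Node Atom (ence es'))))
       (Node (encp (fst (go p q a (spine (dsnd (Node f1 f))) w [] es'))) (encp (snd (go p q a (spine (dsnd (Node f1 f))) w [] es'))))
       (Tc W D (spine (Node f1 f)))" by simp
  qed (use Node.prems in auto)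
  moreover have "60 + length es * KK W + dgr v es * Tc W D (spine (Node f1 f)) \<le> Tc W D (Suc (spine (Node f1 f)))"
  proof -
    have "length es * KK W \<le> W * KK W" using Node.prems by (intro mult_le_mono1)
    moreover have "dgr v es * Tc W D (spine (Node f1 f)) \<le> D * Tc W D (spine (Node f1 f))"
      using Node.prems by (intro mult_le_mono1) (auto simp: dgb_def)
    moreover have "Tc W D (Suc (spine (Node f1 f))) = 60 + W * KK W + D * Tc W D (spine (Node f1 f))" by (simp only: Tc.simps)
    ultimately show ?thesis by linarith
  qed
  ultimately show ?case using returns_mono by fastforce
qed

end

section \<open>Cost of inversion, evaluation and the loop over the vertices\<close>

lemma less_pow2_mono: "x < 2 ^ j \<Longrightarrow> j \<le> k \<Longrightarrow> x < (2 :: nat) ^ k"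
  by (meson less_le_trans one_le_numeral power_increasing)

lemma less_pow2_mult: "x < 2 ^ j \<Longrightarrow> y < 2 ^ k \<Longrightarrow> x * y < (2 :: nat) ^ (j + k)"
  by (simp add: power_add mult_strict_mono)

lemma lt_padd1: "x < 2 ^ k \<Longrightarrow> lt k ys \<Longrightarrow> lt (Suc k) (padd [x] ys)"
  using lt_padd[of k "[x]" ys] by simp

lemma hor_bound:
  assumes "y0 < 2 ^ k" "pb k T"
  shows "pb ((2 * k + 1) * n + 1) (fst (hor n y0 T)) \<and> pb ((2 * k + 1) * n + 1) (fst (snd (hor n y0 T))) \<and>
    snd (snd (hor n y0 T)) < 2 ^ (k * n + 1)"
proof (induction n)
  case 0
  show ?case by (simp add: pb_def)
next
  case (Suc n)
  define j where "j = (2 * k + 1) * n + 1"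
  define y where "y = snd (snd (hor (Suc n) y0 T))"
  have y: "y < 2 ^ (k * Suc n + 1)"
    using less_pow2_mult[OF assms(1) Suc[THEN conjunct2, THEN conjunct2]] by (simp add: y_def Let_def algebra_simps)
  have m: "pb (2 * k + j) (pmul T (fst (hor n y0 T)))" "pb (2 * k + j) (pmul T (fst (snd (hor n y0 T))))"
    using Suc unfolding j_def by (intro pb_pmul[OF assms(2)]; blast)+
  have s: "(2 * k + 1) * Suc n + 1 = Suc (2 * k + j)" by (simp add: j_def)
  have "k * Suc n + 1 \<le> 2 * k + j" by (simp add: j_def algebra_simps)
  then have "y < 2 ^ (2 * k + j)" using y by (rule less_pow2_mono[rotated])
  then have "pb (Suc (2 * k + j)) (padd [y] (pmul T (fst (snd (hor n y0 T)))))"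
    using lt_padd1[of y "2 * k + j"] m(2) by (auto simp: pb_def length_padd j_def)
  then show ?case unfolding s using y pb_mono[OF m(1), of "Suc (2 * k + j)"] by (simp add: Let_def y_def)
qed

lemma alt_bound: "lt k A \<Longrightarrow> lt k B \<Longrightarrow> fst (alt n A B) < 2 ^ (k + n) \<and> snd (alt n A B) < 2 ^ (k + n)"
proof (induction n arbitrary: A B)
  case (Suc n)
  have "lt k (tl A)" "lt k (tl B)" using Suc.prems by (cases A; cases B; simp)+
  from Suc.IH[OF this] have IH: "fst (alt n (tl A) (tl B)) < 2 ^ (k + n)" "snd (alt n (tl A) (tl B)) < 2 ^ (k + n)" by auto
  have "h0 A < 2 ^ (k + n)" "h0 B < 2 ^ (k + n)" using h0_less[OF Suc.prems(1)] h0_less[OF Suc.prems(2)] less_pow2_mono by fastforce+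
  with IH show ?case by (simp add: Let_def)
qed simp

context lisp
begin

definition Thor :: "nat \<Rightarrow> nat" where "Thor W = W * (Tmul W + 2 * Tpmul W + Tpadd W + 100) + 50"

lemma fn_hor:
  assumes y0: "y0 < 2 ^ k" and T: "pb k T" and W: "(2 * k + 1) * (spine f + 1) + 2 \<le> W"
  shows "returns 11 (Node f (Node (enc_nat y0) (encp T)))
    (Node (encp (fst (hor (spine f) y0 T))) (Node (encp (fst (snd (hor (spine f) y0 T)))) (enc_nat (snd (snd (hor (spine f) y0 T))))))
    (Thor W)"
proof -
  define d where "d = Tmul W + 2 * Tpmul W + Tpadd W + 100"
  have "(2 * k + 1) * (spine f + 1) + 2 \<le> W \<Longrightarrow> returns 11 (Node f (Node (enc_nat y0) (encp T)))
    (Node (encp (fst (hor (spine f) y0 T))) (Node (encp (fst (snd (hor (spine f) y0 T)))) (enc_nat (snd (snd (hor (spine f) y0 T))))))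
    (spine f * d + 50)"
  proof (induction f)
    case Atom
    show ?case by (simp add: returns_def fn_unfold b_hor_def)
  next
    case (Node f1 f)
    define h where "h = hor (spine f) y0 T"
    define y where "y = y0 * snd (snd h)"
    have hb: "pb ((2 * k + 1) * spine f + 1) (fst h)" "pb ((2 * k + 1) * spine f + 1) (fst (snd h))" "snd (snd h) < 2 ^ (k * spine f + 1)"
      using hor_bound[OF y0 T, of "spine f"] by (auto simp: h_def)
    have W': "2 * k + ((2 * k + 1) * spine f + 1) + 3 \<le> W" using Node.prems by (simp add: algebra_simps)
    then have W2: "(2 * k + 1) * spine f + 1 \<le> W" "k \<le> W" "k * spine f + 1 \<le> W" "k + (k * spine f + 1) \<le> W"
      by (simp_all add: algebra_simps)
    have hW: "pb W (fst h)" "pb W (fst (snd h))" "snd (snd h) < 2 ^ W" "pb W T" "y0 < 2 ^ W"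
      using hb pb_mono[OF _ W2(1)] less_pow2_mono[OF _ W2(3)] pb_mono[OF T W2(2)] less_pow2_mono[OF y0 W2(2)] by auto
    have y: "y < 2 ^ W" using less_pow2_mono[OF less_pow2_mult[OF y0 hb(3)] W2(4)] by (simp add: y_def)
    have "lt (2 * k + ((2 * k + 1) * spine f + 1)) (pmul T (fst (snd h)))" using pb_pmul[OF T hb(2)] by (simp add: pb_def)
    then have lm: "lt W (pmul T (fst (snd h)))" using W' by (elim lt_mono) linarith
    obtain t where t: "t \<le> spine f * d + 50" "fn 11 (Node f (Node (enc_nat y0) (encp T)))
        = Some (Node (encp (fst h)) (Node (encp (fst (snd h))) (enc_nat (snd (snd h)))), t)"
      using Node.IH(2) Node.prems unfolding h_def by (auto elim!: returnsE)
    obtain t1 where t1: "t1 \<le> Tmul W" "fn 3 (Node (enc_nat y0) (enc_nat (snd (snd h)))) = Some (enc_nat y, t1)"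
      using fn_mul[OF hW(3,5)] unfolding y_def by (rule returnsE)
    obtain t2 where t2: "t2 \<le> Tpmul W" "fn 7 (Node (encp T) (encp (fst (snd h)))) = Some (encp (pmul T (fst (snd h))), t2)"
      using fn_pmul[OF hW(4,2)] by (rule returnsE)
    obtain t3 where t3: "t3 \<le> Tpmul W" "fn 7 (Node (encp T) (encp (fst h))) = Some (encp (pmul T (fst h)), t3)"
      using fn_pmul[OF hW(4,1)] by (rule returnsE)
    obtain t4 where t4: "t4 \<le> Tpadd W" "fn 5 (Node (Node (enc_nat y) Atom) (encp (pmul T (fst (snd h))))) = Some (encp (padd [y] (pmul T (fst (snd h)))), t4)"
      using fn_padd[of "[y]" W "pmul T (fst (snd h))"] lm y W' by (auto elim!: returnsE)
    have eq: "hor (spine (Node f1 f)) y0 T = (padd [y] (pmul T (fst (snd h))), pmul T (fst h), y)"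
      by (simp add: h_def y_def Let_def)
    have "\<exists>u \<le> t + t1 + t2 + t3 + t4 + 80. fn 11 (Node (Node f1 f) (Node (enc_nat y0) (encp T))) =
       Some (Node (encp (padd [y] (pmul T (fst (snd h))))) (Node (encp (pmul T (fst h))) (enc_nat y)), u)"
      unfolding fn_unfold(13)[of "Node (Node f1 f) (Node (enc_nat y0) (encp T))"]
      using t(2) t1(2) t2(2) t3(2) t4(2) by (simp add: b_hor_def)
    moreover have "t + t1 + t2 + t3 + t4 + 80 \<le> spine (Node f1 f) * d + 50"
      using t(1) t1(1) t2(1) t3(1) t4(1) by (simp add: d_def)
    ultimately show ?case unfolding eq fst_conv snd_conv returns_def by (meson order_trans)
  qed
  moreover have "spine f \<le> W" using W by (simp add: algebra_simps)
  then have "spine f * d + 50 \<le> Thor W" unfolding Thor_def d_def[symmetric] by simp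
  ultimately show ?thesis using W returns_mono by blast
qed

definition Talt :: "nat \<Rightarrow> nat" where "Talt W = W * (2 * (60 * (2 * W + 1)) + 100) + 50"

lemma fn_alt:
  assumes "lt k A" "lt k B" and W: "k + spine f \<le> W"
  shows "returns 12 (Node f (Node (encp A) (encp B)))
    (Node (enc_nat (fst (alt (spine f) A B))) (enc_nat (snd (alt (spine f) A B)))) (Talt W)"
proof -
  define d where "d = 2 * (60 * (2 * W + 1)) + 100"
  have "lt k A \<Longrightarrow> lt k B \<Longrightarrow> k + spine f \<le> W \<Longrightarrow> returns 12 (Node f (Node (encp A) (encp B)))
    (Node (enc_nat (fst (alt (spine f) A B))) (enc_nat (snd (alt (spine f) A B)))) (spine f * d + 50)"
  proof (induction f arbitrary: A B)
    case Atom
    show ?case by (simp add: returns_def fn_unfold b_alt_def)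
  next
    case (Node f1 f)
    define r where "r = alt (spine f) (tl A) (tl B)"
    have tl: "lt k (tl A)" "lt k (tl B)" using Node.prems by (cases A; cases B; simp)+
    have le: "k + spine f \<le> W" using Node.prems(3) by simp
    have rb: "fst r < 2 ^ W" "snd r < 2 ^ W" using alt_bound[OF tl, of "spine f"] less_pow2_mono[OF _ le] by (auto simp: r_def)
    have hb: "h0 A < 2 ^ W" "h0 B < 2 ^ W"
      using h0_less[OF Node.prems(1)] h0_less[OF Node.prems(2)] less_pow2_mono le by fastforce+
    obtain t where t: "t \<le> spine f * d + 50" "fn 12 (Node f (Node (encp (tl A)) (encp (tl B)))) = Some (Node (enc_nat (fst r)) (enc_nat (snd r)), t)"
      using Node.IH(2)[OF tl le] unfolding r_def by (rule returnsE)
    obtain t1 where t1: "t1 \<le> 60 * (2 * W + 1)" "fn 2 (Node Atom (Node (enc_nat (h0 A)) (enc_nat (snd r)))) = Some (enc_nat (h0 A + snd r), t1)"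
      using fn_add'[OF hb(1) rb(2)] by (rule returnsE)
    obtain t2 where t2: "t2 \<le> 60 * (2 * W + 1)" "fn 2 (Node Atom (Node (enc_nat (h0 B)) (enc_nat (fst r)))) = Some (enc_nat (h0 B + fst r), t2)"
      using fn_add'[OF hb(2) rb(1)] by (rule returnsE)
    have eq: "alt (spine (Node f1 f)) A B = (h0 A + snd r, h0 B + fst r)" by (simp add: r_def Let_def)
    have "\<exists>u \<le> t + t1 + t2 + 80. fn 12 (Node (Node f1 f) (Node (encp A) (encp B))) = Some (Node (enc_nat (h0 A + snd r)) (enc_nat (h0 B + fst r)), u)"
      unfolding fn_unfold(14)[of "Node (Node f1 f) (Node (encp A) (encp B))"] using t(2) t1(2) t2(2) by (simp add: b_alt_def)
    moreover have "t + t1 + t2 + 80 \<le> spine (Node f1 f) * d + 50" using t(1) t1(1) t2(1) by (simp add: d_def)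
    ultimately show ?case unfolding eq fst_conv snd_conv returns_def by (meson order_trans)
  qed
  moreover have "spine f * d + 50 \<le> Talt W" using W unfolding Talt_def d_def[symmetric] by simp
  ultimately show ?thesis using assms returns_mono by blast
qed

definition Ttay :: "nat \<Rightarrow> nat" where
  "Ttay W = Thor W + Talt W + 2 * Tpmul W + Tmul W + 60 * (2 * W + 1) + 60 * (W + 1) + 300"

lemma fn_tay:
  assumes X: "pb k X" and Y: "pb k Y" and k: "1 \<le> k" and W: "4 * (k + 1) * (spine f + 2) \<le> W" and ok: "tay_ok (spine f) (X, Y)"
  shows "returns 13 (Node f (Node (encp X) (encp Y)))
     (Node (enc_nat (fst (tay (spine f) (X, Y)))) (enc_nat (snd (tay (spine f) (X, Y))))) (Ttay W) \<and>
    fst (tay (spine f) (X, Y)) < 2 ^ W \<and> snd (tay (spine f) (X, Y)) < 2 ^ W"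
proof -
  define n where "n = spine f"
  define y0 where "y0 = h0 Y"
  define T where "T = 0 # tl Y"
  define h where "h = hor n y0 T"
  define E where "E = fst h"
  define F where "F = fst (snd h)"
  define y where "y = snd (snd h)"
  define s where "s = alt (Suc n) (pmul X E) (pmul X F)"
  define d where "d = y0 * y"
  define j where "j = (2 * k + 1) * n + 1"
  have y0: "y0 < 2 ^ k" using h0_less Y by (auto simp: y0_def pb_def)
  have T: "pb k T" using Y k by (cases Y) (auto simp: T_def pb_def)
  have hb: "pb j E" "pb j F" "y < 2 ^ (k * n + 1)" using hor_bound[OF y0 T, of n] by (auto simp: E_def F_def y_def h_def j_def)
  have m: "lt (2 * k + j) (pmul X E)" "lt (2 * k + j) (pmul X F)" using lt_pmul[OF X] hb by (auto simp: pb_def)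
  have sb: "fst s < 2 ^ (2 * k + j + Suc n)" "snd s < 2 ^ (2 * k + j + Suc n)" using alt_bound[OF m, of "Suc n"] by (auto simp: s_def)
  have d: "d < 2 ^ (k + (k * n + 1))" using less_pow2_mult[OF y0 hb(3)] by (simp add: d_def)
  have W': "4 * k * n + 8 * k + 4 * n + 8 \<le> W" using W by (simp add: n_def algebra_simps)
  have W2: "(2 * k + 1) * (n + 1) + 2 \<le> W" "2 * k + j + Suc n \<le> W - 1" "k + (k * n + 1) \<le> W - 1" "k \<le> W" "j \<le> W" "k * n + 1 \<le> W"
    using W' by (simp_all add: j_def algebra_simps)
  \<comment> \<open>One bit is kept in reserve for the carry of \<open>d + fst s\<close>.\<close>
  have W0: "W = Suc (W - 1)" using W' by simp
  have sW: "fst s < 2 ^ (W - 1)" "snd s < 2 ^ (W - 1)" "d < 2 ^ (W - 1)"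
    using less_pow2_mono[OF sb(1) W2(2)] less_pow2_mono[OF sb(2) W2(2)] less_pow2_mono[OF d W2(3)] by auto
  have dsW: "d + fst s < 2 ^ W" using sW by (subst W0) simp
  have dW: "d < 2 ^ W" "fst s < 2 ^ W" "y0 < 2 ^ W" "y < 2 ^ W"
    using dsW less_pow2_mono[OF y0 W2(4)] less_pow2_mono[OF hb(3) W2(6)] by auto
  have ok': "snd s \<le> d + fst s"
    using ok unfolding tay_ok_def Let_def fst_conv snd_conv n_def[symmetric] y0_def[symmetric] T_def[symmetric] h_def[symmetric]
      E_def[symmetric] F_def[symmetric] y_def[symmetric] s_def[symmetric] d_def[symmetric] .
  have eq: "tay (spine f) (X, Y) = (d + fst s - snd s, d)"
    unfolding tay_def Let_def fst_conv snd_conv n_def[symmetric] y0_def[symmetric] T_def[symmetric] h_def[symmetric]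
      E_def[symmetric] F_def[symmetric] y_def[symmetric] s_def[symmetric] d_def[symmetric] ..
  obtain t1 where t1: "t1 \<le> Thor W" "fn 11 (Node f (Node (enc_nat y0) (Node Atom (encp (tl Y))))) = Some (Node (encp E) (Node (encp F) (enc_nat y)), t1)"
    using fn_hor[OF y0 T W2(1)[unfolded n_def]] unfolding E_def F_def y_def h_def n_def T_def by (auto elim!: returnsE)
  obtain t2 where t2: "t2 \<le> Tpmul W" "fn 7 (Node (encp X) (encp E)) = Some (encp (pmul X E), t2)"
    using fn_pmul[OF pb_mono[OF X W2(4)] pb_mono[OF hb(1) W2(5)]] by (rule returnsE)
  obtain t3 where t3: "t3 \<le> Tpmul W" "fn 7 (Node (encp X) (encp F)) = Some (encp (pmul X F), t3)"
    using fn_pmul[OF pb_mono[OF X W2(4)] pb_mono[OF hb(2) W2(5)]] by (rule returnsE)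
  \<comment> \<open>The program adds one node to the fuel, because degree N means N + 1
    coefficients.\<close>
  have "2 * k + j + spine (Node Atom f) \<le> W" using W2(2) by (simp add: n_def)
  from fn_alt[OF m this] obtain t4 where t4: "t4 \<le> Talt W" "fn 12 (Node (Node Atom f) (Node (encp (pmul X E)) (encp (pmul X F)))) = Some (Node (enc_nat (fst s)) (enc_nat (snd s)), t4)"
    unfolding s_def n_def by (auto elim!: returnsE)
  obtain t5 where t5: "t5 \<le> Tmul W" "fn 3 (Node (enc_nat y0) (enc_nat y)) = Some (enc_nat d, t5)"
    using fn_mul[OF dW(4,3)] unfolding d_def by (rule returnsE)
  obtain t6 where t6: "t6 \<le> 60 * (2 * W + 1)" "fn 2 (Node Atom (Node (enc_nat d) (enc_nat (fst s)))) = Some (enc_nat (d + fst s), t6)"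
    using fn_add'[OF dW(1,2)] by (rule returnsE)
  have "bl (d + fst s) \<le> W" using dsW by (simp add: bl_le)
  then obtain t7 where t7: "t7 \<le> 60 * (W + 1)" "fn 4 (Node Atom (Node (enc_nat (d + fst s)) (enc_nat (snd s)))) = Some (enc_nat (d + fst s - snd s), t7)"
    using fn_sub[of "snd s" False "d + fst s"] ok' by (fastforce elim!: returnsE)
  have "\<exists>u \<le> t1 + t2 + t3 + t4 + t5 + t6 + t7 + 150. fn 13 (Node f (Node (encp X) (encp Y))) = Some (Node (enc_nat (d + fst s - snd s)) (enc_nat d), u)"
    unfolding fn_unfold(15) using t1(2) t2(2) t3(2) t4(2) t5(2) t6(2) t7(2) unfolding y0_def by (simp add: b_tay_def)
  moreover have "t1 + t2 + t3 + t4 + t5 + t6 + t7 + 150 \<le> Ttay W"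
    using t1(1) t2(1) t3(1) t4(1) t5(1) t6(1) t7(1) unfolding Ttay_def by linarith
  ultimately have "returns 13 (Node f (Node (encp X) (encp Y))) (Node (enc_nat (d + fst s - snd s)) (enc_nat d)) (Ttay W)"
    unfolding returns_def by (meson order_trans)
  then show ?thesis unfolding eq fst_conv snd_conv using dsW dW(1) by (auto intro: le_less_trans[OF diff_le_self])
qed

lemma fn_deloop: "lsz W es \<Longrightarrow> returns 14 (ence es) (ence (deloop es)) (length es * (Teq W + 80) + 10)"
proof (induction es)
  case Nil
  show ?case by (simp add: returns_def fn_unfold b_deloop_def)
next
  case (Cons e es)
  obtain t where t: "t \<le> length es * (Teq W + 80) + 10" "fn 14 (ence es) = Some (ence (deloop es), t)"
    using Cons by (auto elim!: returnsE)
  obtain t1 where t1: "t1 \<le> Teq W" "fn (Suc 0) (Node (fst e) (snd e)) = Some (enc_bit (fst e = snd e), t1)"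
    using fn_eq'[of "fst e" W "snd e"] Cons.prems by (auto elim!: returnsE)
  have "\<exists>u \<le> t + t1 + 80. fn 14 (ence (e # es)) = Some (ence (deloop (e # es)), u)"
    unfolding fn_unfold(16)[of "ence (e # es)"] using t(2) t1(2) by (cases "fst e = snd e") (simp_all add: b_deloop_def)
  moreover have "t + t1 + 80 \<le> length (e # es) * (Teq W + 80) + 10" using t(1) t1(1) by simp
  ultimately show ?case unfolding returns_def by (meson order_trans)
qed

lemma fn_ebase:
  assumes c: "p < 2 ^ c" "q < 2 ^ c"
  shows "c * length es + c + 1 \<le> W \<Longrightarrow> returns 15 (ence es) (Node (enc_nat (fst (ebase p q es))) (enc_nat (snd (ebase p q es))))
    (length es * (2 * Tmul W + 8 * c + 60) + 20) \<and>
    fst (ebase p q es) < 2 ^ (c * length es + 1) \<and> snd (ebase p q es) < 2 ^ (c * length es + 1)"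
proof (induction es)
  case Nil
  show ?case by (simp add: returns_def fn_unfold b_ebase_def)
next
  case (Cons e es)
  define r where "r = ebase p q es"
  have W: "c * length es + 1 \<le> W" "c \<le> W" using Cons.prems by (simp_all add: algebra_simps)
  obtain t where t: "t \<le> length es * (2 * Tmul W + 8 * c + 60) + 20" "fn 15 (ence es) = Some (Node (enc_nat (fst r)) (enc_nat (snd r)), t)"
    using Cons unfolding r_def by (auto elim!: returnsE simp: algebra_simps)
  have b: "fst r < 2 ^ (c * length es + 1)" "snd r < 2 ^ (c * length es + 1)"
    using Cons unfolding r_def by (auto simp: algebra_simps)
  obtain t1 where t1: "t1 \<le> Tmul W" "fn 3 (Node (enc_nat p) (enc_nat (fst r))) = Some (enc_nat (p * fst r), t1)"
    using fn_mul[OF less_pow2_mono[OF b(1) W(1)] less_pow2_mono[OF c(1) W(2)]] by (rule returnsE)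
  obtain t2 where t2: "t2 \<le> Tmul W" "fn 3 (Node (enc_nat q) (enc_nat (snd r))) = Some (enc_nat (q * snd r), t2)"
    using fn_mul[OF less_pow2_mono[OF b(2) W(1)] less_pow2_mono[OF c(2) W(2)]] by (rule returnsE)
  have b': "p * fst r < 2 ^ (c * length (e # es) + 1)" "q * snd r < 2 ^ (c * length (e # es) + 1)"
    using less_pow2_mult[OF c(1) b(1)] less_pow2_mult[OF c(2) b(2)] by (simp_all add: algebra_simps)
  have "\<exists>u \<le> t + t1 + t2 + 2 * size (enc_nat p) + 2 * size (enc_nat q) + 60. fn 15 (ence (e # es)) = Some (Node (enc_nat (p * fst r)) (enc_nat (q * snd r)), u)"
    unfolding fn_unfold(17)[of "ence (e # es)"] using t(2) t1(2) t2(2) by (simp add: b_ebase_def)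
  moreover have "t + t1 + t2 + 2 * size (enc_nat p) + 2 * size (enc_nat q) + 60 \<le> length (e # es) * (2 * Tmul W + 8 * c + 60) + 20"
    using t(1) t1(1) t2(1) size_const[OF c(1)] size_const[OF c(2)] by simp
  ultimately have "returns 15 (ence (e # es)) (Node (enc_nat (p * fst r)) (enc_nat (q * snd r))) (length (e # es) * (2 * Tmul W + 8 * c + 60) + 20)"
    unfolding returns_def by (meson order_trans)
  then show ?case using b' by (simp add: r_def)
qed

end

lemma dgb_rsub_Nil: "dgb D es \<Longrightarrow> dgb D (rsub v pin0 es [])"
  using dgb_rsub[of D "[]" es v] by simp

lemma bl_le_self: "bl n \<le> n"
  by (simp add: bl_le)

lemma spine_replicate: "spine ((Node Atom ^^ n) d) = n + spine d"
  by (induction n) auto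

context lisp
begin

text \<open>Each vertex multiplies numerator and denominator by numbers below 2^W2, so the bit
  length of the product grows linearly in the number of vertices.\<close>

lemma fn_vloop:
  assumes c: "p < 2 ^ c" "q < 2 ^ c" "a < 2 ^ c" and D: "D \<ge> 1" and W3: "3 \<le> W"
    and W: "3 * (ch D c (spine f) + c) + 2 \<le> W" "ch D c (Suc (spine f)) \<le> W"
    and bs: "fst bs < 2 ^ B" "snd bs < 2 ^ B" and W2: "4 * (W + 1) * (spine f + 2) = W2"
  shows "dgb D es \<Longrightarrow> lsz W es \<Longrightarrow> length es \<le> W \<Longrightarrow> \<forall>v \<in> set vs. size v \<le> W \<and> v \<noteq> pin0 \<and> v \<noteq> pin1 \<Longrightarrow>
    vloop_ok p q a (spine f) vs es \<Longrightarrow> length vs * W2 + B \<le> V \<Longrightarrow>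
    returns 16 (Node f (Node (Node (enc_nat (fst bs)) (enc_nat (snd bs))) (Node (enc_list vs) (ence es))))
      (Node (enc_nat (fst (vloop p q a (spine f) bs vs es))) (enc_nat (snd (vloop p q a (spine f) bs vs es))))
      (length vs * (Tc W D (Suc (spine f)) + Ttay W2 + Trsub W W + 2 * Tmul V + 300) + 100) \<and>
    fst (vloop p q a (spine f) bs vs es) < 2 ^ (length vs * W2 + B) \<and> snd (vloop p q a (spine f) bs vs es) < 2 ^ (length vs * W2 + B)"
proof (induction vs arbitrary: es)
  case Nil
  show ?case using bs by (simp add: returns_def fn_unfold b_vloop_def)
next
  case (Cons v vs)
  define N where "N = spine f"
  define d where "d = Tc W D (Suc N) + Ttay W2 + Trsub W W + 2 * Tmul V + 300"
  define es' where "es' = rsub v pin0 es []"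
  define X where "X = go p q a N v [] es"
  define s where "s = tay N X"
  define r where "r = vloop p q a N bs vs es'"
  have v: "size v \<le> W" "v \<noteq> pin0" "v \<noteq> pin1" and vs: "\<forall>v \<in> set vs. size v \<le> W \<and> v \<noteq> pin0 \<and> v \<noteq> pin1"
    using Cons.prems(4) by auto
  have ok: "tay_ok N X" "vloop_ok p q a N vs es'" using Cons.prems(5) by (simp_all add: X_def N_def es'_def)
  have V: "length vs * W2 + B \<le> V" "W2 \<le> V" "W2 + (length vs * W2 + B) \<le> V" using Cons.prems(6) by simp_all
  have es': "dgb D es'" "lsz W es'" "length es' \<le> W"
    using Cons.prems W3 by (auto simp: es'_def length_rsub intro!: dgb_rsub_Nil lsz_rsub)
  have "dgr v es \<le> D" using Cons.prems(1) v by (simp add: dgb_def)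
  then have "1 + dgr v es * (6 * ch D c N + 6 * c + 4) \<le> ch D c (Suc N)" by simp
  then have bW: "1 + dgr v es * (6 * ch D c N + 6 * c + 4) \<le> W" using W(2) unfolding N_def by linarith
  have Xb: "pb W (fst X)" "pb W (snd X)" using go_pb[OF c D, of "[]" es v N] Cons.prems(1) pb_mono[OF _ bW] unfolding X_def by auto
  obtain t1 where t1: "t1 \<le> Tc W D (Suc N)" "fn 10 (Node f (Node v (Node Atom (ence es)))) = Some (Node (encp (fst X)) (encp (snd X)), t1)"
    using fn_go[OF c D W3 W v Cons.prems(1-3)] unfolding X_def N_def by (rule returnsE)
  have ty: "returns 13 (Node f (Node (encp (fst X)) (encp (snd X)))) (Node (enc_nat (fst s)) (enc_nat (snd s))) (Ttay W2) \<and> fst s < 2 ^ W2 \<and> snd s < 2 ^ W2"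
    using fn_tay[OF Xb, of f W2] W3 W2 ok(1) by (simp add: s_def N_def)
  then obtain t2 where t2: "t2 \<le> Ttay W2" "fn 13 (Node f (Node (encp (fst X)) (encp (snd X)))) = Some (Node (enc_nat (fst s)) (enc_nat (snd s)), t2)"
    by (auto elim: returnsE)
  have IH: "returns 16 (Node f (Node (Node (enc_nat (fst bs)) (enc_nat (snd bs))) (Node (enc_list vs) (ence es'))))
      (Node (enc_nat (fst r)) (enc_nat (snd r))) (length vs * d + 100) \<and> fst r < 2 ^ (length vs * W2 + B) \<and> snd r < 2 ^ (length vs * W2 + B)"
    using Cons.IH[OF es' vs] ok(2) V(1) unfolding r_def N_def d_def by blast
  then obtain t3 where t3: "t3 \<le> length vs * d + 100" "fn 16 (Node f (Node (Node (enc_nat (fst bs)) (enc_nat (snd bs))) (Node (enc_list vs) (ence es')))) = Some (Node (enc_nat (fst r)) (enc_nat (snd r)), t3)"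
    by (auto elim: returnsE)
  obtain t4 where t4: "t4 \<le> Trsub W (length es)" "fn 8 (Node (Node v pin0) (Node (ence es) Atom)) = Some (ence es', t4)"
    using fn_rsub[OF Cons.prems(2), of v pin0 "[]"] unfolding es'_def ence_simps by (rule returnsE)
  have t4': "t4 \<le> Trsub W W" using t4(1) Trsub_mono[OF Cons.prems(3), of W] by simp
  obtain t5 where t5: "t5 \<le> Tmul V" "fn 3 (Node (enc_nat (fst s)) (enc_nat (fst r))) = Some (enc_nat (fst s * fst r), t5)"
    using fn_mul[of "fst r" V "fst s"] less_pow2_mono[OF _ V(1)] less_pow2_mono[OF _ V(2)] IH ty by (auto elim: returnsE)
  obtain t6 where t6: "t6 \<le> Tmul V" "fn 3 (Node (enc_nat (snd s)) (enc_nat (snd r))) = Some (enc_nat (snd s * snd r), t6)"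
    using fn_mul[of "snd r" V "snd s"] less_pow2_mono[OF _ V(1)] less_pow2_mono[OF _ V(2)] IH ty by (auto elim: returnsE)
  have eq: "vloop p q a (spine f) bs (v # vs) es = (fst s * fst r, snd s * snd r)"
    by (simp add: s_def r_def X_def es'_def N_def Let_def)
  have "\<exists>u \<le> t1 + t2 + t3 + t4 + t5 + t6 + 200. fn 16 (Node f (Node (Node (enc_nat (fst bs)) (enc_nat (snd bs))) (Node (enc_list (v # vs)) (ence es))))
      = Some (Node (enc_nat (fst s * fst r)) (enc_nat (snd s * snd r)), u)"
    unfolding fn_unfold(18)[of "Node f (Node (Node (enc_nat (fst bs)) (enc_nat (snd bs))) (Node (enc_list (v # vs)) (ence es)))"]
    using t1(2) t2(2) t3(2) t4(2) t5(2) t6(2) by (simp add: b_vloop_def)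
  moreover have "t1 + t2 + t3 + t4 + t5 + t6 + 200 \<le> length (v # vs) * d + 100"
    using t1(1) t2(1) t3(1) t4' t5(1) t6(1) by (simp add: d_def)
  ultimately have "returns 16 (Node f (Node (Node (enc_nat (fst bs)) (enc_nat (snd bs))) (Node (enc_list (v # vs)) (ence es))))
     (Node (enc_nat (fst s * fst r)) (enc_nat (snd s * snd r))) (length (v # vs) * d + 100)"
    unfolding returns_def by (meson order_trans)
  moreover have "fst s * fst r < 2 ^ (W2 + (length vs * W2 + B))" "snd s * snd r < 2 ^ (W2 + (length vs * W2 + B))"
    using ty IH by (auto intro: less_pow2_mult)
  ultimately show ?case unfolding eq fst_conv snd_conv d_def N_def by (simp add: add.assoc)
qed

lemma fn_cnt: "returns 17 (enc_list vs) (enc_nat (length vs)) (length vs * (60 * (length vs + 2) + 30) + 10)"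
proof -
  have "length vs \<le> m \<Longrightarrow> returns 17 (enc_list vs) (enc_nat (length vs)) (length vs * (60 * (m + 2) + 30) + 10)" for m
  proof (induction vs)
    case Nil
    show ?case by (simp add: returns_def fn_unfold b_cnt_def)
  next
    case (Cons v vs)
    obtain t where t: "t \<le> length vs * (60 * (m + 2) + 30) + 10" "fn 17 (enc_list vs) = Some (enc_nat (length vs), t)"
      using Cons by (auto elim: returnsE)
    have "returns 2 (Node (enc_bit True) (Node (enc_nat 0) (enc_nat (length vs)))) (enc_nat (0 + length vs + of_bool True)) (60 * (m + 2))"
      using fn_add[of True 0 "length vs"] bl_le_self[of "length vs"] Cons.prems by (elim returns_mono) simp
    then obtain s where s: "s \<le> 60 * (m + 2)" "fn 2 (Node (Node Atom Atom) (Node Atom (enc_nat (length vs)))) = Some (enc_nat (Suc (length vs)), s)"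
      by (auto elim: returnsE)
    have "\<exists>u \<le> t + s + 30. fn 17 (enc_list (v # vs)) = Some (enc_nat (length (v # vs)), u)"
      unfolding fn_unfold(19)[of "enc_list (v # vs)"] using t(2) s(2) by (simp add: b_cnt_def)
    moreover have "t + s + 30 \<le> length (v # vs) * (60 * (m + 2) + 30) + 10" using t(1) s(1) by simp
    ultimately show ?case unfolding returns_def by (meson order_trans)
  qed
  then show ?thesis by blast
qed

lemma fn_ldiff: "\<exists>d. spine d = (spine b - spine x) + 1 + spine y \<and> returns 18 (Node x (Node b y)) d (40 * (spine b + 1))"
proof (induction b arbitrary: x)
  case Atom
  show ?case by (rule exI[of _ "Node Atom y"]) (simp add: returns_def fn_unfold b_ldiff_def)
next
  case (Node b1 b)
  have u: "fn 18 (Node x (Node (Node b1 b) y)) = evr (prog p q a K) [Node x (Node (Node b1 b) y)] b_ldiff" by (rule fn_unfold)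
  obtain d where d: "spine d = (spine b - spine (dsnd x)) + 1 + spine y" "returns 18 (Node (dsnd x) (Node b y)) d (40 * (spine b + 1))"
    using Node.IH(2) by blast
  from d(2) obtain t where t: "t \<le> 40 * (spine b + 1)" "fn 18 (Node (dsnd x) (Node b y)) = Some (d, t)" by (rule returnsE)
  show ?case
  proof (cases x)
    case Atom
    have "\<exists>s \<le> t + 40. fn 18 (Node x (Node (Node b1 b) y)) = Some (Node Atom d, s)" unfolding u using t(2) Atom by (simp add: b_ldiff_def)
    then show ?thesis using t(1) d(1) Atom by (intro exI[of _ "Node Atom d"]) (auto simp: returns_def)
  next
    case (Node x1 x2)
    have "\<exists>s \<le> t + 40. fn 18 (Node x (Node (Node b1 b) y)) = Some (d, s)" unfolding u using t(2) Node by (simp add: b_ldiff_def)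
    then show ?thesis using t(1) d(1) Node by (intro exI[of _ d]) (auto simp: returns_def)
  qed
qed

lemma fn_stretch: "\<exists>d. spine d = K * spine x \<and> returns 19 x d (spine x * (2 * K + 20) + 10)"
proof (induction x)
  case Atom
  show ?case by (rule exI[of _ Atom]) (simp add: returns_def fn_unfold b_stretch_def)
next
  case (Node x1 x)
  obtain d where d: "spine d = K * spine x" "returns 19 x d (spine x * (2 * K + 20) + 10)" using Node.IH(2) by blast
  from d(2) obtain t where t: "t \<le> spine x * (2 * K + 20) + 10" "fn 19 x = Some (d, t)" by (rule returnsE)
  have n: "evr (prog p q a K) [Node x1 x] (nest K (ECall 19 (ESnd (EVar 0)))) = Some ((Node Atom ^^ K) d, t + 3 + 2 * K)"
    by (rule evr_nest) (simp add: t(2))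
  have "\<exists>s \<le> t + 2 * K + 20. fn 19 (Node x1 x) = Some ((Node Atom ^^ K) d, s)"
    unfolding fn_unfold(21) using n by (simp add: b_stretch_def)
  then show ?case using t(1) d(1) by (intro exI[of _ "(Node Atom ^^ K) d"]) (auto simp: returns_def spine_replicate)
qed

end

section \<open>Polynomially bounded functions, closed under sums and products\<close>

definition pbd :: "(nat \<Rightarrow> nat) \<Rightarrow> bool" where
  "pbd f \<longleftrightarrow> (\<exists>C k. \<forall>x \<ge> 1. f x \<le> C * x ^ k)"

lemma pbd_const: "pbd (\<lambda>_. c)"
  unfolding pbd_def by (intro exI[of _ c] exI[of _ 0]) simp

lemma pbd_id: "pbd (\<lambda>x. x)"
  unfolding pbd_def by (intro exI[of _ 1] exI[of _ 1]) simp

lemma pbd_add: assumes "pbd f" "pbd h" shows "pbd (\<lambda>x. f x + h x)"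
proof -
  obtain C k C' k' where *: "\<And>x. x \<ge> 1 \<Longrightarrow> f x \<le> C * x ^ k" "\<And>x. x \<ge> 1 \<Longrightarrow> h x \<le> C' * x ^ k'"
    using assms unfolding pbd_def by blast
  have "f x + h x \<le> (C + C') * x ^ (k + k')" if "x \<ge> 1" for x
  proof -
    have "C * x ^ k \<le> C * x ^ (k + k')" "C' * x ^ k' \<le> C' * x ^ (k + k')"
      using that by (auto intro!: mult_le_mono2 power_increasing)
    then show ?thesis using *[OF that] unfolding add_mult_distrib by linarith
  qed
  then show ?thesis unfolding pbd_def by blast
qed

lemma pbd_mult: assumes "pbd f" "pbd h" shows "pbd (\<lambda>x. f x * h x)"
proof -
  obtain C k C' k' where *: "\<And>x. x \<ge> 1 \<Longrightarrow> f x \<le> C * x ^ k" "\<And>x. x \<ge> 1 \<Longrightarrow> h x \<le> C' * x ^ k'"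
    using assms unfolding pbd_def by blast
  have "f x * h x \<le> (C * C') * x ^ (k + k')" if "x \<ge> 1" for x
    using mult_le_mono[OF *(1)[OF that] *(2)[OF that]] by (simp add: power_add algebra_simps)
  then show ?thesis unfolding pbd_def by blast
qed

lemmas pbd_intros = pbd_const pbd_id pbd_add pbd_mult

lemma length_deloop: "length (deloop es) \<le> 2 * length es"
  by (induction es) auto

lemma lsz_deloop: "lsz W es \<Longrightarrow> 3 \<le> W \<Longrightarrow> lsz W (deloop es)"
  by (induction es) auto

context lisp
begin

lemma Ttay_mono: assumes "W \<le> W'" shows "Ttay W \<le> Ttay W'"
  unfolding Ttay_def Thor_def Talt_def using assms
  by (intro add_le_mono mult_le_mono Tmul_mono Tpmul_mono Tpadd_mono order_refl)

definition VV :: "nat \<Rightarrow> nat" where "VV x = x * (4 * (5 * x + 1) * x) + (x * x + x + 1)"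

definition Tmain :: "nat \<Rightarrow> nat" where
  "Tmain x = (x * (60 * (x + 2) + 30) + 10) + 40 * (x + 1) + (x * (2 * x + 20) + 10) + (x * (Teq (5 * x) + 80) + 10)
    + (x * (2 * Tmul (VV x) + 8 * x + 60) + 20)
    + (x * ((60 + 5 * x * KK (5 * x)) * x + Ttay (VV x) + Trsub (5 * x) (5 * x) + 2 * Tmul (VV x) + 300) + 100) + 200"

lemma pbd_Tmain: "pbd Tmain"
proof -
  note T = Tmul_def Tpadd_def Tpscale_def Tpmul_def Teq_def Trsub_def Tpfac_def
  have Tmul: "pbd (\<lambda>x. Tmul (f x))" and Tpadd: "pbd (\<lambda>x. Tpadd (f x))" if "pbd f" for f
    unfolding T by (intro pbd_intros that)+
  have Tpscale: "pbd (\<lambda>x. Tpscale (f x))" if "pbd f" for f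
    unfolding Tpscale_def by (intro pbd_intros Tmul that)
  have Tpmul: "pbd (\<lambda>x. Tpmul (f x))" if "pbd f" for f
    unfolding Tpmul_def by (intro pbd_intros Tpscale Tpadd that)
  have Tpfac: "pbd (\<lambda>x. Tpfac (f x))" if "pbd f" for f
    unfolding Tpfac_def by (intro pbd_intros Tpscale Tpadd that)
  have Teq: "pbd (\<lambda>x. Teq (f x))" if "pbd f" for f
    unfolding Teq_def by (intro pbd_intros that)
  have Trsub: "pbd (\<lambda>x. Trsub (f x) (f x))" if "pbd f" for f
    unfolding Trsub_def by (intro pbd_intros Teq that)
  have KK: "pbd (\<lambda>x. KK (f x))" if "pbd f" for f
    unfolding KK_def by (intro pbd_intros Teq Trsub Tpfac Tpmul that)
  have Ttay: "pbd (\<lambda>x. Ttay (f x))" if "pbd f" for f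
    unfolding Ttay_def Thor_def Talt_def by (intro pbd_intros Tmul Tpmul Tpadd that)
  have VV: "pbd VV"
    unfolding VV_def by (intro pbd_intros)
  have "pbd (\<lambda>x. Tmain x)"
    unfolding Tmain_def
    by (intro pbd_add pbd_mult pbd_const pbd_id Teq Tmul[OF VV] Ttay[OF VV] KK Trsub)
  then show ?thesis .
qed

text \<open>The number \<open>x\<close> dominates the input size, the sizes of all coefficient lists
  and the bound (D + 1)^(N + 1) for the recursion. Every cost is then polynomial in
  \<open>x\<close>, and the exponential dependence on the fuel sits in \<open>x\<close>
  alone.\<close>

lemma fn_main:
  assumes c: "p < 2 ^ c" "q < 2 ^ c" "a < 2 ^ c" and D: "D \<ge> 1" and K: "K \<ge> 1"
    and L: "L = (bl B - bl A) + 1 + bl (length vs)"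
    and S: "\<forall>v \<in> set vs. size v \<le> S" "lsz S es" "length vs \<le> S" "length es \<le> S" "bl B \<le> S" "3 \<le> S"
    and pins: "pin0 \<notin> set vs" "pin1 \<notin> set vs"
    and dg: "dgb D (deloop es)" and ok: "vloop_ok p q a (K * L) vs (deloop es)"
    and x: "(6 * D + 6 * c + 5) ^ (K * L + 2) * (S + 1) \<le> x"
  defines "V \<equiv> vloop p q a (K * L) (ebase p q es) vs (deloop es)"
  shows "returns 0 (Node (Node (enc_list vs) (ence es)) (Node (Node z (enc_nat A)) (enc_nat B)))
    (Node (Node Atom (enc_nat (fst V))) (enc_nat (snd V))) (Tmain x)"
proof -
  define N where "N = K * L"
  define Q where "Q = (6 * D + 6 * c + 5) ^ (N + 2)"
  define W where "W = 5 * x"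
  define W2 where "W2 = 4 * (W + 1) * (N + 2)"
  have Q1: "Q \<ge> 1" by (simp add: Q_def)
  have xQ: "Q \<le> x" "S \<le> x"
  proof -
    have "Q * 1 \<le> Q * (S + 1)" "1 * S \<le> Q * (S + 1)" using Q1 by (intro mult_le_mono; simp)+
    then show "Q \<le> x" "S \<le> x" using x unfolding Q_def N_def by linarith+
  qed
  have bQ: "6 * D + 6 * c + 5 \<le> Q" unfolding Q_def by (rule self_le_power) auto
  have cx: "c \<le> x" "6 * c + 5 \<le> x" using bQ xQ by linarith+
  have NQ: "N + 2 \<le> Q"
  proof -
    have "N + 2 \<le> 2 ^ (N + 2)" using less_exp[of "N + 2"] by (rule less_imp_le)
    also have "\<dots> \<le> Q" unfolding Q_def by (rule power_mono) auto
    finally show ?thesis .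
  qed
  have LN: "L \<le> N" "K \<le> N"
    using mult_le_mono1[OF K, of L] mult_le_mono2[of 1 L K] by (simp_all add: N_def L)
  have Lx: "L \<le> x" "K \<le> x" "N + 2 \<le> x" using LN NQ xQ by linarith+
  have DQ: "(D + 1) ^ Suc N \<le> x"
  proof -
    have "(D + 1) ^ Suc N \<le> (6 * D + 6 * c + 5) ^ Suc N" by (rule power_mono) auto
    also have "\<dots> \<le> Q" unfolding Q_def by (rule power_increasing) auto
    finally show ?thesis using xQ by linarith
  qed
  have chQ: "ch D c N \<le> Q" "ch D c (Suc N) \<le> Q"
    using ch_bound[of D c "Suc N"] ch_Suc_le[OF D, of c N] unfolding Q_def by (auto intro: order_trans)
  have QW: "Q \<le> W" using xQ by (simp add: W_def)
  have W: "3 * (ch D c N + c) + 2 \<le> W" "ch D c (Suc N) \<le> W" "3 \<le> W"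
  proof -
    have "3 * ch D c N + (3 * c + 2) \<le> 3 * x + x" using chQ(1) xQ(1) cx(2) by (intro add_mono) auto
    then show "3 * (ch D c N + c) + 2 \<le> W" unfolding W_def by simp
    show "ch D c (Suc N) \<le> W" using chQ(2) QW by (rule order_trans)
    show "3 \<le> W" using S(6) xQ(2) unfolding W_def by linarith
  qed
  have SW: "S \<le> W" using xQ unfolding W_def by simp
  have lW: "lsz W es" using S(2) SW unfolding lsz_def by (meson order_trans)
  have dW: "lsz W (deloop es)" using lsz_deloop[OF lW W(3)] .
  have dl: "length (deloop es) \<le> W" using length_deloop[of es] S(4) xQ unfolding W_def by linarith
  have vsW: "\<forall>v \<in> set vs. size v \<le> W \<and> v \<noteq> pin0 \<and> v \<noteq> pin1" using S(1) SW pins by (auto intro: order_trans)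
  have m: "length es \<le> x" "length vs \<le> x" "bl B \<le> x" using S xQ by linarith+
  have cm: "c * length es \<le> x * x" using cx m by (intro mult_le_mono)
  have W2x: "W2 \<le> 4 * (5 * x + 1) * x" unfolding W2_def W_def using Lx by (intro mult_le_mono) auto
  have nW2: "length vs * W2 \<le> x * (4 * (5 * x + 1) * x)" using m W2x by (intro mult_le_mono)
  have V1: "c * length es + c + 1 \<le> VV x" using cm cx unfolding VV_def by linarith
  have V2: "length vs * W2 + (c * length es + 1) \<le> VV x" using cm nW2 unfolding VV_def by linarith
  have x1: "x \<ge> 1" using Q1 xQ by linarith
  have W2V: "W2 \<le> VV x"
  proof -
    have "1 * W2 \<le> x * (4 * (5 * x + 1) * x)" using W2x x1 by (intro mult_le_mono)
    then show ?thesis unfolding VV_def by linarith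
  qed
  obtain t1 where t1: "t1 \<le> length vs * (60 * (length vs + 2) + 30) + 10" "fn 17 (enc_list vs) = Some (enc_nat (length vs), t1)"
    using fn_cnt by (rule returnsE)
  obtain d where d: "spine d = L" "returns 18 (Node (enc_nat A) (Node (enc_nat B) (enc_nat (length vs)))) d (40 * (bl B + 1))"
    using fn_ldiff[of "enc_nat B" "enc_nat A" "enc_nat (length vs)"] by (auto simp: L)
  from d(2) obtain t2 where t2: "t2 \<le> 40 * (bl B + 1)" "fn 18 (Node (enc_nat A) (Node (enc_nat B) (enc_nat (length vs)))) = Some (d, t2)"
    by (rule returnsE)
  obtain f where f: "spine f = N" "returns 19 d f (L * (2 * K + 20) + 10)" using fn_stretch[of d] by (auto simp: d N_def)
  from f(2) obtain t3 where t3: "t3 \<le> L * (2 * K + 20) + 10" "fn 19 d = Some (f, t3)" by (rule returnsE)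
  obtain t4 where t4: "t4 \<le> length es * (Teq W + 80) + 10" "fn 14 (ence es) = Some (ence (deloop es), t4)"
    using fn_deloop[OF lW] by (rule returnsE)
  note eb = fn_ebase[OF c(1,2) V1]
  obtain t5 where t5: "t5 \<le> length es * (2 * Tmul (VV x) + 8 * c + 60) + 20" "fn 15 (ence es) = Some (Node (enc_nat (fst (ebase p q es))) (enc_nat (snd (ebase p q es))), t5)"
    using eb by (auto elim: returnsE)
  have W2f: "4 * (W + 1) * (spine f + 2) = W2" by (simp add: W2_def f)
  have vl: "returns 16 (Node f (Node (Node (enc_nat (fst (ebase p q es))) (enc_nat (snd (ebase p q es)))) (Node (enc_list vs) (ence (deloop es)))))
      (Node (enc_nat (fst V)) (enc_nat (snd V)))
      (length vs * (Tc W D (Suc N) + Ttay W2 + Trsub W W + 2 * Tmul (VV x) + 300) + 100)"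
    using fn_vloop[OF c D W(3), of f "ebase p q es" "c * length es + 1" W2 "deloop es" vs "VV x"]
      W(1,2) eb W2f dg dW dl vsW ok V2 unfolding f(1) V_def N_def by blast
  then obtain t6 where t6: "t6 \<le> length vs * (Tc W D (Suc N) + Ttay W2 + Trsub W W + 2 * Tmul (VV x) + 300) + 100"
    "fn 16 (Node f (Node (Node (enc_nat (fst (ebase p q es))) (enc_nat (snd (ebase p q es)))) (Node (enc_list vs) (ence (deloop es)))))
      = Some (Node (enc_nat (fst V)) (enc_nat (snd V)), t6)" by (rule returnsE)
  have "\<exists>u \<le> t1 + t2 + t3 + t4 + t5 + t6 + 200. fn 0 (Node (Node (enc_list vs) (ence es)) (Node (Node z (enc_nat A)) (enc_nat B)))
     = Some (Node (Node Atom (enc_nat (fst V))) (enc_nat (snd V)), u)"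
    unfolding fn_unfold(1) using t1(2) t2(2) t3(2) t4(2) t5(2) t6(2) by (simp add: b_main_def)
  moreover have "t1 + t2 + t3 + t4 + t5 + t6 + 200 \<le> Tmain x"
  proof -
    have "t1 \<le> x * (60 * (x + 2) + 30) + 10"
      by (rule order_trans[OF t1(1)]) (intro add_le_mono mult_le_mono m order_refl)
    moreover have "t2 \<le> 40 * (x + 1)"
      by (rule order_trans[OF t2(1)]) (intro add_le_mono mult_le_mono m order_refl)
    moreover have "t3 \<le> x * (2 * x + 20) + 10"
      by (rule order_trans[OF t3(1)]) (intro add_le_mono mult_le_mono Lx order_refl)
    moreover have "t4 \<le> x * (Teq (5 * x) + 80) + 10"
      by (rule order_trans[OF t4(1)]) (unfold W_def, intro add_le_mono mult_le_mono m order_refl)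
    moreover have "t5 \<le> x * (2 * Tmul (VV x) + 8 * x + 60) + 20"
      by (rule order_trans[OF t5(1)]) (intro add_le_mono mult_le_mono m cx order_refl)
    moreover have "Tc W D (Suc N) \<le> (60 + 5 * x * KK (5 * x)) * x"
      by (rule order_trans[OF Tc_bound]) (unfold W_def, intro mult_le_mono DQ order_refl)
    then have "t6 \<le> x * ((60 + 5 * x * KK (5 * x)) * x + Ttay (VV x) + Trsub (5 * x) (5 * x) + 2 * Tmul (VV x) + 300) + 100"
      by (intro order_trans[OF t6(1)]) (unfold W_def[symmetric], intro add_le_mono mult_le_mono m Ttay_mono W2V order_refl)
    ultimately show ?thesis unfolding Tmain_def by (intro add_le_mono order_refl)
  qed
  ultimately show ?thesis unfolding returns_def by (meson order_trans)
qed

end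

section \<open>Graphs and their encodings\<close>

lemma enc_nat_inj: "enc_nat m = enc_nat n \<Longrightarrow> m = n"
proof (induction m arbitrary: n rule: less_induct)
  case (less m)
  show ?case
  proof (cases "m = 0 \<or> n = 0")
    case True
    then show ?thesis using less.prems enc_nat_Atom by metis
  next
    case False
    then have "enc_bit (odd m) = enc_bit (odd n)" "enc_nat (m div 2) = enc_nat (n div 2)"
      using less.prems by (simp_all add: enc_nat_pos)
    then have "odd m = odd n" "m div 2 = n div 2" using less.IH[of "m div 2" "n div 2"] False
      by (auto simp: enc_bit_def split: if_splits)
    then show ?thesis by (metis bit_eq_rec)
  qed
qed

lemma enc_nat_eq_iff [simp]: "enc_nat m = enc_nat n \<longleftrightarrow> m = n"
  using enc_nat_inj by auto

definition elab :: "(nat \<times> nat) list \<Rightarrow> (data \<times> data) list" where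
  "elab es = map (\<lambda>(u, v). (enc_nat u, enc_nat v)) es"

text \<open>Flipping all spins exchanges the two diagonal entries of the weight matrix.\<close>

lemma Z_swap:
  assumes "wf_mgraph G"
  shows "Z \<beta> \<gamma> G = Z \<gamma> \<beta> G"
proof -
  define flip where "flip \<sigma> = restrict (\<lambda>v. 1 - \<sigma> v) (verts G)" for \<sigma> :: "'a \<Rightarrow> nat"
  have mem: "flip \<sigma> \<in> verts G \<rightarrow>\<^sub>E {0, 1}" for \<sigma>
    unfolding flip_def restrict_PiE_iff by (metis diff_le_self insertI1 insert_iff le_0_eq le_Suc_eq One_nat_def)
  have inv: "flip (flip \<sigma>) = \<sigma>" if s: "\<sigma> \<in> verts G \<rightarrow>\<^sub>E {0, 1}" for \<sigma>
  proof (rule PiE_ext[OF mem s])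
    fix v assume v: "v \<in> verts G"
    then have "\<sigma> v = 0 \<or> \<sigma> v = 1" using PiE_mem[OF s v] by simp
    then show "flip (flip \<sigma>) v = \<sigma> v" using v unfolding flip_def by (elim disjE) simp_all
  qed
  have w: "edge_weight \<gamma> \<beta> (flip \<sigma>) e = edge_weight \<beta> \<gamma> \<sigma> e"
    if s: "\<sigma> \<in> verts G \<rightarrow>\<^sub>E {0, 1}" and e: "e \<in># edges G" for \<sigma> e
  proof -
    obtain u v where uv: "e = Upair u v" using uprod_exhaust by blast
    then have "u \<in> verts G" "v \<in> verts G" using e assms unfolding wf_mgraph_def by auto
    moreover from this have "\<sigma> u = 0 \<or> \<sigma> u = 1" "\<sigma> v = 0 \<or> \<sigma> v = 1" using PiE_mem[OF s] by blast+
    ultimately show ?thesis unfolding uv edge_weight_Upair flip_def by (elim disjE) (simp_all add: spin_matrix_def)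
  qed
  show ?thesis unfolding Z_def
  proof (rule sum.reindex_bij_witness[of _ flip flip])
    fix \<sigma> assume s: "\<sigma> \<in> verts G \<rightarrow>\<^sub>E {0, 1 :: nat}"
    show "(\<Prod>e \<in># edges G. edge_weight \<gamma> \<beta> (flip \<sigma>) e) = (\<Prod>e \<in># edges G. edge_weight \<beta> \<gamma> \<sigma> e)"
      using w[OF s] by (metis (no_types, lifting) image_mset_cong)
  qed (simp_all only: inv mem)
qed

lemma Z_eq_zs:
  fixes \<beta> \<gamma> :: rat
  assumes wf: "wf_mgraph G" and vs: "set vs = verts G"
    and es: "image_mset (\<lambda>(u, v). Upair u v) (mset es) = edges G"
  shows "real_of_rat (Z \<beta> \<gamma> G) = zs (real_of_rat \<beta>) (real_of_rat \<gamma>) (\<lambda>_. 1) (elab es) {} (set (map enc_nat vs))"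
proof -
  have ends: "u \<in> verts G \<and> v \<in> verts G" if "(u, v) \<in> set es" for u v
  proof -
    have "Upair u v \<in># edges G" using that unfolding es[symmetric] by force
    then show ?thesis using wf unfolding wf_mgraph_def by fastforce
  qed
  define ones where "ones \<sigma> = enc_nat ` {v \<in> verts G. \<sigma> v = 1}" for \<sigma> :: "nat \<Rightarrow> nat"
  define spins where "spins S = (\<lambda>v \<in> verts G. if enc_nat v \<in> S then 1 else (0 :: nat))" for S
  have m: "enc_nat v \<in> ones \<sigma> \<longleftrightarrow> \<sigma> v = 1" if "v \<in> verts G" for v \<sigma> using that by (auto simp: ones_def)
  have sp: "spins S \<in> verts G \<rightarrow>\<^sub>E {0, 1}" for S unfolding spins_def restrict_PiE_iff by simp
  have w: "real_of_rat (\<Prod>e \<in># edges G. edge_weight \<beta> \<gamma> \<sigma> e) = wt (real_of_rat \<beta>) (real_of_rat \<gamma>) (\<lambda>_. 1) (elab es) (ones \<sigma>)"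
    if \<sigma>: "\<sigma> \<in> verts G \<rightarrow>\<^sub>E {0, 1}" for \<sigma>
  proof -
    have "real_of_rat (\<Prod>e \<in># edges G. edge_weight \<beta> \<gamma> \<sigma> e) = real_of_rat (\<Prod>(u, v) \<leftarrow> es. edge_weight \<beta> \<gamma> \<sigma> (Upair u v))"
      unfolding es[symmetric] by (simp add: image_mset.compositionality comp_def case_prod_unfold flip: mset_map prod_mset_prod_list)
    also have "\<dots> = (\<Prod>e \<leftarrow> elab es. ew (real_of_rat \<beta>) (real_of_rat \<gamma>) (ones \<sigma>) e)"
      using ends
    proof (induction es)
      case (Cons e es)
      obtain u v where e: "e = (u, v)" by (cases e)
      have uv: "u \<in> verts G" "v \<in> verts G" using Cons.prems[of u v] e by auto
      then have "\<sigma> u = 0 \<or> \<sigma> u = 1" "\<sigma> v = 0 \<or> \<sigma> v = 1" using PiE_mem[OF \<sigma>] by blast+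
      then have "real_of_rat (spin_matrix \<beta> \<gamma> (\<sigma> u) (\<sigma> v)) = ew (real_of_rat \<beta>) (real_of_rat \<gamma>) (ones \<sigma>) (enc_nat u, enc_nat v)"
        unfolding ew_def fst_conv snd_conv m[OF uv(1)] m[OF uv(2)] spin_matrix_def by (elim disjE) simp_all
      moreover have "real_of_rat (\<Prod>(u, v) \<leftarrow> es. edge_weight \<beta> \<gamma> \<sigma> (Upair u v)) = (\<Prod>e \<leftarrow> elab es. ew (real_of_rat \<beta>) (real_of_rat \<gamma>) (ones \<sigma>) e)"
        by (rule Cons.IH) (use Cons.prems in \<open>meson list.set_intros(2)\<close>)
      ultimately show ?case by (simp add: e elab_def of_rat_mult)
    qed (simp add: elab_def)
    finally show ?thesis by (simp add: wt_def)
  qed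
  have "real_of_rat (Z \<beta> \<gamma> G) = (\<Sum>\<sigma> \<in> verts G \<rightarrow>\<^sub>E {0, 1}. wt (real_of_rat \<beta>) (real_of_rat \<gamma>) (\<lambda>_. 1) (elab es) (ones \<sigma>))"
    unfolding Z_def of_rat_sum by (rule sum.cong) (auto simp: w)
  also have "\<dots> = (\<Sum>S \<in> Pow (enc_nat ` verts G). wt (real_of_rat \<beta>) (real_of_rat \<gamma>) (\<lambda>_. 1) (elab es) ({} \<union> S))"
  proof (rule sum.reindex_bij_witness[of _ spins ones])
    fix \<sigma> assume s: "\<sigma> \<in> verts G \<rightarrow>\<^sub>E {0, 1 :: nat}"
    show "spins (ones \<sigma>) = \<sigma>"
    proof (rule PiE_ext[OF _ s])
      show "spins (ones \<sigma>) \<in> verts G \<rightarrow>\<^sub>E {0, 1}" by (rule sp)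
      fix v assume v: "v \<in> verts G"
      then have "\<sigma> v = 0 \<or> \<sigma> v = 1" using PiE_mem[OF s v] by simp
      then show "spins (ones \<sigma>) v = \<sigma> v" using v m[OF v, of \<sigma>] unfolding spins_def by (elim disjE) simp_all
    qed
    show "ones \<sigma> \<in> Pow (enc_nat ` verts G)" by (auto simp: ones_def)
    show "wt (real_of_rat \<beta>) (real_of_rat \<gamma>) (\<lambda>_. 1) (elab es) ({} \<union> ones \<sigma>) = wt (real_of_rat \<beta>) (real_of_rat \<gamma>) (\<lambda>_. 1) (elab es) (ones \<sigma>)"
      by simp
  next
    fix S assume "S \<in> Pow (enc_nat ` verts G)"
    then show "ones (spins S) = S" unfolding ones_def spins_def by (auto split: if_splits)
    show "spins S \<in> verts G \<rightarrow>\<^sub>E {0, 1}" by (rule sp)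
  qed
  finally show ?thesis by (simp add: zs_def vs)
qed

text \<open>\<open>deloop\<close> replaces a loop by two edges to pins, in accordance with the count
  of two in \<open>mdegree\<close>.\<close>

lemma dgr_elab:
  "dgr (enc_nat v) (deloop (elab es))
    = (\<Sum>e \<in># image_mset (\<lambda>(u, v). Upair u v) (mset es). if e = Upair v v then 2 else if v \<in> set_uprod e then 1 else 0)"
  by (induction es) (auto simp: elab_def other_def)

lemma dgr_0: "w \<notin> fst ` set es \<union> snd ` set es \<Longrightarrow> dgr w es = 0"
  by (induction es) (auto simp: other_def)

lemma deloop_ends: "e \<in> set (deloop es) \<Longrightarrow> fst e \<in> fst ` set es \<and> (snd e \<in> {pin0, pin1} \<union> snd ` set es)"
  by (induction es) (auto split: if_splits)

lemma dgb_elab: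
  assumes wf: "wf_mgraph G" and es: "image_mset (\<lambda>(u, v). Upair u v) (mset es) = edges G" and D: "max_degree_le G D"
  shows "dgb D (deloop (elab es))"
  unfolding dgb_def
proof (intro allI impI)
  fix w assume w: "w \<noteq> pin0" "w \<noteq> pin1"
  show "dgr w (deloop (elab es)) \<le> D"
  proof (cases "w \<in> enc_nat ` verts G")
    case True
    then obtain v where "v \<in> verts G" "w = enc_nat v" by auto
    then show ?thesis using D unfolding max_degree_le_def mdegree_def by (simp add: dgr_elab es)
  next
    case False
    have "u \<in> verts G \<and> v \<in> verts G" if "(u, v) \<in> set es" for u v
    proof -
      have "Upair u v \<in># edges G" using that unfolding es[symmetric] by force
      then show ?thesis using wf unfolding wf_mgraph_def by fastforce
    qed
    then have "\<forall>e \<in> set (elab es). fst e \<in> enc_nat ` verts G \<and> snd e \<in> enc_nat ` verts G" by (auto simp: elab_def)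
    then have "w \<notin> fst ` set (deloop (elab es)) \<union> snd ` set (deloop (elab es))"
      using deloop_ends[of _ "elab es"] False w by fastforce
    then show ?thesis by (simp add: dgr_0)
  qed
qed

lemma max_degree_le_length:
  assumes "image_mset (\<lambda>(u, v). Upair u v) (mset es) = edges G"
  shows "max_degree_le G (2 * length es)"
proof -
  have "(\<Sum>e \<in># image_mset (\<lambda>(u, v). Upair u v) (mset es). if e = Upair v v then 2 else if v \<in> set_uprod e then 1 else 0) \<le> 2 * length es" for v :: 'a
    by (induction es) auto
  then show ?thesis unfolding max_degree_le_def mdegree_def assms by blast
qed

section \<open>Input size and the amount of fuel\<close>

lemma enc_list_sizes: "length xs \<le> size (enc_list xs)" "x \<in> set xs \<Longrightarrow> size x \<le> size (enc_list xs)"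
  by (induction xs) auto

lemma spine_le_size: "spine d \<le> size d"
  by (induction d) auto

lemma bl_double: "n > 0 \<Longrightarrow> 2 ^ bl n \<le> 2 * n"
proof -
  assume "n > 0"
  then have b: "bl n = Suc (bl (n div 2))" by (rule bl_pos)
  then have "\<not> bl n \<le> bl (n div 2)" by simp
  then have "2 ^ bl (n div 2) \<le> n" unfolding bl_le by simp
  then show ?thesis by (simp add: b)
qed

lemma bl_gt: "n < 2 ^ bl n"
  using bl_le[of n "bl n"] by simp

text \<open>The fuel \<open>L\<close> is \<open>log (n / \<epsilon>)\<close> up to a constant, for \<open>\<epsilon> = A / B\<close>.\<close>

lemma fuel_bounds:
  fixes A B n :: nat
  assumes A: "A > 0" and B: "B > 0" and L: "L = (bl B - bl A) + 1 + bl n"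
  shows "real n * max 1 (real B / real A) \<le> 2 ^ L"
    and "\<And>S. n \<le> S \<Longrightarrow> real B / real A \<le> real S \<Longrightarrow> 2 ^ L \<le> (4 * S + 2) ^ 2"
proof -
  have ba: "2 ^ bl B \<le> (2::nat) ^ (bl B - bl A) * 2 ^ bl A" by (simp add: power_add[symmetric] power_increasing)
  have "B < 2 ^ (bl B - bl A) * 2 ^ bl A" using bl_gt[of B] ba by linarith
  also have "\<dots> \<le> 2 ^ (bl B - bl A) * (2 * A)" using bl_double[OF A] by (rule mult_le_mono2)
  finally have "real B \<le> real (2 ^ (bl B - bl A) * (2 * A))" by (simp only: of_nat_le_iff less_imp_le)
  then have "real B \<le> 2 ^ (bl B - bl A) * (2 * real A)" by simp
  then have "real B / real A \<le> 2 ^ (bl B - bl A + 1)" using A by (simp add: divide_le_eq mult_ac)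
  then have "max 1 (real B / real A) \<le> 2 ^ (bl B - bl A + 1)" by (intro max.boundedI one_le_power) auto
  moreover have "real n \<le> 2 ^ bl n"
  proof -
    have "real n \<le> real (2 ^ bl n)" using bl_gt[of n] by (simp only: of_nat_le_iff less_imp_le)
    then show ?thesis by simp
  qed
  ultimately have "real n * max 1 (real B / real A) \<le> 2 ^ bl n * 2 ^ (bl B - bl A + 1)" by (intro mult_mono) auto
  also have "\<dots> = 2 ^ L" unfolding L by (simp add: power_add)
  finally show "real n * max 1 (real B / real A) \<le> 2 ^ L" .
  fix S assume S: "n \<le> S" "real B / real A \<le> real S"
  have n: "2 ^ bl n \<le> 2 * n + 1" using bl_double[of n] by (cases "n = 0") auto
  have B': "B \<le> A * S" using S(2) A by (simp add: divide_le_eq mult.commute flip: of_nat_mult)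
  have "2 ^ (bl B - bl A) \<le> 2 * S + 1"
  proof (cases "bl A \<le> bl B")
    case True
    have "2 ^ (bl B - bl A) * A \<le> 2 ^ (bl B - bl A) * 2 ^ bl A" using bl_gt[of A] by simp
    also have "\<dots> = 2 ^ bl B" using True by (simp flip: power_add)
    also have "\<dots> \<le> 2 * (A * S)" using bl_double[OF B] B' by linarith
    finally have "2 ^ (bl B - bl A) * A \<le> (2 * S) * A" by (simp add: mult_ac)
    then show ?thesis using A by simp
  qed simp
  then have "2 ^ (bl B - bl A) * 2 ^ bl n \<le> (2 * S + 1) * (2 * S + 1)" using n S(1) by (intro mult_le_mono) auto
  then show "2 ^ L \<le> (4 * S + 2) ^ 2" unfolding L by (simp add: power_add power2_eq_square algebra_simps)
qed

text \<open>The error decays like E r^N with r = 1 / R < 1, and a fixed number \<open>K\<close> of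
  extra orders per unit of fuel makes it at most 2^(-L - 1). \<open>K\<close> depends neither on the
  graph nor on \<epsilon>.\<close>

lemma (in approx) fuel_factor:
  obtains K :: nat where "K \<ge> 1" and "\<And>L (n :: nat) \<epsilon>. L \<ge> 1 \<Longrightarrow> \<epsilon> > 0 \<Longrightarrow> real n * max 1 (1 / \<epsilon>) \<le> 2 ^ L \<Longrightarrow>
    err (K * L) * real n * 2 \<le> min \<epsilon> 1 \<and> err (K * L) \<le> 1"
proof -
  define r where "r = 1 / R"
  have r: "0 < r" "r < 1" using R1 by (simp_all add: r_def)
  define E where "E = r / (1 - r) / (1 - \<kappa>1)"
  have E0: "E \<ge> 0" using r k1(2) by (simp add: E_def)
  have err: "err N = E * r ^ N" for N by (simp add: err_def E_def r_def)
  \<comment> \<open>\<theta> absorbs the constant \<open>E\<close>: as L \<ge> 1, one of the L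
    factors \<theta> suffices to make E \<theta> \<le> 1/2.\<close>
  define \<theta> where "\<theta> = 1 / (2 * E + 1)"
  have th: "0 < \<theta>" "\<theta> \<le> 1" "E * \<theta> \<le> 1 / 2" using E0 by (simp_all add: \<theta>_def field_simps)
  obtain k where k: "r ^ k < \<theta> / 2" using real_arch_pow_inv[of "\<theta> / 2" r] th r by auto
  define K where "K = Suc k"
  have rK: "r ^ K \<le> \<theta> / 2" using k r by (simp add: K_def mult_le_one) (smt (verit, best) mult_less_cancel_right2 zero_less_power)
  have "err (K * L) * real n * 2 \<le> min \<epsilon> 1 \<and> err (K * L) \<le> 1"
    if L: "L \<ge> 1" and e: "\<epsilon> > 0" and n: "real n * max 1 (1 / \<epsilon>) \<le> 2 ^ L" for L n :: nat and \<epsilon> :: real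
  proof -
    have "r ^ (K * L) = (r ^ K) ^ L" by (rule power_mult)
    also have "\<dots> \<le> (\<theta> / 2) ^ L" using rK r by (intro power_mono) auto
    also have "\<dots> = \<theta> ^ L / 2 ^ L" by (rule power_divide)
    also have "\<theta> ^ L \<le> \<theta> ^ 1" using th L by (intro power_decreasing) auto
    then have "\<theta> ^ L / 2 ^ L \<le> \<theta> / 2 ^ L" by (simp add: divide_right_mono)
    finally have "err (K * L) \<le> E * (\<theta> / 2 ^ L)" unfolding err using E0 by (rule mult_left_mono)
    also have "\<dots> = (E * \<theta>) / 2 ^ L" by simp
    also have "\<dots> \<le> (1 / 2) / 2 ^ L" using th(3) by (intro divide_right_mono) auto
    finally have err2: "err (K * L) * 2 \<le> 1 / 2 ^ L" by simp
    have m: "min \<epsilon> 1 * max 1 (1 / \<epsilon>) = 1" using e by (auto simp: min_def max_def field_simps)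
    have "real n = real n * (max 1 (1 / \<epsilon>) * min \<epsilon> 1)" using m by (simp add: mult.commute)
    also have "\<dots> \<le> 2 ^ L * min \<epsilon> 1" using mult_right_mono[OF n, of "min \<epsilon> 1"] e by (simp add: mult.assoc)
    finally have "real n \<le> min \<epsilon> 1 * 2 ^ L" by (simp add: mult.commute)
    then have n': "real n / 2 ^ L \<le> min \<epsilon> 1" by (subst pos_divide_le_eq) simp_all
    have "err (K * L) * real n * 2 \<le> real n / 2 ^ L" using mult_right_mono[OF err2, of "real n"] by (simp add: mult_ac)
    moreover have "(1::real) / 2 ^ L \<le> 1" by simp
    ultimately show ?thesis using n' err2 by linarith
  qed
  then show ?thesis using that[of K] by (simp add: K_def)
qed

section \<open>The approximation schemes\<close>

lemma ence_elab: "enc_list (map (\<lambda>(u, v). Node (enc_nat u) (enc_nat v)) es) = ence (elab es)"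
  by (induction es) (auto simp: elab_def)

lemma encodes_graph_degree: "encodes_graph x G \<Longrightarrow> max_degree_le G (2 * size x)"
proof -
  assume "encodes_graph x G"
  then obtain vs es where es: "image_mset (\<lambda>(u, v). Upair u v) (mset es) = edges G"
    and x: "x = Node (enc_list (map enc_nat vs)) (enc_list (map (\<lambda>(u, v). Node (enc_nat u) (enc_nat v)) es))"
    unfolding encodes_graph_def by blast
  have "length es \<le> size x" using enc_list_sizes(1)[of "map (\<lambda>(u, v). Node (enc_nat u) (enc_nat v)) es"] by (simp add: x)
  then show ?thesis using max_degree_le_length[OF es] unfolding max_degree_le_def by fastforce
qed

text \<open>The constants do not depend on \<open>D\<close>, which is left free: it will be a
  constant for the FPTAS and proportional to the input size for the quasi-polynomial scheme.\<close>

lemma (in approx) scheme: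
  fixes b c :: rat
  assumes b: "real_of_rat b = \<beta>" and c: "real_of_rat c = - (real g / real q)"
  obtains K C k s :: nat where
    "\<And>G \<epsilon> x y D. wf_mgraph G \<Longrightarrow> max_degree_le G D \<Longrightarrow> D \<ge> 1 \<Longrightarrow> \<epsilon> > 0 \<Longrightarrow> encodes_graph x G \<Longrightarrow> encodes_rat y \<epsilon> \<Longrightarrow>
      \<exists>z r t L. run (prog p q a K) (Node x y) z t \<and> encodes_rat z r \<and> \<bar>r - Z b c G\<bar> \<le> \<epsilon> * \<bar>Z b c G\<bar> \<and>
        t \<le> C * ((6 * D + 6 * s + 5) ^ (K * L + 2) * (size (Node x y) + nat \<lceil>1 / \<epsilon>\<rceil> + 1)) ^ k \<and>
        2 ^ L \<le> (4 * (size (Node x y) + nat \<lceil>1 / \<epsilon>\<rceil>) + 2) ^ 2"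
proof -
  obtain K where K: "K \<ge> 1" and KL: "\<And>L (n :: nat) \<epsilon>. L \<ge> 1 \<Longrightarrow> \<epsilon> > 0 \<Longrightarrow> real n * max 1 (1 / \<epsilon>) \<le> 2 ^ L \<Longrightarrow>
    err (K * L) * real n * 2 \<le> min \<epsilon> 1 \<and> err (K * L) \<le> 1" by (rule fuel_factor) blast
  define s where "s = p + q + a"
  have "p + q + a < 2 ^ s" unfolding s_def by (rule less_exp)
  then have s: "p < 2 ^ s" "q < 2 ^ s" "a < 2 ^ s" by linarith+
  obtain C k where Ck: "\<And>x. x \<ge> 1 \<Longrightarrow> lisp.Tmain x \<le> C * x ^ k" using lisp.pbd_Tmain unfolding pbd_def by blast
  have "\<exists>z r t L. run (prog p q a K) (Node x y) z t \<and> encodes_rat z r \<and> \<bar>r - Z b c G\<bar> \<le> \<epsilon> * \<bar>Z b c G\<bar> \<and>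
        t \<le> C * ((6 * D + 6 * s + 5) ^ (K * L + 2) * (size (Node x y) + nat \<lceil>1 / \<epsilon>\<rceil> + 1)) ^ k \<and>
        2 ^ L \<le> (4 * (size (Node x y) + nat \<lceil>1 / \<epsilon>\<rceil>) + 2) ^ 2"
    if wf: "wf_mgraph G" and deg: "max_degree_le G D" and D: "D \<ge> 1" and \<epsilon>: "\<epsilon> > 0" and x: "encodes_graph x G" and y: "encodes_rat y \<epsilon>"
    for G \<epsilon> x y D
  proof -
    define S where "S = size (Node x y) + nat \<lceil>1 / \<epsilon>\<rceil>"
    from x obtain vs es where vs: "distinct vs" "set vs = verts G" and es: "image_mset (\<lambda>(u, v). Upair u v) (mset es) = edges G"
      and x: "x = Node (enc_list (map enc_nat vs)) (ence (elab es))"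
      unfolding encodes_graph_def ence_elab by blast
    from y obtain a0 B where B: "B > 0" and y: "y = Node (enc_int a0) (enc_nat B)" and e: "\<epsilon> = of_int a0 / of_nat B"
      unfolding encodes_rat_def by blast
    have a0: "a0 > 0" using \<epsilon> B unfolding e by (simp add: zero_less_divide_iff)
    define A where "A = nat a0"
    have A: "A > 0" "a0 = int A" using a0 by (simp_all add: A_def)
    have y: "y = Node (Node Atom (enc_nat A)) (enc_nat B)" using a0 by (simp add: y enc_int_def A)
    have eR: "real_of_rat \<epsilon> = real A / real B" by (simp add: e A of_rat_divide)
    define ws where "ws = map enc_nat vs"
    define L where "L = (bl B - bl A) + 1 + bl (length ws)"
    have L1: "L \<ge> 1" by (simp add: L_def)
    note fb = fuel_bounds[OF A(1) B L_def]
    have e0: "real_of_rat \<epsilon> > 0" using \<epsilon> by simp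
    have inv: "1 / real_of_rat \<epsilon> = real B / real A" by (simp add: eR)
    have err: "err (K * L) * real (length ws) * 2 \<le> min (real_of_rat \<epsilon>) 1" "err (K * L) \<le> 1"
      using KL[OF L1 e0] fb(1) unfolding inv by auto
    have wsd: "distinct ws" "pin0 \<notin> set ws" "pin1 \<notin> set ws" using vs by (auto simp: ws_def distinct_map inj_on_def)
    have ends: "\<forall>e \<in> set (elab es). fst e \<in> set ws \<and> snd e \<in> set ws"
    proof -
      have "u \<in> verts G \<and> v \<in> verts G" if "(u, v) \<in> set es" for u v
      proof -
        have "Upair u v \<in># edges G" using that unfolding es[symmetric] by force
        then show ?thesis using wf unfolding wf_mgraph_def by fastforce
      qed
      then show ?thesis by (auto simp: elab_def ws_def vs)
    qed
    define V where "V = vloop p q a (K * L) (ebase p q (elab es)) ws (deloop (elab es))"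
    have vc: "vloop_ok p q a (K * L) ws (deloop (elab es))" "snd V > 0"
      "\<bar>real (fst V) / real (snd V) - zr (elab es) {} (set ws)\<bar> \<le> real_of_rat \<epsilon> * \<bar>zr (elab es) {} (set ws)\<bar>"
      using vloop_correct[OF wsd ends err] unfolding V_def by auto
    have Zz: "real_of_rat (Z b c G) = zr (elab es) {} (set ws)"
      using Z_eq_zs[OF wf vs(2) es, of b c] unfolding b c ws_def .
    define X where "X = (6 * D + 6 * s + 5) ^ (K * L + 2) * (S + 1)"
    have sx: "size x \<le> S" "size y \<le> S" by (simp_all add: S_def)
    have S1: "\<forall>v \<in> set ws. size v \<le> S"
    proof
      fix v assume "v \<in> set ws"
      then have "size v \<le> size (enc_list ws)" by (rule enc_list_sizes)
      then show "size v \<le> S" using sx(1) by (simp add: x ws_def)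
    qed
    have S2: "lsz S (elab es)"
      unfolding lsz_def
    proof
      fix e assume "e \<in> set (elab es)"
      then have "Node (fst e) (snd e) \<in> set (map (\<lambda>(x, y). Node x y) (elab es))" by (force simp: case_prod_unfold)
      then have "size (Node (fst e) (snd e)) \<le> size (ence (elab es))" unfolding ence_def by (rule enc_list_sizes)
      then show "size (fst e) \<le> S \<and> size (snd e) \<le> S" using sx(1) by (simp add: x)
    qed
    have S3: "length ws \<le> S" using enc_list_sizes(1)[of ws] sx(1) by (simp add: x ws_def)
    have S4: "length (elab es) \<le> S" using enc_list_sizes(1)[of "map (\<lambda>(x, y). Node x y) (elab es)"] sx(1) by (simp add: x ence_def)
    have S5: "bl B \<le> S" using spine_le_size[of "enc_nat B"] sx(2) by (simp add: y)
    have S6: "3 \<le> S" using B by (simp add: S_def x y enc_nat_pos)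
    have "lisp.returns p q a K 0 (Node (Node (enc_list ws) (ence (elab es))) (Node (Node Atom (enc_nat A)) (enc_nat B)))
      (Node (Node Atom (enc_nat (fst V))) (enc_nat (snd V))) (lisp.Tmain X)"
      unfolding V_def
      by (rule lisp.fn_main[OF s D K L_def S1 S2 S3 S4 S5 S6 wsd(2,3) dgb_elab[OF wf es deg] vc(1)]) (simp add: X_def)
    then obtain t where t: "t \<le> lisp.Tmain X" "lisp.fn p q a K 0 (Node x y) = Some (Node (Node Atom (enc_nat (fst V))) (enc_nat (snd V)), t)"
      unfolding x y ws_def by (rule lisp.returnsE)
    have run: "run (prog p q a K) (Node x y) (Node (Node Atom (enc_nat (fst V))) (enc_nat (snd V))) t"
      using t(2) unfolding lisp.fn_def evr_Some run_def by (simp add: prog_def)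
    define r where "r = (of_int (int (fst V)) / of_nat (snd V) :: rat)"
    have enc: "encodes_rat (Node (Node Atom (enc_nat (fst V))) (enc_nat (snd V))) r"
      unfolding encodes_rat_def r_def using vc(2) by (intro exI[of _ "int (fst V)"] exI[of _ "snd V"]) (simp add: enc_int_def)
    have rR: "real_of_rat r = real (fst V) / real (snd V)" by (simp add: r_def of_rat_divide)
    have ab: "real_of_rat \<bar>z\<bar> = \<bar>real_of_rat z\<bar>" for z by (simp add: abs_if of_rat_minus)
    have "real_of_rat \<bar>r - Z b c G\<bar> \<le> real_of_rat (\<epsilon> * \<bar>Z b c G\<bar>)"
      unfolding ab of_rat_diff of_rat_mult Zz rR by (rule vc(3))
    then have app: "\<bar>r - Z b c G\<bar> \<le> \<epsilon> * \<bar>Z b c G\<bar>" by (simp only: of_rat_less_eq)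
    have X1: "X \<ge> 1" unfolding X_def by (simp only: One_nat_def Suc_le_eq) simp
    have tb: "t \<le> C * X ^ k" using t(1) Ck[OF X1] by linarith
    have "real B / real A \<le> real S"
    proof -
      have "real_of_rat (1 / \<epsilon>) \<le> real_of_rat (of_nat (nat \<lceil>1 / \<epsilon>\<rceil>))"
        unfolding of_rat_less_eq by (rule of_nat_ceiling)
      then show ?thesis unfolding inv[symmetric] by (simp add: of_rat_divide S_def)
    qed
    then have "2 ^ L \<le> (4 * S + 2) ^ 2" by (rule fb(2)[OF S3])
    then show ?thesis using run enc app tb unfolding X_def S_def by blast
  qed
  then show ?thesis by (rule that)
qed

text \<open>A constant base \<open>A\<close> is at most 2^(bl A), so A^L is at most a fixed power of
  2^L, and 2^L is quadratic in the input size.\<close>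

lemma fptas_bound:
  fixes A C K k L S :: nat
  assumes "2 ^ L \<le> (4 * S + 2) ^ 2"
  shows "C * (A ^ (K * L + 2) * (S + 1)) ^ k \<le> C * (A\<^sup>2 * ((4 * S + 2)\<^sup>2) ^ (bl A * K) * (S + 1)) ^ k"
proof -
  have "A ^ (K * L) \<le> (2 ^ bl A) ^ (K * L)" using bl_gt[of A] by (intro power_mono) auto
  also have "\<dots> = (2 ^ L) ^ (bl A * K)" by (simp flip: power_mult add: mult_ac)
  also have "\<dots> \<le> ((4 * S + 2)\<^sup>2) ^ (bl A * K)" using assms by (intro power_mono) auto
  finally have "A\<^sup>2 * A ^ (K * L) \<le> A\<^sup>2 * ((4 * S + 2)\<^sup>2) ^ (bl A * K)" by (rule mult_le_mono2)
  then have "A ^ (K * L + 2) \<le> A\<^sup>2 * ((4 * S + 2)\<^sup>2) ^ (bl A * K)" unfolding power_add by (simp only: mult.commute)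
  then show ?thesis by (intro mult_le_mono2 power_mono mult_le_mono1) auto
qed

text \<open>Base and exponent are both turned into functions of u = ln S: L is linear in u because 4
  S + 2 \<le> 6 S, and the base is at most (17 + 6 s) S. The exponent of e is then quadratic in
  u.\<close>

lemma quasipoly_bound:
  fixes C K k s S L :: nat
  assumes L: "2 ^ L \<le> (4 * S + 2) ^ 2" and S: "S \<ge> 1"
  defines "u \<equiv> ln (real S)" and "c1 \<equiv> ln (17 + 6 * real s)"
  shows "real (C * ((6 * (2 * S) + 6 * s + 5) ^ (K * L + 2) * (S + 1)) ^ k)
    \<le> exp (ln (real C + 1) + real k * ((real K * (2 / ln 2 * (ln 6 + u)) + 2) * (c1 + u) + (ln 2 + u)))"
proof -
  have u: "u \<ge> 0" "exp u = real S" using S by (auto simp: u_def)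
  have c1: "c1 \<ge> 0" "exp c1 = 17 + 6 * real s" by (auto simp: c1_def)
  have Lb: "real L \<le> 2 / ln 2 * (ln 6 + u)"
  proof -
    have "real (2 ^ L) \<le> real ((4 * S + 2) ^ 2)" using L by (simp only: of_nat_le_iff)
    also have "\<dots> \<le> (6 * real S) ^ 2" unfolding of_nat_power using S by (intro power_mono) auto
    finally have "ln (2 ^ L) \<le> ln ((6 * real S) ^ 2)" using S by (subst ln_le_cancel_iff) auto
    also have "ln ((6 * real S) ^ 2) = 2 * ln (6 * real S)" using S by (subst ln_realpow) auto
    also have "ln (6 * real S) = ln 6 + u" using S by (simp add: ln_mult u_def)
    finally have "real L * ln 2 \<le> 2 * (ln 6 + u)" by (simp add: ln_realpow)
    then show ?thesis by (simp add: field_simps)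
  qed
  have A: "real (6 * (2 * S) + 6 * s + 5) \<le> exp (c1 + u)"
  proof -
    have "6 * real s + 5 \<le> (6 * real s + 5) * real S" using S by (intro mult_le_cancel_left1[THEN iffD2]) auto
    then show ?thesis by (simp add: exp_add u c1 algebra_simps)
  qed
  have "real (6 * (2 * S) + 6 * s + 5) ^ (K * L + 2) \<le> exp (c1 + u) ^ (K * L + 2)" using A by (intro power_mono) auto
  also have "\<dots> = exp (real (K * L + 2) * (c1 + u))" by (rule exp_of_nat_mult[symmetric])
  also have "\<dots> \<le> exp ((real K * (2 / ln 2 * (ln 6 + u)) + 2) * (c1 + u))"
  proof -
    have "real (K * L + 2) = real K * real L + 2" by simp
    also have "\<dots> \<le> real K * (2 / ln 2 * (ln 6 + u)) + 2" by (intro add_right_mono mult_left_mono Lb) simp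
    finally show ?thesis unfolding exp_le_cancel_iff using u c1 by (intro mult_right_mono) auto
  qed
  finally have 1: "real (6 * (2 * S) + 6 * s + 5) ^ (K * L + 2) \<le> exp ((real K * (2 / ln 2 * (ln 6 + u)) + 2) * (c1 + u))" .
  have 2: "real S + 1 \<le> exp (ln 2 + u)" using S by (simp add: exp_add u)
  have 3: "real C \<le> exp (ln (real C + 1))" by simp
  have "real (6 * (2 * S) + 6 * s + 5) ^ (K * L + 2) * (real S + 1)
     \<le> exp ((real K * (2 / ln 2 * (ln 6 + u)) + 2) * (c1 + u)) * exp (ln 2 + u)"
    by (intro mult_mono 1 2) auto
  also have "\<dots> = exp ((real K * (2 / ln 2 * (ln 6 + u)) + 2) * (c1 + u) + (ln 2 + u))" by (rule exp_add[symmetric])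
  finally have "(real (6 * (2 * S) + 6 * s + 5) ^ (K * L + 2) * (real S + 1)) ^ k
     \<le> exp ((real K * (2 / ln 2 * (ln 6 + u)) + 2) * (c1 + u) + (ln 2 + u)) ^ k" by (intro power_mono) auto
  also have "\<dots> = exp (real k * ((real K * (2 / ln 2 * (ln 6 + u)) + 2) * (c1 + u) + (ln 2 + u)))" by (rule exp_of_nat_mult[symmetric])
  finally have "real C * (real (6 * (2 * S) + 6 * s + 5) ^ (K * L + 2) * (real S + 1)) ^ k
     \<le> exp (ln (real C + 1)) * exp (real k * ((real K * (2 / ln 2 * (ln 6 + u)) + 2) * (c1 + u) + (ln 2 + u)))"
    by (intro mult_mono 3) auto
  then show ?thesis
    unfolding exp_add[symmetric] of_nat_mult[of C] of_nat_power[of _ k] of_nat_mult[of _ "S + 1"] of_nat_power[of _ "K * L + 2"] of_nat_add[of S] of_nat_1 .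
qed

lemma common_denominator:
  fixes b c :: rat
  assumes "b > 0" "c < 0"
  obtains p q g :: nat where "p > 0" "q > 0" "b = of_nat p / of_nat q" "c = - (of_nat g / of_nat q)"
proof -
  obtain m n where b: "b = of_int m / of_int n" "n > 0" by (metis quotient_of_denom_pos quotient_of_div surj_pair)
  obtain m' n' where c: "c = of_int m' / of_int n'" "n' > 0" by (metis quotient_of_denom_pos quotient_of_div surj_pair)
  have m: "m > 0" "m' < 0" using assms b c by (simp_all add: zero_less_divide_iff divide_less_0_iff)
  show ?thesis
  proof (rule that[of "nat (m * n')" "nat (n * n')" "nat (- m' * n)"])
    show "0 < nat (m * n')" "0 < nat (n * n')" using m b c by (simp_all add: mult_neg_pos)
    show "b = of_nat (nat (m * n')) / of_nat (nat (n * n'))" using m b c by (simp add: of_nat_nat)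
    have "0 \<le> - m' * n" using m b by (simp add: mult_nonpos_nonneg)
    then show "c = - (of_nat (nat (- m' * n)) / of_nat (nat (n * n')))" using m b c by (simp add: of_nat_nat)
  qed
qed

lemma schemes:
  fixes b c :: rat
  assumes b: "1 < b" and c: "c < 0" and bc: "real_of_rat (b + c) > 2 - g (real_of_rat b)"
  shows "(\<forall>\<Delta> > 0. has_FPTAS {G. wf_mgraph G \<and> max_degree_le G \<Delta>} (Z b c)) \<and> has_quasipoly_AS {G. wf_mgraph G} (Z b c)"
proof -
  have b0: "b > 0" using b by linarith
  obtain p q h :: nat where pq: "p > 0" "q > 0" "b = of_nat p / of_nat q" "c = - (of_nat h / of_nat q)"
    by (rule common_denominator[OF b0 c])
  have b1: "1 < real_of_rat b" "real_of_rat c < 0" using b c by simp_all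
  have bc': "real_of_rat b + real_of_rat c > 2 - g (real_of_rat b)" using bc by (simp add: of_rat_add)
  obtain M q' k1 k2 r where zf: "zero_free (real_of_rat b) M q' k1 k2 r" and M: "1 / real_of_rat b - real_of_rat c < M"
    by (rule zero_free_params[OF b1 bc'])
  have bR: "real_of_rat b = real p / real q" and cR: "real_of_rat c = - (real h / real q)"
    by (simp_all add: pq of_rat_divide of_rat_minus)
  interpret A: approx "real_of_rat b" M q' k1 k2 r p q h
    using zf pq bR M cR by (intro approx.intro approx_axioms.intro) auto
  obtain K C k s :: nat where sch:
    "\<And>G \<epsilon> x y D. wf_mgraph G \<Longrightarrow> max_degree_le G D \<Longrightarrow> D \<ge> 1 \<Longrightarrow> \<epsilon> > 0 \<Longrightarrow> encodes_graph x G \<Longrightarrow> encodes_rat y \<epsilon> \<Longrightarrow>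
      \<exists>z r t L. run (prog p q A.a K) (Node x y) z t \<and> encodes_rat z r \<and> \<bar>r - Z b c G\<bar> \<le> \<epsilon> * \<bar>Z b c G\<bar> \<and>
        t \<le> C * ((6 * D + 6 * s + 5) ^ (K * L + 2) * (size (Node x y) + nat \<lceil>1 / \<epsilon>\<rceil> + 1)) ^ k \<and>
        2 ^ L \<le> (4 * (size (Node x y) + nat \<lceil>1 / \<epsilon>\<rceil>) + 2) ^ 2"
    by (rule A.scheme[OF refl cR]) blast
  have "has_FPTAS {G. wf_mgraph G \<and> max_degree_le G \<Delta>} (Z b c)" if D: "\<Delta> > 0" for \<Delta>
  proof -
    define A where "A = 6 * \<Delta> + 6 * s + 5"
    define pl where "pl = [:real C:] * ([:real A ^ 2:] * ([:2, 4:] ^ 2) ^ (bl A * K) * [:1, 1:]) ^ k"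
    have pl: "poly pl (real S) = real (C * (A\<^sup>2 * ((4 * S + 2)\<^sup>2) ^ (bl A * K) * (S + 1)) ^ k)" for S
      by (simp only: pl_def poly_mult poly_power poly_pCons poly_0 of_nat_mult of_nat_power of_nat_add of_nat_numeral of_nat_1
            mult_zero_right add_0_right mult_1_right) (simp only: add.commute mult.commute)
    have "approximates (prog p q A.a K) {G. wf_mgraph G \<and> max_degree_le G \<Delta>} (Z b c) (\<lambda>N. poly pl (real N))"
      unfolding approximates_def
    proof (intro ballI allI impI)
      fix G \<epsilon> x y assume G: "G \<in> {G. wf_mgraph G \<and> max_degree_le G \<Delta>}" and e: "0 < (\<epsilon> :: rat)" and xy: "encodes_graph x G \<and> encodes_rat y \<epsilon>"
      define S where "S = size (Node x y) + nat \<lceil>1 / \<epsilon>\<rceil>"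
      from G D obtain z r t L where *: "run (prog p q A.a K) (Node x y) z t" "encodes_rat z r" "\<bar>r - Z b c G\<bar> \<le> \<epsilon> * \<bar>Z b c G\<bar>"
        "t \<le> C * (A ^ (K * L + 2) * (S + 1)) ^ k" "2 ^ L \<le> (4 * S + 2) ^ 2"
        using sch[of G \<Delta> \<epsilon> x y] e xy unfolding S_def A_def by auto
      have "real t \<le> poly pl (real S)" unfolding pl of_nat_le_iff using *(4) fptas_bound[OF *(5)] by (rule order_trans)
      then show "\<exists>z r t. run (prog p q A.a K) (Node x y) z t \<and> encodes_rat z r \<and> \<bar>r - Z b c G\<bar> \<le> \<epsilon> * \<bar>Z b c G\<bar> \<and>
          real t \<le> poly pl (real (size (Node x y) + nat \<lceil>1 / \<epsilon>\<rceil>))" using *(1-3) unfolding S_def by blast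
    qed
    then show ?thesis unfolding has_FPTAS_def by blast
  qed
  moreover have "has_quasipoly_AS {G. wf_mgraph G} (Z b c)"
  proof -
    define pl where "pl = [:ln (real C + 1):] + [:real k:] * (([:real K * (2 / ln 2):] * [:ln 6, 1:] + [:2:]) * [:ln (17 + 6 * real s), 1:] + [:ln 2, 1:])"
    have pl: "poly pl u = ln (real C + 1) + real k * ((real K * (2 / ln 2 * (ln 6 + u)) + 2) * (ln (17 + 6 * real s) + u) + (ln 2 + u))" for u
      by (simp add: pl_def algebra_simps add_divide_distrib)
    have "approximates (prog p q A.a K) {G. wf_mgraph G} (Z b c) (\<lambda>N. exp (poly pl (ln (real N))))"
      unfolding approximates_def
    proof (intro ballI allI impI)
      fix G \<epsilon> x y assume G: "G \<in> {G. wf_mgraph G}" and e: "0 < (\<epsilon> :: rat)" and xy: "encodes_graph x G \<and> encodes_rat y \<epsilon>"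
      define S where "S = size (Node x y) + nat \<lceil>1 / \<epsilon>\<rceil>"
      have S1: "S \<ge> 1" by (simp add: S_def)
      \<comment> \<open>Without a degree bound, the length of the edge list still limits every
        degree.\<close>
      have "max_degree_le G (2 * size x)" using xy encodes_graph_degree by blast
      then have d: "max_degree_le G (2 * S)" unfolding max_degree_le_def S_def by fastforce
      from G S1 obtain z r t L where *: "run (prog p q A.a K) (Node x y) z t" "encodes_rat z r" "\<bar>r - Z b c G\<bar> \<le> \<epsilon> * \<bar>Z b c G\<bar>"
        "t \<le> C * ((6 * (2 * S) + 6 * s + 5) ^ (K * L + 2) * (S + 1)) ^ k" "2 ^ L \<le> (4 * S + 2) ^ 2"
        using sch[OF _ d, of \<epsilon> x y] e xy unfolding S_def by auto
      have "real t \<le> real (C * ((6 * (2 * S) + 6 * s + 5) ^ (K * L + 2) * (S + 1)) ^ k)" using *(4) by (simp only: of_nat_le_iff)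
      also have "\<dots> \<le> exp (poly pl (ln (real S)))" unfolding pl by (rule quasipoly_bound[OF *(5) S1])
      finally show "\<exists>z r t. run (prog p q A.a K) (Node x y) z t \<and> encodes_rat z r \<and> \<bar>r - Z b c G\<bar> \<le> \<epsilon> * \<bar>Z b c G\<bar> \<and>
          real t \<le> exp (poly pl (ln (real (size (Node x y) + nat \<lceil>1 / \<epsilon>\<rceil>))))" using *(1-3) unfolding S_def by blast
    qed
    then show ?thesis unfolding has_quasipoly_AS_def by blast
  qed
  ultimately show ?thesis by blast
qed

lemma approximates_cong: "(\<And>G. G \<in> X \<Longrightarrow> F G = F' G) \<Longrightarrow> approximates P X F T = approximates P X F' T"
  unfolding approximates_def by simp

theorem theorem6:
  fixes \<beta> \<gamma> :: rat
  assumes "1 < max \<beta> \<gamma>"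
    and "min \<beta> \<gamma> < 0"
    and "real_of_rat (\<beta> + \<gamma>) > 2 - g (real_of_rat (max \<beta> \<gamma>))"
  shows "(\<forall>\<Delta> > 0. has_FPTAS {G. wf_mgraph G \<and> max_degree_le G \<Delta>} (Z \<beta> \<gamma>)) \<and>
         has_quasipoly_AS {G. wf_mgraph G} (Z \<beta> \<gamma>)"
proof (cases "\<gamma> \<le> \<beta>")
  case True
  then show ?thesis using assms by (intro schemes) (simp_all add: max_def min_def split: if_splits)
next
  case False
  then have s: "(\<forall>\<Delta> > 0. has_FPTAS {G. wf_mgraph G \<and> max_degree_le G \<Delta>} (Z \<gamma> \<beta>)) \<and> has_quasipoly_AS {G. wf_mgraph G} (Z \<gamma> \<beta>)"
    using assms by (intro schemes) (simp_all add: max_def min_def add.commute split: if_splits)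
  have "approximates P {G. wf_mgraph G \<and> max_degree_le G \<Delta>} (Z \<beta> \<gamma>) T = approximates P {G. wf_mgraph G \<and> max_degree_le G \<Delta>} (Z \<gamma> \<beta>) T"
    "approximates P {G. wf_mgraph G} (Z \<beta> \<gamma>) T = approximates P {G. wf_mgraph G} (Z \<gamma> \<beta>) T" for P \<Delta> T
    by (auto intro!: approximates_cong Z_swap)
  then show ?thesis using s unfolding has_FPTAS_def has_quasipoly_AS_def by simp
qed

end
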